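(* Let $L\in\mathbb{N}$, let $(T_n)_{n\geq 2}$ be invertible and $(V_n)_{n\geq1}$ self-adjoint complex $L\times L$ matrices, and let $H$ be the semi-infinite Jacobi matrix on $\ell^2(\mathbb{N})\otimes\mathbb{C}^L$ given by $(H\phi)_n=T_{n+1}\phi_{n+1}+V_n\phi_n+T_n^*\phi_{n-1}$ with $\phi_0=0$, assumed to be in the limit point case (essentially self-adjoint on finitely supported sequences). Let $N\in\mathbb{N}$, let $W_1,\ldots,W_N$ be real positive semi-definite $L\times L$ matrices, let $\pi_n$ denote the embedding of $\mathbb{C}^L$ onto the $n$th site, and for $\mu\in\mathbb{R}$ set $H(\mu)=H+\mu\sum_{n=1}^N\pi_nW_n\pi_n^*$. Let $H^N(\mu)$ be the restriction of $H(\mu)$ to the first $N$ sites (the $NL\times NL$ block tridiagonal matrix with diagonal blocks $V_n+\mu W_n$, off-diagonal blocks $T_{n+1}$, $T_{n+1}^*$, and Dirichlet boundary conditions at both ends). Let $\rho(\mu)(\Delta)=\pi_1^*\chi_\Delta(H(\mu))\pi_1$ be the matrix-valued spectral measure of $H(\mu)$ at the first site, and for an interval $I=[\mu_0,\mu_1]$ set $\overline{\rho}=\int_I d\mu\,\mathrm{Tr}(\rho(\mu))$. Suppose that $W_n>0$ and $W_{n+1}>0$ for some $n\in\{1,\ldots,N-1\}$, and let $E\in\mathbb{R}$ and $I$ be such that $2L$ eigenvalues of $H^N(\mu)$ (counted with multiplicity) pass by $E$ as $\mu$ varies in $I$. Then $\overline{\rho}$ is equivalent to the Lebesgue measure in a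 neighborhood of $E$.
   Context: The eigenvalues of $H^N(\mu)$ are non-decreasing in $\mu$; "pass by $E$" means crossing the level $E$ as $\mu$ increases through $I$. Equivalence of measures means mutual absolute continuity. *)

theory Defs
  imports "HOL-Analysis.Analysis" "Jordan_Normal_Form.Char_Poly"
begin

text \<open>A sequence phi is a function from sites n (n >= 1) and components j (j < L)
  to complex numbers; phi 0 = 0 encodes the boundary condition phi_0 = 0.\<close>

type_synonym cseq = "nat \<Rightarrow> nat \<Rightarrow> complex"

definition valid_seq :: "nat \<Rightarrow> cseq \<Rightarrow> bool" where
  "valid_seq L \<phi> \<longleftrightarrow> (\<forall>n j. (n = 0 \<or> L \<le> j) \<longrightarrow> \<phi> n j = 0)"

definition site_sqnorm :: "nat \<Rightarrow> cseq \<Rightarrow> nat \<Rightarrow> real" where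
  "site_sqnorm L \<phi> n = (\<Sum>j<L. (cmod (\<phi> n j))^2)"

definition l2 :: "nat \<Rightarrow> cseq \<Rightarrow> bool" where
  "l2 L \<phi> \<longleftrightarrow> valid_seq L \<phi> \<and> summable (site_sqnorm L \<phi>)"

definition l2norm :: "nat \<Rightarrow> cseq \<Rightarrow> real" where
  "l2norm L \<phi> = sqrt (\<Sum>n. site_sqnorm L \<phi> n)"

definition l2inner :: "nat \<Rightarrow> cseq \<Rightarrow> cseq \<Rightarrow> complex" where
  "l2inner L \<phi> \<psi> = (\<Sum>n. \<Sum>j<L. cnj (\<phi> n j) * \<psi> n j)"

definition finsupp :: "nat \<Rightarrow> cseq \<Rightarrow> bool" where
  "finsupp L \<phi> \<longleftrightarrow> valid_seq L \<phi> \<and> (\<exists>M. \<forall>n>M. \<forall>j. \<phi> n j = 0)"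

definition jac :: "nat \<Rightarrow> (nat \<Rightarrow> complex mat) \<Rightarrow> (nat \<Rightarrow> complex mat) \<Rightarrow> cseq \<Rightarrow> cseq" where
  "jac L T V \<phi> = (\<lambda>n j. if n = 0 \<or> L \<le> j then 0 else
      (\<Sum>k<L. T (Suc n) $$ (j,k) * \<phi> (Suc n) k + V n $$ (j,k) * \<phi> n k
              + (if 2 \<le> n then cnj (T n $$ (k,j)) * \<phi> (n - 1) k else 0)))"

definition min_graph :: "nat \<Rightarrow> (nat \<Rightarrow> complex mat) \<Rightarrow> (nat \<Rightarrow> complex mat) \<Rightarrow> (cseq \<times> cseq) set" where
  "min_graph L T V = {(\<phi>, jac L T V \<phi>) | \<phi>. finsupp L \<phi>}"

definition graph_closure :: "nat \<Rightarrow> (cseq \<times> cseq) set \<Rightarrow> (cseq \<times> cseq) set" where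
  "graph_closure L G = {(\<phi>, \<psi>). l2 L \<phi> \<and> l2 L \<psi> \<and>
     (\<forall>e>0. \<exists>(a, b)\<in>G. l2norm L (\<lambda>n j. \<phi> n j - a n j) < e \<and> l2norm L (\<lambda>n j. \<psi> n j - b n j) < e)}"

definition adjoint_graph :: "nat \<Rightarrow> (cseq \<times> cseq) set \<Rightarrow> (cseq \<times> cseq) set" where
  "adjoint_graph L G = {(\<psi>, \<eta>). l2 L \<psi> \<and> l2 L \<eta> \<and>
     (\<forall>(\<phi>, c)\<in>G. l2inner L c \<psi> = l2inner L \<phi> \<eta>)}"

text \<open>Essential self-adjointness (limit point case): the closure of the operator
  on finitely supported sequences is self-adjoint, i.e. equals its adjoint
  (the adjoint of the closure equals the adjoint of the operator).\<close>

definition ess_self_adjoint :: "nat \<Rightarrow> (cseq \<times> cseq) set \<Rightarrow> bool" where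
  "ess_self_adjoint L G \<longleftrightarrow> graph_closure L G = adjoint_graph L G"

definition site1_vec :: "nat \<Rightarrow> cseq" where
  "site1_vec i = (\<lambda>n j. if n = 1 \<and> j = i then 1 else 0)"

text \<open>rho i is the diagonal entry (i,i) of the matrix-valued spectral measure
  pi_1^* chi_Delta(A) pi_1 of the self-adjoint operator A with graph G, i.e. the
  spectral measure of the vector pi_1 e_i, characterised by its Stieltjes transform
  < pi_1 e_i, (A - z)^{-1} pi_1 e_i > = int 1/(x - z) d rho_i(x) for non-real z.\<close>

definition site1_spectral_diag :: "nat \<Rightarrow> (cseq \<times> cseq) set \<Rightarrow> (nat \<Rightarrow> real measure) \<Rightarrow> bool" where
  "site1_spectral_diag L G \<rho> \<longleftrightarrow> (\<forall>i<L. sets (\<rho> i) = sets borel \<and> finite_measure (\<rho> i) \<and>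
     (\<forall>z. Im z \<noteq> 0 \<longrightarrow> (\<forall>\<psi> \<eta>. (\<psi>, \<eta>) \<in> G \<longrightarrow>
          (\<forall>n j. \<eta> n j - z * \<psi> n j = site1_vec i n j) \<longrightarrow>
          l2inner L (site1_vec i) \<psi> = (\<integral>x. inverse (complex_of_real x - z) \<partial>\<rho> i))))"

definition hermitian_mat :: "nat \<Rightarrow> complex mat \<Rightarrow> bool" where
  "hermitian_mat L A \<longleftrightarrow> A \<in> carrier_mat L L \<and> (\<forall>i<L. \<forall>j<L. A $$ (i,j) = cnj (A $$ (j,i)))"

definition quad_form :: "nat \<Rightarrow> complex mat \<Rightarrow> (nat \<Rightarrow> complex) \<Rightarrow> complex" where
  "quad_form L A v = (\<Sum>i<L. \<Sum>j<L. cnj (v i) * A $$ (i,j) * v j)"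

definition real_psd :: "nat \<Rightarrow> complex mat \<Rightarrow> bool" where
  "real_psd L A \<longleftrightarrow> hermitian_mat L A \<and> (\<forall>i<L. \<forall>j<L. Im (A $$ (i,j)) = 0) \<and>
     (\<forall>v. 0 \<le> Re (quad_form L A v))"

definition pos_def :: "nat \<Rightarrow> complex mat \<Rightarrow> bool" where
  "pos_def L A \<longleftrightarrow> hermitian_mat L A \<and> (\<forall>v. (\<exists>i<L. v i \<noteq> 0) \<longrightarrow> 0 < Re (quad_form L A v))"

definition Vmu :: "nat \<Rightarrow> (nat \<Rightarrow> complex mat) \<Rightarrow> (nat \<Rightarrow> complex mat) \<Rightarrow> real \<Rightarrow> nat \<Rightarrow> complex mat" where
  "Vmu N V W \<mu> n = (if 1 \<le> n \<and> n \<le> N then V n + complex_of_real \<mu> \<cdot>\<^sub>m W n else V n)"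

text \<open>The NL x NL restriction H^N(mu) to the first N sites (Dirichlet b.c.);
  row index r corresponds to site r div L + 1, component r mod L.\<close>
definition HN :: "nat \<Rightarrow> nat \<Rightarrow> (nat \<Rightarrow> complex mat) \<Rightarrow> (nat \<Rightarrow> complex mat) \<Rightarrow> (nat \<Rightarrow> complex mat) \<Rightarrow> real \<Rightarrow> complex mat" where
  "HN L N T V W \<mu> = mat (N * L) (N * L) (\<lambda>(r, c).
     (let a = r div L + 1; i = r mod L; b = c div L + 1; k = c mod L in
      if a = b then Vmu N V W \<mu> a $$ (i,k)
      else if b = a + 1 then T (a + 1) $$ (i,k)
      else if a = b + 1 then cnj (T a $$ (k,i))
      else 0))"

text \<open>Number of eigenvalues (with algebraic multiplicity) that are <= x, and the
  k-th smallest eigenvalue (k >= 1), for a Hermitian matrix.\<close>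
definition ev_count_le :: "complex mat \<Rightarrow> real \<Rightarrow> nat" where
  "ev_count_le A x = (\<Sum>a\<in>{a. poly (char_poly A) a = 0 \<and> Re a \<le> x}. order a (char_poly A))"

definition kth_eig :: "complex mat \<Rightarrow> nat \<Rightarrow> real" where
  "kth_eig A k = Inf {x. k \<le> ev_count_le A x}"

end

theory Submission
  imports Defs "HOL-Complex_Analysis.Great_Picard"
begin

text \<open>Let \<open>H\<^sup>K(\<mu>)\<close> be the truncation to \<open>K > N\<close> sites, with eigenvalues \<open>d\<^sub>k(\<mu>)\<close>, and let \<open>z = x + i\<epsilon>\<close>.
  Since \<open>Im 1/(d - z)\<close> is the derivative of \<open>arctan ((d - x)/\<epsilon>)\<close>, the integral over \<open>I\<close> of \<open>Im tr (W (H\<^sup>K(\<mu>) - z)\<^sup>-\<^sup>1)\<close>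
  is the change of the sum of \<open>arctan ((d\<^sub>k(\<mu>) - x)/\<epsilon>)\<close> over \<open>I\<close>. It is at most \<open>N L \<pi>\<close>, because \<open>W\<close> acts on \<open>N\<close>
  sites only. Replacing \<open>H\<^sup>N(\<mu>)\<close> by \<open>H\<^sup>K(\<mu>)\<close> amounts to a Hermitian correction of rank \<open>L\<close> which does not depend on
  \<open>\<mu>\<close> (a Schur complement), so at least \<open>2L - L\<close> eigenvalues of \<open>H\<^sup>K(\<mu>)\<close> still pass by each level near \<open>E\<close>, and the
  integral is at least \<open>\<pi>/2\<close>. Eigenvectors solve a three term recursion with invertible coefficients, hence
  their size at site 1 is comparable to their size at two neighbouring sites where \<open>W\<close> is positive definite,
  so the averaged Green function at site 1 also has two-sided bounds, uniformly in \<open>K\<close>, in \<open>x\<close> near \<open>E\<close> and in small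
  \<open>\<epsilon>\<close>. In the limit point case these pass to \<open>K \<rightarrow> \<infinity>\<close>, so the averaged measure smoothed by the Poisson kernel
  has density bounded above and below near \<open>E\<close>.\<close>

section \<open>Hermitian matrices as functions\<close>

text \<open>The Schur complement exists only off the eigenvalues of the lower block, so crossings of
  the large truncation are counted outside a finite set of levels that depends on K. For this reason
  the change of the trace is written as an integral of differences of counting functions, where
  finite sets disappear and the bounds become uniform in K. Eigenvalue branches are never followed
  in \<mu>: only traces are differentiated, and these see neither crossings nor the choice of
  eigenbasis. Positivity is asked for at two neighbouring sites because two adjacent blocks
  determine a solution of the recursion, whereas the Dirichlet condition lets the first block alone
  determine it. The other obstacle is the limit in K: the hypothesis on \<rho> speaks only about
  vectors that already lie in the closed graph, so resolvent vectors have to be constructed there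
  before any information about \<rho> is obtained. All constants are crude, since equivalence of
  measures is a statement about null sets.\<close>

definition ip :: "nat \<Rightarrow> (nat \<Rightarrow> complex) \<Rightarrow> (nat \<Rightarrow> complex) \<Rightarrow> complex" where
  "ip n x y = (\<Sum>r<n. cnj (x r) * y r)"

definition sqn :: "nat \<Rightarrow> (nat \<Rightarrow> complex) \<Rightarrow> real" where
  "sqn n x = (\<Sum>r<n. (cmod (x r))\<^sup>2)"

text \<open>Vectors and matrices are total functions and the size is a separate argument. Passing to
  an upper left block or to another truncation then changes only n.\<close>

definition mv :: "nat \<Rightarrow> (nat \<Rightarrow> nat \<Rightarrow> complex) \<Rightarrow> (nat \<Rightarrow> complex) \<Rightarrow> nat \<Rightarrow> complex" where
  "mv n a x r = (\<Sum>s<n. a r s * x s)"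

definition herm :: "nat \<Rightarrow> (nat \<Rightarrow> nat \<Rightarrow> complex) \<Rightarrow> bool" where
  "herm n a \<longleftrightarrow> (\<forall>r<n. \<forall>s<n. a r s = cnj (a s r))"

definition orthon :: "nat \<Rightarrow> nat \<Rightarrow> (nat \<Rightarrow> nat \<Rightarrow> complex) \<Rightarrow> bool" where
  "orthon n k u \<longleftrightarrow> (\<forall>i<k. \<forall>j<k. ip n (u i) (u j) = (if i = j then 1 else 0))"

lemma cnj_mult_self: "cnj z * z = complex_of_real ((cmod z)\<^sup>2)"
  by (metis complex_norm_square mult.commute)

lemma ip_self: "ip n x x = complex_of_real (sqn n x)"
  unfolding ip_def sqn_def of_real_sum by (rule sum.cong[OF refl], rule cnj_mult_self)

lemma sqn_nonneg [simp]: "0 \<le> sqn n x"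
  by (simp add: sqn_def sum_nonneg)

lemma sqn_eq_0: "sqn n x = 0 \<longleftrightarrow> (\<forall>r<n. x r = 0)"
  by (auto simp add: sqn_def sum_nonneg_eq_0_iff)

lemma ip_cnj: "cnj (ip n x y) = ip n y x"
  by (simp add: ip_def mult.commute)

lemma ip_cong: "(\<And>r. r < n \<Longrightarrow> x r = x' r) \<Longrightarrow> (\<And>r. r < n \<Longrightarrow> y r = y' r) \<Longrightarrow> ip n x y = ip n x' y'"
  by (simp add: ip_def)

lemma ip_sum_right: "ip n x (\<lambda>r. \<Sum>i\<in>S. c i * u i r) = (\<Sum>i\<in>S. c i * ip n x (u i))"
  unfolding ip_def sum_distrib_left by (subst sum.swap) (simp add: mult_ac)

lemma ip_sum_left: "ip n (\<lambda>r. \<Sum>i\<in>S. c i * u i r) y = (\<Sum>i\<in>S. cnj (c i) * ip n (u i) y)"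
  unfolding ip_def sum_distrib_left cnj_sum complex_cnj_mult sum_distrib_right
  by (subst sum.swap) (simp add: mult_ac)

lemma ip_add_right: "ip n x (\<lambda>r. y r + z r) = ip n x y + ip n x z"
  by (simp add: ip_def algebra_simps sum.distrib)

lemma ip_diff_right: "ip n x (\<lambda>r. y r - z r) = ip n x y - ip n x z"
  by (simp add: ip_def algebra_simps sum_subtractf)

lemma ip_scale_right: "ip n x (\<lambda>r. c * y r) = c * ip n x y"
  by (simp add: ip_def sum_distrib_left mult_ac)

lemma ip_scale_left: "ip n (\<lambda>r. c * x r) y = cnj c * ip n x y"
  by (simp add: ip_def sum_distrib_left mult_ac)

lemma mv_sum: "mv n a (\<lambda>r. \<Sum>i\<in>S. c i * u i r) = (\<lambda>r. \<Sum>i\<in>S. c i * mv n a (u i) r)"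
  unfolding mv_def sum_distrib_left by (rule ext, subst sum.swap) (simp add: mult_ac)

lemma herm_ip:
  assumes "herm n a"
  shows "ip n x (mv n a y) = ip n (mv n a x) y"
proof -
  have "ip n x (mv n a y) = (\<Sum>r<n. \<Sum>s<n. cnj (x r) * a r s * y s)"
    by (simp add: ip_def mv_def sum_distrib_left mult_ac)
  also have "\<dots> = (\<Sum>r<n. \<Sum>s<n. cnj (x r) * cnj (a s r) * y s)"
    using assms unfolding herm_def by (intro sum.cong refl) (metis lessThan_iff)
  also have "\<dots> = (\<Sum>s<n. \<Sum>r<n. cnj (x r) * cnj (a s r) * y s)"
    by (rule sum.swap)
  also have "\<dots> = ip n (mv n a x) y"
    by (simp add: ip_def mv_def sum_distrib_left sum_distrib_right mult_ac)
  finally show ?thesis .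
qed

lemma herm_ip_real: "herm n a \<Longrightarrow> Im (ip n x (mv n a x)) = 0"
  by (metis complex_cnj_cancel_iff herm_ip ip_cnj Reals_cnj_iff complex_is_Real_iff)

text \<open>Padding the m equations with zero rows to a square matrix leaves row m equal to zero, so
  the determinant vanishes and the kernel is nontrivial.\<close>

lemma nontrivial_solution_nat:
  fixes l :: "nat \<Rightarrow> nat \<Rightarrow> complex"
  assumes "m < n"
  shows "\<exists>c. (\<exists>i<n. c i \<noteq> 0) \<and> (\<forall>k<m. (\<Sum>i<n. l k i * c i) = 0)"
proof -
  define A where "A = mat n n (\<lambda>(k,i). if k < m then l k i else 0)"
  have A: "A \<in> carrier_mat n n" by (simp add: A_def)
  \<comment> \<open>Row m of \<open>A\<close> is one of the padding rows, so the transpose kills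
    this unit vector.\<close>
  have "transpose_mat A *\<^sub>v unit_vec n m = 0\<^sub>v n"
    using assms by (intro eq_vecI) (auto simp: A_def)
  moreover have "unit_vec n m \<noteq> (0\<^sub>v n :: complex vec)"
    using assms by (metis index_unit_vec(1) index_zero_vec(1) zero_neq_one)
  ultimately have "det (transpose_mat A) = 0"
    using det_0_iff_vec_prod_zero_field[of "transpose_mat A" n] A by (metis transpose_carrier_mat unit_vec_carrier)
  then have "det A = 0" using det_transpose[OF A] by simp
  then obtain v where v: "v \<in> carrier_vec n" "v \<noteq> 0\<^sub>v n" "A *\<^sub>v v = 0\<^sub>v n"
    using det_0_iff_vec_prod_zero_field[OF A] by auto
  have "\<exists>i<n. v $ i \<noteq> 0" using v(1,2) by (metis eq_vecI carrier_vecD index_zero_vec)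
  moreover have "(\<Sum>i<n. l k i * v $ i) = 0" if "k < m" for k
  proof -
    have "(A *\<^sub>v v) $ k = (\<Sum>i<n. l k i * v $ i)"
      using that assms v(1) by (simp add: A_def scalar_prod_def atLeast0LessThan)
    then show ?thesis using v(3) that assms by simp
  qed
  ultimately show ?thesis by blast
qed

text \<open>The form needed for dimension counts: S indexes low eigenvectors, and F is a union of
  families of functionals. Functionals that coincide are counted once in F, which only
  helps.\<close>

lemma nontrivial_solution:
  fixes F :: "('i \<Rightarrow> complex) set"
  assumes "finite S" "finite F" "card F < card S"
  shows "\<exists>c. (\<exists>i\<in>S. c i \<noteq> 0) \<and> (\<forall>l\<in>F. (\<Sum>i\<in>S. l i * c i) = 0)"
proof -
  obtain f where f: "bij_betw f {..<card S} S"
    using assms(1) ex_bij_betw_nat_finite atLeast0LessThan by metis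
  obtain g where g: "bij_betw g {..<card F} F"
    using assms(2) ex_bij_betw_nat_finite atLeast0LessThan by metis
  obtain c where c: "\<exists>i<card S. c i \<noteq> 0" "\<forall>k<card F. (\<Sum>i<card S. g k (f i) * c i) = 0"
    using nontrivial_solution_nat[OF assms(3), of "\<lambda>k i. g k (f i)"] by auto
  define f' where "f' = the_inv_into {..<card S} f"
  have f': "f' (f i) = i" if "i < card S" for i
    using f that by (simp add: f'_def bij_betw_def the_inv_into_f_f)
  have "(\<Sum>i\<in>S. l i * c (f' i)) = 0" if "l \<in> F" for l
  proof -
    have "l \<in> g ` {..<card F}" using g that by (simp add: bij_betw_def)
    then obtain k where k: "k < card F" "g k = l" by blast
    have "(\<Sum>i\<in>S. l i * c (f' i)) = (\<Sum>i<card S. l (f i) * c (f' (f i)))"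
      by (rule sum.reindex_bij_betw[OF f, symmetric])
    also have "\<dots> = (\<Sum>i<card S. g k (f i) * c i)" using f' k by simp
    finally show ?thesis using c(2) k by auto
  qed
  moreover have "\<exists>i\<in>S. c (f' i) \<noteq> 0"
    using c(1) f f' by (metis bij_betwE lessThan_iff)
  ultimately show ?thesis by (intro exI[of _ "\<lambda>i. c (f' i)"]) auto
qed

text \<open>Orthonormality of the n vectors is \<open>V * U = 1\<close>. For square matrices a left
  inverse is a right inverse, and \<open>U * V = 1\<close> is completeness.\<close>

lemma orthon_complete:
  assumes "orthon n n u" "r < n" "s < n"
  shows "(\<Sum>i<n. u i r * cnj (u i s)) = (if r = s then 1 else 0)"
proof -
  define U where "U = mat n n (\<lambda>(r,i). u i r)"
  define V where "V = mat n n (\<lambda>(i,r). cnj (u i r))"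
  have c: "U \<in> carrier_mat n n" "V \<in> carrier_mat n n" by (auto simp: U_def V_def)
  have "V * U = 1\<^sub>m n"
    using assms(1) by (intro eq_matI) (auto simp: U_def V_def scalar_prod_def orthon_def ip_def atLeast0LessThan)
  then have "U * V = 1\<^sub>m n" using mat_mult_left_right_inverse[OF c(2,1)] by simp
  then have "(U * V) $$ (r,s) = (if r = s then 1 else 0)" using assms by simp
  then show ?thesis using assms by (simp add: U_def V_def scalar_prod_def atLeast0LessThan)
qed

lemma orthon_expand:
  assumes "orthon n n u" "r < n"
  shows "x r = (\<Sum>i<n. ip n (u i) x * u i r)"
proof -
  have "(\<Sum>i<n. ip n (u i) x * u i r) = (\<Sum>i<n. \<Sum>s<n. u i r * cnj (u i s) * x s)"
    unfolding ip_def sum_distrib_right by (simp add: mult_ac)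
  also have "\<dots> = (\<Sum>s<n. (\<Sum>i<n. u i r * cnj (u i s)) * x s)"
    by (subst sum.swap) (simp add: sum_distrib_right)
  also have "\<dots> = (\<Sum>s<n. if r = s then x s else 0)"
    using orthon_complete[OF assms(1,2)] by (intro sum.cong) auto
  also have "\<dots> = x r" using assms(2) by simp
  finally show ?thesis by simp
qed

lemma orthon_parseval_ip:
  assumes "orthon n n u"
  shows "ip n x y = (\<Sum>i<n. cnj (ip n (u i) x) * ip n (u i) y)"
proof -
  have "ip n x y = ip n (\<lambda>r. \<Sum>i<n. ip n (u i) x * u i r) y"
    using orthon_expand[OF assms] by (intro ip_cong) auto
  then show ?thesis by (simp add: ip_sum_left)
qed

lemma orthon_parseval:
  assumes "orthon n n u"
  shows "sqn n x = (\<Sum>i<n. (cmod (ip n (u i) x))\<^sup>2)"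
proof -
  have "complex_of_real (sqn n x) = complex_of_real (\<Sum>i<n. (cmod (ip n (u i) x))\<^sup>2)"
    using orthon_parseval_ip[OF assms, of x x]
    by (simp add: ip_self cnj_mult_self)
  then show ?thesis by (simp only: of_real_eq_iff)
qed

lemma ip_normalize:
  assumes "0 < sqn n x" "t = complex_of_real (1 / sqrt (sqn n x))"
  shows "ip n (\<lambda>r. t * x r) (\<lambda>r. t * x r) = 1"
proof -
  have "ip n (\<lambda>r. t * x r) (\<lambda>r. t * x r) = cnj t * (t * complex_of_real (sqn n x))"
    unfolding ip_scale_left ip_scale_right ip_self ..
  also have "\<dots> = complex_of_real ((1 / sqrt (sqn n x))\<^sup>2 * sqn n x)"
    unfolding assms(2) by (simp only: complex_cnj_complex_of_real power2_eq_square of_real_mult mult_ac)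
  also have "(1 / sqrt (sqn n x))\<^sup>2 * sqn n x = 1" using assms(1) by (simp add: power_divide)
  finally show ?thesis by simp
qed

text \<open>Orthogonality to k vectors is a homogeneous system of k < n equations; a nonzero
  solution is normalised.\<close>

lemma orthon_extend_one:
  assumes "orthon n k u" "k < n"
  shows "\<exists>w. orthon n (Suc k) w \<and> (\<forall>i<k. w i = u i)"
proof -
  obtain c where c: "\<exists>i<n. c i \<noteq> 0" "\<forall>j<k. (\<Sum>i<n. cnj (u j i) * c i) = 0"
    using nontrivial_solution_nat[OF assms(2), of "\<lambda>j i. cnj (u j i)"] by auto
  have pos: "0 < sqn n c" using c(1) sqn_eq_0 sqn_nonneg by (metis order_less_le)
  define t where "t = complex_of_real (1 / sqrt (sqn n c))"
  define w where "w = u(k := \<lambda>r. t * c r)"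
  have "ip n (\<lambda>r. t * c r) (\<lambda>r. t * c r) = 1" by (rule ip_normalize[OF pos t_def])
  moreover have o: "ip n (u j) (\<lambda>r. t * c r) = 0" if "j < k" for j
    using c(2) that by (simp add: ip_scale_right ip_def)
  moreover have "ip n (\<lambda>r. t * c r) (u j) = 0" if "j < k" for j
    using o[OF that] ip_cnj by (metis complex_cnj_zero)
  ultimately have "orthon n (Suc k) w"
    using assms(1) unfolding orthon_def w_def by (auto simp: less_Suc_eq)
  then show ?thesis by (auto simp: w_def)
qed

lemma orthon_extend:
  assumes "orthon n k u" "k \<le> m" "m \<le> n"
  shows "\<exists>w. orthon n m w \<and> (\<forall>i<k. w i = u i)"
  using assms(2,3)
proof (induction m rule: dec_induct)
  case base
  then show ?case using assms(1) by blast
next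
  case (step m)
  then obtain w where w: "orthon n m w" "\<forall>i<k. w i = u i" by auto
  obtain w' where "orthon n (Suc m) w'" "\<forall>i<m. w' i = w i" using orthon_extend_one[OF w(1)] step by auto
  then show ?case using w(2) step by (intro exI[of _ w']) auto
qed

section \<open>The spectral theorem for Hermitian matrices\<close>

lemma eigenvector_exists:
  fixes b :: "nat \<Rightarrow> nat \<Rightarrow> complex"
  assumes "0 < m"
  shows "\<exists>c l. (\<exists>i<m. c i \<noteq> 0) \<and> (\<forall>i<m. mv m b c i = l * c i)"
proof -
  define B where "B = mat m m (\<lambda>(i,j). b i j)"
  have B: "B \<in> carrier_mat m m" by (simp add: B_def)
  have "degree (char_poly B) = m" using degree_monic_char_poly[OF B] by simp
  then have "\<exists>l. poly (char_poly B) l = 0"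
    using Fundamental_Theorem_Algebra.fundamental_theorem_of_algebra[of "char_poly B"] assms
    by (metis constant_degree gr_implies_not0)
  then obtain l where "eigenvalue B l" using eigenvalue_root_char_poly[OF B] by auto
  then obtain v where v: "v \<in> carrier_vec m" "v \<noteq> 0\<^sub>v m" "B *\<^sub>v v = l \<cdot>\<^sub>v v"
    using B by (auto simp: eigenvalue_def eigenvector_def)
  have "\<exists>i<m. v $ i \<noteq> 0" using v(1,2) by (metis eq_vecI carrier_vecD index_zero_vec)
  moreover have "mv m b (\<lambda>i. v $ i) i = l * v $ i" if "i < m" for i
  proof -
    have "(B *\<^sub>v v) $ i = mv m b (\<lambda>i. v $ i) i"
      using that v(1) by (simp add: B_def scalar_prod_def atLeast0LessThan mv_def)
    then show ?thesis using v that by simp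
  qed
  ultimately show ?thesis by blast
qed

text \<open>The complement of the eigenvectors found so far is invariant because the matrix is
  Hermitian. An eigenvector of the compression to it is therefore an eigenvector of the whole
  matrix, and the eigenvalue is real because the form is.\<close>

lemma herm_eigenvector_extend:
  assumes h: "herm n a" and o: "orthon n k u" and kn: "k < n"
    and ev: "\<And>i r. i < k \<Longrightarrow> r < n \<Longrightarrow> mv n a (u i) r = complex_of_real (d i) * u i r"
  shows "\<exists>w e. orthon n (Suc k) w \<and> (\<forall>i<Suc k. \<forall>r<n. mv n a (w i) r = complex_of_real (e i) * w i r)"
proof -
  obtain w where w: "orthon n n w" "\<forall>i<k. w i = u i" using orthon_extend[OF o] kn by (metis less_imp_le order_refl)
  have wi: "ip n (w i) (w j) = (if i = j then 1 else 0)" if "i < n" "j < n" for i j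
    using w(1) that by (simp add: orthon_def)
  \<comment> \<open>The compression to the span of the added vectors \<open>w k\<close>, ...,
    \<open>w (n - 1)\<close>.\<close>
  define b where "b = (\<lambda>i j. ip n (w (k + i)) (mv n a (w (k + j))))"
  obtain c l where c: "\<exists>i<n-k. c i \<noteq> 0" "\<forall>i<n-k. mv (n-k) b c i = l * c i"
    using eigenvector_exists[of "n-k" b] kn by auto
  define x where "x = (\<lambda>r. \<Sum>i<n-k. c i * w (k+i) r)"
  have xo: "ip n (w j) x = 0" if "j < k" for j
    unfolding x_def ip_sum_right using that kn wi by (intro sum.neutral) auto
  have xc: "ip n (w (k+j)) x = c j" if "j < n-k" for j
  proof -
    have "ip n (w (k+j)) x = (\<Sum>i<n-k. c i * (if j = i then 1 else 0))"
      unfolding x_def ip_sum_right using that kn wi by (intro sum.cong) auto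
    then show ?thesis using that by (simp add: if_distrib cong: if_cong)
  qed
  \<comment> \<open>The eigenvalue equation is tested on the full basis: against old eigenvectors
    both sides vanish, against new ones it is the compressed equation.\<close>
  have ax: "ip n (w j) (mv n a x) = l * ip n (w j) x" if "j < n" for j
  proof (cases "j < k")
    case True
    have "ip n (w j) (mv n a x) = ip n (mv n a (w j)) x" by (rule herm_ip[OF h])
    also have "\<dots> = ip n (\<lambda>r. complex_of_real (d j) * w j r) x"
      using ev w(2) True by (intro ip_cong) auto
    also have "\<dots> = 0" using xo[OF True] by (simp add: ip_scale_left)
    finally show ?thesis using xo[OF True] by simp
  next
    case False
    then have i: "j = k + (j - k)" "j - k < n-k" using that by auto
    define i where "i = j - k"
    note i = i[folded i_def]
    have "ip n (w j) (mv n a x) = (\<Sum>m<n-k. c m * ip n (w j) (mv n a (w (k+m))))"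
      unfolding x_def mv_sum ip_sum_right ..
    also have "\<dots> = mv (n-k) b c i" by (simp add: mv_def b_def i mult.commute)
    finally show ?thesis using c i xc by simp
  qed
  have axr: "mv n a x r = l * x r" if "r < n" for r
  proof -
    have "mv n a x r = (\<Sum>i<n. ip n (w i) (mv n a x) * w i r)" by (rule orthon_expand[OF w(1) that])
    also have "\<dots> = l * (\<Sum>i<n. ip n (w i) x * w i r)" using ax by (simp add: sum_distrib_left mult_ac)
    also have "\<dots> = l * x r" using orthon_expand[OF w(1) that, of x] by simp
    finally show ?thesis .
  qed
  have xpos: "0 < sqn n x"
  proof -
    obtain i where "i < n-k" "c i \<noteq> 0" using c(1) by auto
    then have "ip n (w (k+i)) x \<noteq> 0" using xc by simp
    then have "\<exists>r<n. x r \<noteq> 0" unfolding ip_def by (metis (no_types, lifting) lessThan_iff mult_zero_right sum.neutral)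
    then show ?thesis by (metis order_less_le sqn_eq_0 sqn_nonneg)
  qed
  have "ip n x (mv n a x) = l * complex_of_real (sqn n x)"
    using axr by (simp add: ip_scale_right flip: ip_self cong: ip_cong)
  then have "Im l * sqn n x = 0" using herm_ip_real[OF h, of x] by simp
  then have lr: "l = complex_of_real (Re l)" using xpos by (simp add: complex_eq_iff)
  define t where "t = complex_of_real (1 / sqrt (sqn n x))"
  define w' where "w' = u(k := \<lambda>r. t * x r)"
  have n1: "ip n (\<lambda>r. t * x r) (\<lambda>r. t * x r) = 1" by (rule ip_normalize[OF xpos t_def])
  have o1: "ip n (u j) (\<lambda>r. t * x r) = 0" if "j < k" for j
    using xo that w(2) by (simp add: ip_scale_right)
  then have o2: "ip n (\<lambda>r. t * x r) (u j) = 0" if "j < k" for j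
    using that ip_cnj by (metis complex_cnj_zero)
  have "orthon n (Suc k) w'"
    using o n1 o1 o2 unfolding orthon_def w'_def by (auto simp: less_Suc_eq)
  moreover have "mv n a (w' i) r = complex_of_real ((d(k := Re l)) i) * w' i r" if "i < Suc k" "r < n" for i r
  proof (cases "i = k")
    case True
    have "mv n a (\<lambda>r. t * x r) r = t * mv n a x r" by (simp add: mv_def sum_distrib_left mult_ac)
    then show ?thesis using True axr[OF that(2)] lr by (simp add: w'_def)
  next
    case False
    then show ?thesis using that ev by (simp add: w'_def)
  qed
  ultimately show ?thesis by blast
qed

lemma spectral_theorem:
  assumes "herm n a"
  shows "\<exists>u d. orthon n n u \<and> (\<forall>i<n. \<forall>r<n. mv n a (u i) r = complex_of_real (d i) * u i r)"
proof -
  have "\<exists>u d. orthon n k u \<and> (\<forall>i<k. \<forall>r<n. mv n a (u i) r = complex_of_real (d i) * u i r)" if "k \<le> n" for k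
    using that
  proof (induction k)
    case 0
    then show ?case by (simp add: orthon_def)
  next
    case (Suc k)
    then obtain u d where "orthon n k u" "\<forall>i<k. \<forall>r<n. mv n a (u i) r = complex_of_real (d i) * u i r" by auto
    then show ?case using herm_eigenvector_extend[OF assms, of k u d] Suc.prems by auto
  qed
  then show ?thesis by blast
qed

section \<open>Eigenvalue counts and the characteristic polynomial\<close>

definition eigsys :: "nat \<Rightarrow> (nat \<Rightarrow> nat \<Rightarrow> complex) \<Rightarrow> (nat \<Rightarrow> nat \<Rightarrow> complex) \<Rightarrow> (nat \<Rightarrow> real) \<Rightarrow> bool" where
  "eigsys n a u d \<longleftrightarrow> orthon n n u \<and> (\<forall>i<n. \<forall>r<n. mv n a (u i) r = complex_of_real (d i) * u i r)"

text \<open>An arbitrary choice, without order and without continuity in the matrix. Later it enters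
  through sums over the whole basis whose values do not depend on the choice.\<close>

definition eigvec_of :: "nat \<Rightarrow> (nat \<Rightarrow> nat \<Rightarrow> complex) \<Rightarrow> nat \<Rightarrow> nat \<Rightarrow> complex" where
  "eigvec_of n a = fst (SOME p. eigsys n a (fst p) (snd p))"

definition eigval_of :: "nat \<Rightarrow> (nat \<Rightarrow> nat \<Rightarrow> complex) \<Rightarrow> nat \<Rightarrow> real" where
  "eigval_of n a = snd (SOME p. eigsys n a (fst p) (snd p))"

lemma eigsys_ev: "herm n a \<Longrightarrow> eigsys n a (eigvec_of n a) (eigval_of n a)"
proof -
  assume "herm n a"
  then have "\<exists>p. eigsys n a (fst p) (snd p)"
    using spectral_theorem[of n a] unfolding eigsys_def by auto
  from someI_ex[OF this] show ?thesis by (simp add: eigvec_of_def eigval_of_def)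
qed

text \<open>The eigenbasis gives a similarity with a diagonal matrix. This ties the algebraic
  multiplicities in the hypothesis of the theorem to repetitions among the numbers
  \<open>d i\<close>.\<close>

lemma char_poly_eigsys:
  assumes "eigsys n a u d"
  shows "char_poly (mat n n (\<lambda>(r,s). a r s)) = (\<Prod>i<n. [:- complex_of_real (d i), 1:])"
proof -
  have o: "orthon n n u" using assms by (simp add: eigsys_def)
  define A where "A = mat n n (\<lambda>(r,s). a r s)"
  define U where "U = mat n n (\<lambda>(r,i). u i r)"
  define V where "V = mat n n (\<lambda>(i,r). cnj (u i r))"
  define D where "D = mat n n (\<lambda>(i,j). if i = j then complex_of_real (d i) else 0)"
  have c: "A \<in> carrier_mat n n" "U \<in> carrier_mat n n" "V \<in> carrier_mat n n" "D \<in> carrier_mat n n"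
    by (auto simp: A_def U_def V_def D_def)
  have VU: "V * U = 1\<^sub>m n"
    using o by (intro eq_matI) (auto simp: U_def V_def scalar_prod_def orthon_def ip_def atLeast0LessThan)
  then have UV: "U * V = 1\<^sub>m n" using mat_mult_left_right_inverse[OF c(3,2)] by simp
  have AU: "A * U = U * D"
  proof (rule eq_matI)
    fix r i assume "r < dim_row (U * D)" "i < dim_col (U * D)"
    then have ri: "r < n" "i < n" using c by auto
    have "(A * U) $$ (r,i) = mv n a (u i) r"
      using ri by (simp add: A_def U_def scalar_prod_def mv_def atLeast0LessThan)
    moreover have "(U * D) $$ (r,i) = u i r * complex_of_real (d i)"
      using ri by (simp add: D_def U_def scalar_prod_def atLeast0LessThan if_distrib sum.delta cong: if_cong)
    ultimately show "(A * U) $$ (r,i) = (U * D) $$ (r,i)"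
      using assms ri by (simp add: eigsys_def mult.commute)
  qed (use c in auto)
  have "U * D * V = A * U * V" by (simp add: AU)
  also have "\<dots> = A" using c UV by (simp add: assoc_mult_mat[of A n n U n V n])
  finally have "similar_mat_wit A D U V"
    by (intro similar_mat_witI[of _ _ n]) (use c UV VU in auto)
  then have "char_poly A = char_poly D"
    by (intro char_poly_similar) (auto simp: similar_mat_def)
  also have "\<dots> = (\<Prod>x\<leftarrow>diag_mat D. [:- x, 1:])"
    by (rule char_poly_upper_triangular[OF c(4)]) (auto simp: upper_triangular_def D_def)
  also have "diag_mat D = map (\<lambda>i. complex_of_real (d i)) [0..<n]"
    by (simp add: diag_mat_def D_def)
  also have "(\<Prod>x\<leftarrow>map (\<lambda>i. complex_of_real (d i)) [0..<n]. [:- x, 1:]) = (\<Prod>i<n. [:- complex_of_real (d i), 1:])"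
    by (induction n) auto
  finally show ?thesis by (simp add: A_def)
qed

lemma order_prod_linear:
  fixes c :: "nat \<Rightarrow> complex"
  shows "order a (\<Prod>i<n. [:- c i, 1:]) = card {i\<in>{..<n}. c i = a}"
proof (induction n)
  case 0
  then show ?case by (simp add: order_0I)
next
  case (Suc n)
  have "(\<Prod>i<n. [:- c i, 1:]) \<noteq> 0" by (simp add: prod_zero_iff)
  then have "(\<Prod>i<n. [:- c i, 1:]) * [:- c n, 1:] \<noteq> 0" by (intro no_zero_divisors) auto
  then have "order a (\<Prod>i<Suc n. [:- c i, 1:]) = card {i\<in>{..<n}. c i = a} + order a [:- c n, 1:]"
    by (simp add: order_mult Suc.IH del: mult_pCons_right)
  also have "order a [:- c n, 1:] = (if c n = a then 1 else 0)"
    using order_power_n_n[of a 1] by (auto intro!: order_0I)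
  also have "{i\<in>{..<Suc n}. c i = a} = {i\<in>{..<n}. c i = a} \<union> (if c n = a then {n} else {})"
    by (auto simp: less_Suc_eq)
  ultimately show ?case by (auto simp: card_Un_disjoint)
qed

text \<open>Working with the number of eigenvalues up to a level avoids sorting: min-max comparisons
  become inequalities between counts.\<close>

definition eig_count :: "nat \<Rightarrow> (nat \<Rightarrow> real) \<Rightarrow> real \<Rightarrow> nat" where
  "eig_count n d x = card {i\<in>{..<n}. d i \<le> x}"

lemma ev_count_le_eigsys:
  assumes "eigsys n a u d"
  shows "ev_count_le (mat n n (\<lambda>(r,s). a r s)) x = eig_count n d x"
proof -
  let ?p = "\<Prod>i<n. [:- complex_of_real (d i), 1:]"
  let ?R = "complex_of_real ` d ` {i\<in>{..<n}. d i \<le> x}"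
  have R: "{a. poly ?p a = 0 \<and> Re a \<le> x} = ?R"
    by (auto simp: poly_prod image_iff)
  have "ev_count_le (mat n n (\<lambda>(r,s). a r s)) x = (\<Sum>b\<in>?R. card {i\<in>{..<n}. complex_of_real (d i) = b})"
    unfolding ev_count_le_def char_poly_eigsys[OF assms] R
    by (intro sum.cong refl order_prod_linear)
  also have "\<dots> = (\<Sum>b\<in>?R. card {i\<in>{i\<in>{..<n}. d i \<le> x}. complex_of_real (d i) = b})"
    by (intro sum.cong refl arg_cong[of _ _ card]) auto
  also have "\<dots> = card {i\<in>{..<n}. d i \<le> x}"
    unfolding card_eq_sum by (subst sum.group) auto
  finally show ?thesis by (simp add: eig_count_def)
qed

text \<open>One half of min-max: on combinations of eigenvectors with eigenvalues at most x the
  Rayleigh quotient is at most x. The norm formula shows that such a combination is nonzero as soon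
  as one coefficient is.\<close>

lemma low_vector_form:
  assumes e: "eigsys n a u d" and S: "S \<subseteq> {i\<in>{..<n}. d i \<le> x}" and v: "v = (\<lambda>r. \<Sum>i\<in>S. c i * u i r)"
  shows "Re (ip n v (mv n a v)) \<le> x * sqn n v" "sqn n v = (\<Sum>i\<in>S. (cmod (c i))\<^sup>2)"
proof -
  have fin: "finite S" using S by (rule finite_subset) auto
  have o: "ip n (u i) (u j) = (if i = j then 1 else 0)" if "i < n" "j < n" for i j
    using e that by (simp add: eigsys_def orthon_def)
  have c: "ip n (u i) v = (if i \<in> S then c i else 0)" if "i < n" for i
  proof -
    have "ip n (u i) v = (\<Sum>j\<in>S. c j * (if i = j then 1 else 0))"
      unfolding v ip_sum_right using S that o by (intro sum.cong refl) auto
    then show ?thesis using fin by (simp add: if_distrib cong: if_cong)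
  qed
  have oo: "orthon n n u" using e by (simp add: eigsys_def)
  have "sqn n v = (\<Sum>i<n. if i \<in> S then (cmod (c i))\<^sup>2 else 0)"
    unfolding orthon_parseval[OF oo] using c by (intro sum.cong) auto
  also have "\<dots> = (\<Sum>i\<in>S. (cmod (c i))\<^sup>2)"
    using S by (subst sum.inter_restrict[symmetric]) (auto intro: sum.cong)
  finally show s: "sqn n v = (\<Sum>i\<in>S. (cmod (c i))\<^sup>2)" .
  have "ip n v (mv n a v) = (\<Sum>i\<in>S. c i * ip n v (mv n a (u i)))"
    unfolding v mv_sum ip_sum_right ..
  also have "\<dots> = (\<Sum>i\<in>S. complex_of_real (d i * (cmod (c i))\<^sup>2))"
  proof (rule sum.cong[OF refl])
    fix i assume i: "i \<in> S"
    then have "i < n" using S by auto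
    have "ip n v (mv n a (u i)) = ip n v (\<lambda>r. complex_of_real (d i) * u i r)"
      using e \<open>i < n\<close> by (intro ip_cong) (auto simp: eigsys_def)
    also have "\<dots> = complex_of_real (d i) * cnj (c i)"
      using c[OF \<open>i < n\<close>] i by (simp add: ip_scale_right flip: ip_cnj[of n "u i" v])
    finally show "c i * ip n v (mv n a (u i)) = complex_of_real (d i * (cmod (c i))\<^sup>2)"
      by (simp only: of_real_mult cnj_mult_self[symmetric] mult_ac)
  qed
  finally have "Re (ip n v (mv n a v)) = (\<Sum>i\<in>S. d i * (cmod (c i))\<^sup>2)" by simp
  also have "\<dots> \<le> (\<Sum>i\<in>S. x * (cmod (c i))\<^sup>2)"
    using S by (intro sum_mono mult_right_mono) auto
  finally show "Re (ip n v (mv n a v)) \<le> x * sqn n v" by (simp add: s sum_distrib_left)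
qed

lemma eigsys_form:
  assumes e: "eigsys n a u d"
  shows "Re (ip n v (mv n a v)) = (\<Sum>i<n. d i * (cmod (ip n (u i) v))\<^sup>2)"
    and "Im (ip n v (mv n a v)) = 0"
proof -
  have oo: "orthon n n u" using e by (simp add: eigsys_def)
  define w where "w = (\<lambda>r. \<Sum>i<n. ip n (u i) v * u i r)"
  have w: "v r = w r" if "r < n" for r using orthon_expand[OF oo that, of v] by (simp add: w_def)
  have "ip n v (mv n a v) = ip n v (mv n a w)"
    using w by (simp add: ip_def mv_def)
  also have "\<dots> = (\<Sum>i<n. ip n (u i) v * ip n v (mv n a (u i)))"
    unfolding w_def mv_sum ip_sum_right ..
  also have "\<dots> = (\<Sum>i<n. complex_of_real (d i * (cmod (ip n (u i) v))\<^sup>2))"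
  proof (rule sum.cong[OF refl])
    fix i assume i: "i \<in> {..<n}"
    have "ip n v (mv n a (u i)) = ip n v (\<lambda>r. complex_of_real (d i) * u i r)"
      using e i by (intro ip_cong) (auto simp: eigsys_def)
    also have "\<dots> = complex_of_real (d i) * cnj (ip n (u i) v)"
      by (simp add: ip_scale_right ip_cnj)
    finally show "ip n (u i) v * ip n v (mv n a (u i)) = complex_of_real (d i * (cmod (ip n (u i) v))\<^sup>2)"
      by (simp only: of_real_mult cnj_mult_self[symmetric] mult_ac)
  qed
  finally have *: "ip n v (mv n a v) = complex_of_real (\<Sum>i<n. d i * (cmod (ip n (u i) v))\<^sup>2)" by simp
  show "Re (ip n v (mv n a v)) = (\<Sum>i<n. d i * (cmod (ip n (u i) v))\<^sup>2)" unfolding * by simp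
  show "Im (ip n v (mv n a v)) = 0" unfolding * by simp
qed

text \<open>The other half of min-max. Only eigenvalues strictly above x contribute, and this
  strictness is what produces contradictions at the level x itself.\<close>

lemma high_vector_form:
  assumes e: "eigsys n a u d" and v: "\<And>i. i < n \<Longrightarrow> d i \<le> x \<Longrightarrow> ip n (u i) v = 0"
  shows "x * sqn n v \<le> Re (ip n v (mv n a v))" "sqn n v \<noteq> 0 \<Longrightarrow> x * sqn n v < Re (ip n v (mv n a v))"
proof -
  have oo: "orthon n n u" using e by (simp add: eigsys_def)
  note p = orthon_parseval[OF oo, of v]
  have le: "x * (cmod (ip n (u i) v))\<^sup>2 \<le> d i * (cmod (ip n (u i) v))\<^sup>2" if "i < n" for i
    using v[OF that] by (cases "d i \<le> x") (auto intro: mult_right_mono)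
  show "x * sqn n v \<le> Re (ip n v (mv n a v))"
    unfolding eigsys_form[OF e] p sum_distrib_left using le by (intro sum_mono) auto
  assume "sqn n v \<noteq> 0"
  then obtain i where i: "i < n" "ip n (u i) v \<noteq> 0"
    unfolding p by (metis (no_types, lifting) lessThan_iff norm_zero power_zero_numeral sum.neutral)
  then have "x < d i" using v[OF i(1)] by force
  then have "x * (cmod (ip n (u i) v))\<^sup>2 < d i * (cmod (ip n (u i) v))\<^sup>2"
    using i by (intro mult_strict_right_mono) auto
  then have "\<exists>i\<in>{..<n}. x * (cmod (ip n (u i) v))\<^sup>2 < d i * (cmod (ip n (u i) v))\<^sup>2"
    using i by blast
  then show "x * sqn n v < Re (ip n v (mv n a v))"
    unfolding eigsys_form[OF e] p sum_distrib_left using le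
    by (intro sum_strict_mono_ex1) auto
qed

section \<open>Trace functions along a Hermitian pencil\<close>

text \<open>Together with the symmetry \<open>cmod_ip_commute\<close> this makes the squared
  overlaps of two orthonormal bases a doubly stochastic matrix.\<close>

lemma orthon_sum_sq:
  assumes "orthon n n u" "orthon n n v" "j < n"
  shows "(\<Sum>i<n. (cmod (ip n (u i) (v j)))\<^sup>2) = 1"
proof -
  have "ip n (v j) (v j) = 1" using assms by (simp add: orthon_def)
  then have "sqn n (v j) = 1" by (simp add: ip_self)
  then show ?thesis using orthon_parseval[OF assms(1), of "v j"] by simp
qed

lemma cmod_ip_commute: "cmod (ip n x y) = cmod (ip n y x)"
  by (metis complex_mod_cnj ip_cnj)

lemma mv_diff: "mv n (\<lambda>r s. b r s - a r s) x = (\<lambda>r. mv n b x r - mv n a x r)"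
  by (rule ext) (simp add: mv_def left_diff_distrib sum_subtractf)

text \<open>This identity replaces perturbation theory for eigenvectors: differences of eigenvalues,
  weighted by overlaps, are matrix elements of the perturbation.\<close>

lemma eigsys_diff_ip:
  assumes a: "eigsys n a u d" and b: "eigsys n b v e" and hb: "herm n b" and ij: "i < n" "j < n"
  shows "ip n (v j) (mv n (\<lambda>r s. b r s - a r s) (u i)) = complex_of_real (e j - d i) * ip n (v j) (u i)"
proof -
  have "ip n (v j) (mv n b (u i)) = ip n (mv n b (v j)) (u i)" by (rule herm_ip[OF hb])
  also have "\<dots> = ip n (\<lambda>r. complex_of_real (e j) * v j r) (u i)"
    using b ij by (intro ip_cong) (auto simp: eigsys_def)
  finally have 1: "ip n (v j) (mv n b (u i)) = complex_of_real (e j) * ip n (v j) (u i)"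
    by (simp add: ip_scale_left)
  have "ip n (v j) (mv n a (u i)) = ip n (v j) (\<lambda>r. complex_of_real (d i) * u i r)"
    using a ij by (intro ip_cong) (auto simp: eigsys_def)
  then have 2: "ip n (v j) (mv n a (u i)) = complex_of_real (d i) * ip n (v j) (u i)"
    by (simp add: ip_scale_right)
  show ?thesis
    using 1 2 by (simp add: mv_diff ip_diff_right left_diff_distrib)
qed

text \<open>Double sums over two eigenbases, weighted by the squared overlaps, give a second order
  expansion of the trace of a function without any regularity of the eigenvectors.\<close>

lemma trace_function_expansion:
  fixes th th' :: "real \<Rightarrow> real"
  assumes a: "eigsys n a u d" and b: "eigsys n b v e" and hb: "herm n b"
    and th: "\<And>x y. \<bar>th y - th x - th' x * (y - x)\<bar> \<le> C * (y - x)\<^sup>2"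
  defines "w \<equiv> (\<lambda>r s. b r s - a r s)"
  shows "\<bar>(\<Sum>j<n. th (e j)) - (\<Sum>i<n. th (d i)) - (\<Sum>i<n. th' (d i) * Re (ip n (u i) (mv n w (u i))))\<bar>
    \<le> C * (\<Sum>i<n. sqn n (mv n w (u i)))"
proof -
  have ou: "orthon n n u" and ov: "orthon n n v" using a b by (auto simp: eigsys_def)
  define g where "g = (\<lambda>i j. (cmod (ip n (v j) (u i)))\<^sup>2)"
  have gi: "(\<Sum>j<n. g i j) = 1" if "i < n" for i
    unfolding g_def by (rule orthon_sum_sq[OF ov ou that])
  have gj: "(\<Sum>i<n. g i j) = 1" if "j < n" for j
    unfolding g_def cmod_ip_commute[of n "v j"] by (rule orthon_sum_sq[OF ou ov that])
  have wip: "ip n (v j) (mv n w (u i)) = complex_of_real (e j - d i) * ip n (v j) (u i)" if "i < n" "j < n" for i j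
    unfolding w_def by (rule eigsys_diff_ip[OF a b hb that])
  \<comment> \<open>Expanding in the second basis turns the form of \<open>w\<close> into first
    moments of \<open>e j - d i\<close>, and its squared norm into second moments.\<close>
  have 1: "Re (ip n (u i) (mv n w (u i))) = (\<Sum>j<n. g i j * (e j - d i))" if "i < n" for i
  proof -
    have "ip n (u i) (mv n w (u i)) = (\<Sum>j<n. cnj (ip n (v j) (u i)) * (complex_of_real (e j - d i) * ip n (v j) (u i)))"
      unfolding orthon_parseval_ip[OF ov, of "u i"] using wip that by (intro sum.cong) auto
    also have "\<dots> = (\<Sum>j<n. complex_of_real (g i j * (e j - d i)))"
      unfolding g_def of_real_mult cnj_mult_self[symmetric] by (intro sum.cong) (auto simp: mult_ac)
    finally show ?thesis by simp
  qed
  have 2: "sqn n (mv n w (u i)) = (\<Sum>j<n. g i j * (e j - d i)\<^sup>2)" if "i < n" for i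
    unfolding orthon_parseval[OF ov, of "mv n w (u i)"] using wip that
    by (intro sum.cong) (auto simp: g_def norm_mult power_mult_distrib simp flip: of_real_diff)
  have "(\<Sum>j<n. th (e j)) = (\<Sum>j<n. (\<Sum>i<n. g i j) * th (e j))" using gj by simp
  also have "\<dots> = (\<Sum>i<n. \<Sum>j<n. g i j * th (e j))"
    by (subst sum.swap) (simp add: sum_distrib_right)
  finally have 3: "(\<Sum>j<n. th (e j)) = (\<Sum>i<n. \<Sum>j<n. g i j * th (e j))" .
  have "(\<Sum>i<n. th (d i)) = (\<Sum>i<n. (\<Sum>j<n. g i j) * th (d i))" using gi by simp
  then have 4: "(\<Sum>i<n. th (d i)) = (\<Sum>i<n. \<Sum>j<n. g i j * th (d i))"
    by (simp add: sum_distrib_right)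
  have 5: "(\<Sum>i<n. th' (d i) * Re (ip n (u i) (mv n w (u i)))) = (\<Sum>i<n. \<Sum>j<n. g i j * (th' (d i) * (e j - d i)))"
    using 1 by (simp add: sum_distrib_left mult_ac)
  \<comment> \<open>All three sums now run over the same pairs with the same nonnegative weights, so
    the scalar expansion applies pair by pair.\<close>
  have "(\<Sum>j<n. th (e j)) - (\<Sum>i<n. th (d i)) - (\<Sum>i<n. th' (d i) * Re (ip n (u i) (mv n w (u i))))
    = (\<Sum>i<n. \<Sum>j<n. g i j * (th (e j) - th (d i) - th' (d i) * (e j - d i)))"
    unfolding 3 4 5 by (simp add: right_diff_distrib sum_subtractf)
  also have "\<bar>\<dots>\<bar> \<le> (\<Sum>i<n. \<Sum>j<n. g i j * (C * (e j - d i)\<^sup>2))"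
    using th by (intro order_trans[OF sum_abs] sum_mono) (auto simp: abs_mult g_def intro!: mult_left_mono)
  also have "\<dots> = C * (\<Sum>i<n. sqn n (mv n w (u i)))"
    using 2 by (simp add: sum_distrib_left mult_ac)
  finally show ?thesis .
qed

text \<open>The Hilbert-Schmidt norm does not depend on the basis, so the error term is free of the
  chosen eigenvectors.\<close>

lemma orthon_hilbert_schmidt:
  assumes "orthon n n u"
  shows "(\<Sum>i<n. sqn n (mv n w (u i))) = (\<Sum>r<n. \<Sum>s<n. (cmod (w r s))\<^sup>2)"
proof -
  have "(\<Sum>i<n. (cmod (mv n w (u i) r))\<^sup>2) = (\<Sum>s<n. (cmod (w r s))\<^sup>2)" for r
  proof -
    have "mv n w (u i) r = ip n (\<lambda>s. cnj (w r s)) (u i)" for i by (simp add: mv_def ip_def)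
    then show ?thesis
      using orthon_parseval[OF assms, of "\<lambda>s. cnj (w r s)"] by (simp add: cmod_ip_commute[of n _ "u _"] sqn_def)
  qed
  then show ?thesis unfolding sqn_def by (subst sum.swap) simp
qed

lemma has_real_derivative_quadratic:
  fixes f :: "real \<Rightarrow> real"
  assumes "\<And>y. \<bar>f y - f x - D * (y - x)\<bar> \<le> C * (y - x)\<^sup>2"
  shows "(f has_real_derivative D) (at x)"
proof -
  have "((\<lambda>y. (f y - f x) / (y - x) - D) \<longlongrightarrow> 0) (at x)"
  proof (rule Lim_null_comparison)
    show "\<forall>\<^sub>F y in at x. norm ((f y - f x) / (y - x) - D) \<le> C * \<bar>y - x\<bar>"
      unfolding eventually_at_topological
    proof (intro exI[of _ UNIV] conjI ballI impI)
      fix y assume "y \<noteq> x"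
      then have "(f y - f x) / (y - x) - D = (f y - f x - D * (y - x)) / (y - x)"
        by (simp add: field_simps)
      then have "norm ((f y - f x) / (y - x) - D) = \<bar>f y - f x - D * (y - x)\<bar> / \<bar>y - x\<bar>" by simp
      also have "\<dots> \<le> C * (y - x)\<^sup>2 / \<bar>y - x\<bar>" by (intro divide_right_mono assms) simp
      also have "(y - x)\<^sup>2 = \<bar>y - x\<bar> * \<bar>y - x\<bar>" by (simp add: power2_eq_square)
      also have "C * (\<bar>y - x\<bar> * \<bar>y - x\<bar>) / \<bar>y - x\<bar> = C * \<bar>y - x\<bar>" using \<open>y \<noteq> x\<close> by (simp del: abs_mult_self_eq)
      finally show "norm ((f y - f x) / (y - x) - D) \<le> C * \<bar>y - x\<bar>" .
    qed auto
    show "((\<lambda>y. C * \<bar>y - x\<bar>) \<longlongrightarrow> 0) (at x)" by (auto intro!: tendsto_eq_intros)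
  qed
  then show ?thesis by (simp add: has_field_derivative_iff LIM_zero_iff)
qed

text \<open>The Hellmann-Feynman formula summed over the spectrum. Labels of eigenvalues may jump
  with t, but the error in the trace is bounded by a constant times \<open>(t' - t)\<^sup>2\<close>,
  and differentiability follows from that.\<close>

lemma trace_function_derivative:
  fixes th th' :: "real \<Rightarrow> real"
  assumes h: "herm n a" "herm n w"
    and th: "\<And>x y. \<bar>th y - th x - th' x * (y - x)\<bar> \<le> C * (y - x)\<^sup>2"
  defines "A \<equiv> (\<lambda>t::real. \<lambda>r s. a r s + complex_of_real t * w r s)"
  shows "((\<lambda>t. \<Sum>i<n. th (eigval_of n (A t) i)) has_real_derivative
     (\<Sum>i<n. th' (eigval_of n (A t) i) * Re (ip n (eigvec_of n (A t) i) (mv n w (eigvec_of n (A t) i))))) (at t)"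
proof (rule has_real_derivative_quadratic)
  fix t'
  have hA: "herm n (A t)" for t
    using h unfolding herm_def A_def
    by (metis complex_cnj_add complex_cnj_mult complex_cnj_complex_of_real)
  note e = eigsys_ev[OF hA]
  have o: "orthon n n (eigvec_of n (A t))" for t using e[of t] by (simp add: eigsys_def)
  define W where "W = (\<lambda>r s. A t' r s - A t r s)"
  have W: "W = (\<lambda>r s. complex_of_real (t' - t) * w r s)"
    by (simp add: W_def A_def algebra_simps)
  have mW: "mv n W x = (\<lambda>r. complex_of_real (t' - t) * mv n w x r)" for x
    by (rule ext) (simp add: W mv_def sum_distrib_left mult_ac)
  have 1: "(\<Sum>i<n. sqn n (mv n W (eigvec_of n (A t) i))) = (t' - t)\<^sup>2 * (\<Sum>r<n. \<Sum>s<n. (cmod (w r s))\<^sup>2)"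
    unfolding orthon_hilbert_schmidt[OF o]
    by (simp add: W norm_mult power_mult_distrib sum_distrib_left del: of_real_diff)
  have 2: "(\<Sum>i<n. th' (eigval_of n (A t) i) * Re (ip n (eigvec_of n (A t) i) (mv n W (eigvec_of n (A t) i))))
    = (\<Sum>i<n. th' (eigval_of n (A t) i) * Re (ip n (eigvec_of n (A t) i) (mv n w (eigvec_of n (A t) i)))) * (t' - t)"
    by (simp add: mW ip_scale_right sum_distrib_right sum_distrib_left mult_ac del: of_real_diff)
  show "\<bar>(\<Sum>i<n. th (eigval_of n (A t') i)) - (\<Sum>i<n. th (eigval_of n (A t) i)) -
      (\<Sum>i<n. th' (eigval_of n (A t) i) * Re (ip n (eigvec_of n (A t) i) (mv n w (eigvec_of n (A t) i)))) * (t' - t)\<bar>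
      \<le> (C * (\<Sum>r<n. \<Sum>s<n. (cmod (w r s))\<^sup>2)) * (t' - t)\<^sup>2"
    using trace_function_expansion[OF e[of t] e[of t'] hA th, folded W_def] unfolding 1 2
    by (simp add: mult_ac)
qed

section \<open>The Poisson kernel and the scaled arctangent\<close>

definition poisson :: "real \<Rightarrow> real \<Rightarrow> real" where
  "poisson \<epsilon> t = \<epsilon> / (t\<^sup>2 + \<epsilon>\<^sup>2)"

lemma poisson_nonneg [simp]: "0 < \<epsilon> \<Longrightarrow> 0 \<le> poisson \<epsilon> t"
  by (simp add: poisson_def)

text \<open>The kernel is Im 1/(t - i\<epsilon>), without the factor 1/pi; its primitive has total
  variation pi, which is the source of every pi below.\<close>

lemma arctan_scaled_derivative:
  assumes "0 < \<epsilon>"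
  shows "((\<lambda>x. arctan ((x - E) / \<epsilon>)) has_real_derivative poisson \<epsilon> (x - E)) (at x within S)"
proof -
  have "inverse (1 + ((x - E) / \<epsilon>)\<^sup>2) / \<epsilon> = poisson \<epsilon> (x - E)"
    using assms by (simp add: poisson_def power_divide divide_simps) (simp add: power2_eq_square algebra_simps)
  then show ?thesis
    using assms by (auto intro!: derivative_eq_intros simp: divide_inverse mult_ac)
qed

text \<open>By the inequality between the means, \<epsilon> times \<open>\<bar>s\<bar>\<close> is at
  most half of the denominator \<open>p\<close>, and similarly for t. This absorbs the numerator of
  the difference and leaves one factor \<open>1 / \<epsilon>\<^sup>2\<close>.\<close>

lemma poisson_lipschitz:
  assumes "0 < \<epsilon>"
  shows "\<bar>poisson \<epsilon> s - poisson \<epsilon> t\<bar> \<le> \<bar>s - t\<bar> / \<epsilon>\<^sup>2"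
proof -
  define p q where "p = s\<^sup>2 + \<epsilon>\<^sup>2" and "q = t\<^sup>2 + \<epsilon>\<^sup>2"
  have pq: "\<epsilon>\<^sup>2 \<le> p" "\<epsilon>\<^sup>2 \<le> q" "0 < \<epsilon>\<^sup>2" using assms by (auto simp: p_def q_def)
  have pos: "0 < p" "0 < q" using pq by linarith+
  have s: "2 * (\<epsilon> * \<bar>s\<bar>) \<le> p" using zero_le_power2[of "\<bar>s\<bar> - \<epsilon>"] by (simp add: p_def power2_diff mult_ac)
  have t: "2 * (\<epsilon> * \<bar>t\<bar>) \<le> q" using zero_le_power2[of "\<bar>t\<bar> - \<epsilon>"] by (simp add: q_def power2_diff mult_ac)
  have "\<epsilon> * \<bar>t + s\<bar> \<le> \<epsilon> * \<bar>t\<bar> + \<epsilon> * \<bar>s\<bar>"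
    using assms by (simp flip: distrib_left)
  also have "\<dots> \<le> q / 2 + p / 2" using s t by simp
  finally have 1: "\<epsilon> * \<bar>t + s\<bar> \<le> q / 2 + p / 2" .
  have 2: "\<epsilon>\<^sup>2 * (q / 2 + p / 2) \<le> p * q"
  proof -
    have "\<epsilon>\<^sup>2 * q \<le> p * q" "\<epsilon>\<^sup>2 * p \<le> p * q"
      using mult_right_mono[OF pq(1), of q] mult_right_mono[OF pq(2), of p] pos by (auto simp: mult_ac)
    then show ?thesis by (simp add: distrib_left)
  qed
  have "poisson \<epsilon> s - poisson \<epsilon> t = (t - s) * (\<epsilon> * (t + s)) / (p * q)"
    using pos unfolding poisson_def p_def[symmetric] q_def[symmetric]
    by (simp add: divide_simps) (simp add: p_def q_def power2_eq_square algebra_simps)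
  then have "\<bar>poisson \<epsilon> s - poisson \<epsilon> t\<bar> = \<bar>s - t\<bar> * (\<epsilon> * \<bar>t + s\<bar>) / (p * q)"
    using pos assms by (simp add: abs_mult abs_minus_commute)
  also have "\<dots> \<le> \<bar>s - t\<bar> * (q / 2 + p / 2) / (p * q)"
    using pos by (intro divide_right_mono mult_left_mono 1) auto
  also have "\<dots> \<le> \<bar>s - t\<bar> / \<epsilon>\<^sup>2"
  proof -
    have "(q / 2 + p / 2) / (p * q) \<le> 1 / \<epsilon>\<^sup>2"
      using 2 pos pq(3) by (simp add: divide_simps mult_ac)
    then show ?thesis using mult_left_mono[of _ _ "\<bar>s - t\<bar>"] by fastforce
  qed
  finally show ?thesis .
qed

text \<open>The mean value theorem combined with the Lipschitz derivative; this supplies the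
  quadratic error required of \<open>th\<close> in the trace expansion.\<close>

lemma arctan_scaled_expansion:
  assumes e: "0 < \<epsilon>"
  shows "\<bar>arctan ((y - E) / \<epsilon>) - arctan ((x - E) / \<epsilon>) - poisson \<epsilon> (x - E) * (y - x)\<bar> \<le> (1 / \<epsilon>\<^sup>2) * (y - x)\<^sup>2"
proof -
  define th where "th = (\<lambda>x. arctan ((x - E) / \<epsilon>))"
  have d: "(th has_real_derivative poisson \<epsilon> (x - E)) (at x)" for x
    unfolding th_def by (rule arctan_scaled_derivative[OF e])
  have "\<exists>z. \<bar>z - x\<bar> \<le> \<bar>y - x\<bar> \<and> th y - th x = (y - x) * poisson \<epsilon> (z - E)"
  proof (cases x y rule: linorder_cases)
    case less
    then obtain z where "x < z" "z < y" "th y - th x = (y - x) * poisson \<epsilon> (z - E)"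
      using MVT2[of x y th "\<lambda>z. poisson \<epsilon> (z - E)"] d by auto
    then show ?thesis by (intro exI[of _ z]) auto
  next
    case greater
    then obtain z where "y < z" "z < x" "th x - th y = (x - y) * poisson \<epsilon> (z - E)"
      using MVT2[of y x th "\<lambda>z. poisson \<epsilon> (z - E)"] d by auto
    then show ?thesis by (intro exI[of _ z]) (auto simp: algebra_simps)
  qed auto
  then obtain z where z: "\<bar>z - x\<bar> \<le> \<bar>y - x\<bar>" "th y - th x = (y - x) * poisson \<epsilon> (z - E)" by blast
  have "\<bar>th y - th x - poisson \<epsilon> (x - E) * (y - x)\<bar> = \<bar>y - x\<bar> * \<bar>poisson \<epsilon> (z - E) - poisson \<epsilon> (x - E)\<bar>"
    unfolding z(2) by (simp add: algebra_simps flip: abs_mult)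
  also have "\<dots> \<le> \<bar>y - x\<bar> * (\<bar>z - x\<bar> / \<epsilon>\<^sup>2)"
    using poisson_lipschitz[OF e, of "z - E" "x - E"] by (intro mult_left_mono) auto
  also have "\<dots> \<le> \<bar>y - x\<bar> * (\<bar>y - x\<bar> / \<epsilon>\<^sup>2)"
    using z(1) by (intro mult_left_mono divide_right_mono) auto
  also have "\<dots> = (1 / \<epsilon>\<^sup>2) * (y - x)\<^sup>2" by (simp add: power2_eq_square flip: abs_mult)
  finally show ?thesis by (simp add: th_def)
qed

text \<open>A finite-dimensional Krein trace formula, with the difference of the counting functions
  as spectral shift function. An eigenvalue c contributes the integral of \<open>th'\<close> from c
  to R, and the terms at R cancel.\<close>

lemma sum_diff_eq_count_integral:
  fixes d e :: "nat \<Rightarrow> real"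
  assumes deriv: "\<And>x. (th has_real_derivative th' x) (at x)"
    and R: "\<And>i. i < n \<Longrightarrow> d i \<in> {-R..R}" "\<And>i. i < n \<Longrightarrow> e i \<in> {-R..R}"
  shows "((\<lambda>x. th' x * (real (eig_count n d x) - real (eig_count n e x))) has_integral
     ((\<Sum>i<n. th (e i)) - (\<Sum>i<n. th (d i)))) {-R..R}"
proof -
  have I: "((\<lambda>x. if c \<le> x then th' x else 0) has_integral (th R - th c)) {-R..R}" if "c \<in> {-R..R}" for c
  proof -
    have "(th' has_integral (th R - th c)) {c..R}"
      using that by (intro fundamental_theorem_of_calculus)
        (auto intro: has_field_derivative_at_within deriv simp flip: has_real_derivative_iff_has_vector_derivative)
    then have "((\<lambda>x. if x \<in> {c..R} then th' x else 0) has_integral (th R - th c)) {-R..R}"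
      using that by (subst has_integral_restrict) auto
    then show ?thesis by (rule has_integral_eq[rotated]) auto
  qed
  have c: "real (eig_count n f x) = (\<Sum>i<n. if f i \<le> x then 1 else 0)" for f :: "nat \<Rightarrow> real" and x
    unfolding eig_count_def by (simp add: sum.If_cases Int_def lessThan_def)
  have "((\<lambda>x. (\<Sum>i<n. if d i \<le> x then th' x else 0) - (\<Sum>i<n. if e i \<le> x then th' x else 0))
     has_integral ((\<Sum>i<n. th R - th (d i)) - (\<Sum>i<n. th R - th (e i)))) {-R..R}"
    using R by (intro has_integral_diff has_integral_sum I) auto
  moreover have "(\<Sum>i<n. if d i \<le> x then th' x else 0) - (\<Sum>i<n. if e i \<le> x then th' x else 0)
     = th' x * (real (eig_count n d x) - real (eig_count n e x))" for x
    unfolding c right_diff_distrib sum_distrib_left by (intro arg_cong2[of _ _ _ _ "(-)"] sum.cong) auto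
  ultimately show ?thesis by (simp add: sum_subtractf)
qed

lemma exists_bound_finite_families:
  fixes d e :: "nat \<Rightarrow> real"
  shows "\<exists>R\<ge>c. (\<forall>i<n. d i \<in> {-R..R}) \<and> (\<forall>i<n. e i \<in> {-R..R})"
proof -
  define R where "R = \<bar>c\<bar> + (\<Sum>i<n. \<bar>d i\<bar>) + (\<Sum>i<n. \<bar>e i\<bar>)"
  have "\<bar>d i\<bar> \<le> (\<Sum>i<n. \<bar>d i\<bar>)" "\<bar>e i\<bar> \<le> (\<Sum>i<n. \<bar>e i\<bar>)" if "i < n" for i
    using that by (auto intro!: member_le_sum)
  moreover have "0 \<le> (\<Sum>i<n. \<bar>d i\<bar>)" "0 \<le> (\<Sum>i<n. \<bar>e i\<bar>)" by (auto intro: sum_nonneg)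
  ultimately show ?thesis unfolding R_def
    by (intro exI[of _ R] conjI allI impI) (fastforce simp: R_def abs_le_iff)+
qed

text \<open>The spectral shift is at most m, and it is integrated against a kernel of total mass at
  most pi.\<close>

lemma arctan_sum_upper:
  fixes d e :: "nat \<Rightarrow> real"
  assumes e: "0 < \<epsilon>" and eig_count: "\<And>x. eig_count n d x \<le> eig_count n e x + m"
  shows "(\<Sum>i<n. arctan ((e i - E) / \<epsilon>)) - (\<Sum>i<n. arctan ((d i - E) / \<epsilon>)) \<le> real m * pi"
proof -
  define th where "th = (\<lambda>x. arctan ((x - E) / \<epsilon>))"
  have dv: "(th has_real_derivative poisson \<epsilon> (x - E)) (at x within S)" for x S
    unfolding th_def by (rule arctan_scaled_derivative[OF e])
  obtain R where R: "0 \<le> R" "\<forall>i<n. d i \<in> {-R..R}" "\<forall>i<n. e i \<in> {-R..R}"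
    using exists_bound_finite_families[of 0 n d e] by auto
  have 1: "((\<lambda>x. poisson \<epsilon> (x - E) * (real (eig_count n d x) - real (eig_count n e x))) has_integral
     ((\<Sum>i<n. th (e i)) - (\<Sum>i<n. th (d i)))) {-R..R}"
    using R by (intro sum_diff_eq_count_integral dv) auto
  have "((\<lambda>x. poisson \<epsilon> (x - E)) has_integral (th R - th (-R))) {-R..R}"
    using R(1) by (intro fundamental_theorem_of_calculus)
        (auto intro: dv simp flip: has_real_derivative_iff_has_vector_derivative)
  then have 2: "((\<lambda>x. poisson \<epsilon> (x - E) * real m) has_integral ((th R - th (-R)) * real m)) {-R..R}"
    by (rule has_integral_mult_left)
  have "(\<Sum>i<n. th (e i)) - (\<Sum>i<n. th (d i)) \<le> (th R - th (-R)) * real m"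
  proof (rule has_integral_le[OF 1 2])
    fix x
    have "real (eig_count n d x) - real (eig_count n e x) \<le> real m" using eig_count[of x] by linarith
    then show "poisson \<epsilon> (x - E) * (real (eig_count n d x) - real (eig_count n e x)) \<le> poisson \<epsilon> (x - E) * real m"
      using e by (intro mult_left_mono) auto
  qed
  also have "\<dots> \<le> pi * real m"
  proof -
    have "th R < pi / 2" "- (pi/2) < th (-R)" unfolding th_def by (rule arctan_ubound, rule arctan_lbound)
    then have "th R - th (-R) \<le> pi" by linarith
    then show ?thesis by (intro mult_right_mono) auto
  qed
  finally show ?thesis by (simp add: th_def mult.commute)
qed

text \<open>The shift is nonnegative everywhere and at least 1 on the window except at finitely many
  levels, which do not affect the integral.\<close>

lemma arctan_sum_lower:
  fixes d e :: "nat \<Rightarrow> real"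
  assumes e: "0 < \<epsilon>" and eig_count: "\<And>x. eig_count n e x \<le> eig_count n d x" and X: "finite X"
    and gt: "\<And>x. x \<in> {\<alpha>..\<beta>} - X \<Longrightarrow> eig_count n e x + 1 \<le> eig_count n d x" and ab: "\<alpha> \<le> \<beta>"
  shows "arctan ((\<beta> - E) / \<epsilon>) - arctan ((\<alpha> - E) / \<epsilon>)
     \<le> (\<Sum>i<n. arctan ((e i - E) / \<epsilon>)) - (\<Sum>i<n. arctan ((d i - E) / \<epsilon>))"
proof -
  define th where "th = (\<lambda>x. arctan ((x - E) / \<epsilon>))"
  have dv: "(th has_real_derivative poisson \<epsilon> (x - E)) (at x within S)" for x S
    unfolding th_def by (rule arctan_scaled_derivative[OF e])
  obtain R where R: "\<bar>\<alpha>\<bar> + \<bar>\<beta>\<bar> \<le> R" "\<forall>i<n. d i \<in> {-R..R}" "\<forall>i<n. e i \<in> {-R..R}"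
    using exists_bound_finite_families[of "\<bar>\<alpha>\<bar> + \<bar>\<beta>\<bar>" n d e] by auto
  have 1: "((\<lambda>x. poisson \<epsilon> (x - E) * (real (eig_count n d x) - real (eig_count n e x))) has_integral
     ((\<Sum>i<n. th (e i)) - (\<Sum>i<n. th (d i)))) {-R..R}"
    using R by (intro sum_diff_eq_count_integral dv) auto
  have "((\<lambda>x. poisson \<epsilon> (x - E)) has_integral (th \<beta> - th \<alpha>)) {\<alpha>..\<beta>}"
    using ab by (intro fundamental_theorem_of_calculus)
        (auto intro: dv simp flip: has_real_derivative_iff_has_vector_derivative)
  then have "((\<lambda>x. if x \<in> {\<alpha>..\<beta>} then poisson \<epsilon> (x - E) else 0) has_integral (th \<beta> - th \<alpha>)) {-R..R}"
    using R(1) by (subst has_integral_restrict) auto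
  then have 2: "((\<lambda>x. if x \<in> {\<alpha>..\<beta>} - X then poisson \<epsilon> (x - E) else 0) has_integral (th \<beta> - th \<alpha>)) {-R..R}"
    by (rule has_integral_spike_finite[OF X, rotated]) auto
  have "th \<beta> - th \<alpha> \<le> (\<Sum>i<n. th (e i)) - (\<Sum>i<n. th (d i))"
  proof (rule has_integral_le[OF 2 1])
    fix x
    show "(if x \<in> {\<alpha>..\<beta>} - X then poisson \<epsilon> (x - E) else 0) \<le> poisson \<epsilon> (x - E) * (real (eig_count n d x) - real (eig_count n e x))"
    proof (cases "x \<in> {\<alpha>..\<beta>} - X")
      case True
      then have "1 \<le> real (eig_count n d x) - real (eig_count n e x)" using gt[of x] by linarith
      then have "poisson \<epsilon> (x - E) * 1 \<le> poisson \<epsilon> (x - E) * (real (eig_count n d x) - real (eig_count n e x))"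
        using e by (intro mult_left_mono) auto
      then show ?thesis using True by simp
    next
      case False
      then show ?thesis using eig_count[of x] e by auto
    qed
  qed
  then show ?thesis by (simp add: th_def)
qed

section \<open>Comparing eigenvalue counts\<close>

lemma sum_lessThan_add:
  fixes p q :: nat
  shows "(\<Sum>r<p+q. f r) = (\<Sum>r<p. f r) + (\<Sum>s<q. f (p + s) :: 'a::comm_monoid_add)"
  by (induction q) (auto simp: add.assoc)

text \<open>Otherwise the low space of \<open>a\<close> contains a nonzero vector that is killed by
  F and orthogonal to the low eigenvectors of \<open>b\<close>. Its \<open>b\<close>-form lies
  strictly above t times its squared norm, its \<open>a\<close>-form does not, and on the kernel of
  F the \<open>b\<close>-form is the smaller one.\<close>

lemma eig_count_le_functionals:
  assumes a: "eigsys n a u d" and b: "eigsys n b v e" and F: "finite F"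
    and le: "\<And>x. (\<forall>l\<in>F. (\<Sum>r<n. l r * x r) = 0) \<Longrightarrow> Re (ip n x (mv n b x)) \<le> Re (ip n x (mv n a x))"
  shows "eig_count n d t \<le> eig_count n e t + card F"
proof (rule ccontr)
  assume neg: "\<not> ?thesis"
  let ?S = "{i\<in>{..<n}. d i \<le> t}" and ?T = "{i\<in>{..<n}. e i \<le> t}"
  let ?G = "(\<lambda>l i. \<Sum>r<n. l r * u i r) ` F \<union> (\<lambda>j i. ip n (v j) (u i)) ` ?T"
  have "card ?G \<le> card F + card ?T"
    by (rule order_trans[OF card_Un_le add_mono]) (use F in \<open>auto intro: card_image_le\<close>)
  then have "card ?G < card ?S" using neg by (simp add: eig_count_def)
  from nontrivial_solution[OF _ _ this] F obtain c where c: "\<exists>i\<in>?S. c i \<noteq> 0"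
    "\<forall>l\<in>?G. (\<Sum>i\<in>?S. l i * c i) = 0" by auto
  define x where "x = (\<lambda>r. \<Sum>i\<in>?S. c i * u i r)"
  have 1: "(\<Sum>r<n. l r * x r) = 0" if "l \<in> F" for l
  proof -
    have "(\<Sum>r<n. l r * x r) = (\<Sum>i\<in>?S. (\<Sum>r<n. l r * u i r) * c i)"
      unfolding x_def sum_distrib_left sum_distrib_right
      by (subst sum.swap) (simp add: mult_ac)
    then show ?thesis using c(2) that by auto
  qed
  have 2: "ip n (v j) x = 0" if "j < n" "e j \<le> t" for j
  proof -
    have "ip n (v j) x = (\<Sum>i\<in>?S. ip n (v j) (u i) * c i)"
      unfolding x_def ip_sum_right by (simp add: mult.commute)
    then show ?thesis using c(2) that by auto
  qed
  note lo = low_vector_form[OF a subset_refl x_def]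
  have "sqn n x \<noteq> 0"
    unfolding lo(2) using c(1) by (subst sum_nonneg_eq_0_iff) auto
  then have "t * sqn n x < Re (ip n x (mv n b x))"
    using high_vector_form(2)[OF b 2] by blast
  moreover have "Re (ip n x (mv n b x)) \<le> Re (ip n x (mv n a x))"
    using 1 by (intro le ballI)
  ultimately show False using lo(1) by linarith
qed

text \<open>In an eigenbasis \<open>ec\<close>, \<open>c\<close> of the lower block, \<open>schurM\<close> is the correction that eliminating this block
  adds to the last \<open>L\<close> coordinates of the upper block, and \<open>shifted_coord\<close> is the coordinate that
  completes the square.\<close>

definition coupling_coeff :: "nat \<Rightarrow> nat \<Rightarrow> nat \<Rightarrow> (nat \<Rightarrow> nat \<Rightarrow> complex) \<Rightarrow> (nat \<Rightarrow> nat \<Rightarrow> complex) \<Rightarrow> nat \<Rightarrow> nat \<Rightarrow> complex" where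
  "coupling_coeff p L q a ec k j = (\<Sum>s<q. cnj (ec k s) * cnj (a (p - L + j) (p + s)))"

definition schurM :: "nat \<Rightarrow> nat \<Rightarrow> nat \<Rightarrow> (nat \<Rightarrow> nat \<Rightarrow> complex) \<Rightarrow> (nat \<Rightarrow> nat \<Rightarrow> complex) \<Rightarrow> (nat \<Rightarrow> real) \<Rightarrow> real \<Rightarrow> nat \<Rightarrow> nat \<Rightarrow> complex" where
  "schurM p L q a ec c x i j = (\<Sum>k<q. cnj (coupling_coeff p L q a ec k i) * coupling_coeff p L q a ec k j / complex_of_real (c k - x))"

lemma herm_schurM: "herm L (schurM p L q a ec c x)"
  by (simp add: herm_def schurM_def mult.commute)

definition coupling :: "nat \<Rightarrow> nat \<Rightarrow> nat \<Rightarrow> (nat \<Rightarrow> nat \<Rightarrow> complex) \<Rightarrow> (nat \<Rightarrow> nat \<Rightarrow> complex) \<Rightarrow> nat \<Rightarrow> (nat \<Rightarrow> complex) \<Rightarrow> complex" where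
  "coupling p L q a ec k y = (\<Sum>j<L. coupling_coeff p L q a ec k j * y (p - L + j))"

definition shifted_coord :: "nat \<Rightarrow> nat \<Rightarrow> nat \<Rightarrow> (nat \<Rightarrow> nat \<Rightarrow> complex) \<Rightarrow> (nat \<Rightarrow> nat \<Rightarrow> complex) \<Rightarrow> (nat \<Rightarrow> real) \<Rightarrow> real \<Rightarrow> nat \<Rightarrow> (nat \<Rightarrow> complex) \<Rightarrow> complex" where
  "shifted_coord p L q a ec c x k y = ip q (ec k) (\<lambda>s. y (p + s)) + coupling p L q a ec k y / complex_of_real (c k - x)"

lemma coupling_sum: "coupling p L q a ec k (\<lambda>r. \<Sum>i\<in>S. c i * u i r) = (\<Sum>i\<in>S. c i * coupling p L q a ec k (u i))"
  unfolding coupling_def sum_distrib_left by (subst sum.swap) (simp add: mult_ac)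

lemma shifted_coord_sum: "shifted_coord p L q a ec c x k (\<lambda>r. \<Sum>i\<in>S. g i * u i r) = (\<Sum>i\<in>S. shifted_coord p L q a ec c x k (u i) * g i)"
  unfolding shifted_coord_def coupling_sum ip_sum_right
  by (simp add: sum_distrib_right sum_divide_distrib distrib_left sum.distrib mult_ac)

lemma complete_square:
  fixes w b :: complex and g :: real
  assumes "g \<noteq> 0"
  shows "g * (cmod (w + b / complex_of_real g))\<^sup>2 = g * (cmod w)\<^sup>2 + 2 * Re (cnj b * w) + (cmod b)\<^sup>2 / g"
proof -
  have r: "g * (s + t / g)\<^sup>2 = g * s\<^sup>2 + 2 * (t * s) + t\<^sup>2 / g" for s t :: real
    unfolding power2_sum power_divide distrib_left using assms by (simp add: power2_eq_square)
  have "g * (cmod (w + b / complex_of_real g))\<^sup>2 = g * (Re w + Re b / g)\<^sup>2 + g * (Im w + Im b / g)\<^sup>2"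
    unfolding cmod_power2 plus_complex.sel Re_divide_of_real Im_divide_of_real by (rule distrib_left)
  also have "\<dots> = g * (Re w)\<^sup>2 + 2 * (Re b * Re w) + (Re b)\<^sup>2 / g + (g * (Im w)\<^sup>2 + 2 * (Im b * Im w) + (Im b)\<^sup>2 / g)"
    unfolding r ..
  also have "\<dots> = g * ((Re w)\<^sup>2 + (Im w)\<^sup>2) + 2 * (Re b * Re w + Im b * Im w) + ((Re b)\<^sup>2 + (Im b)\<^sup>2) / g"
    by (simp only: distrib_left add_divide_distrib add_ac)
  also have "Re b * Re w + Im b * Im w = Re (cnj b * w)" by simp
  finally show ?thesis unfolding cmod_power2 .
qed

text \<open>Completing the square in each eigencoordinate of the lower block removes the cross
  terms. By \<open>band\<close> these involve only the last L coordinates of the upper block, so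
  what they leave behind is a form on L coordinates.\<close>

lemma schur_form:
  assumes h: "herm (p + q) a" and C: "eigsys q (\<lambda>r s. a (p + r) (p + s)) ec c"
    and L: "L \<le> p" and band: "\<And>r s. r < p - L \<Longrightarrow> s < q \<Longrightarrow> a r (p + s) = 0"
    and x: "\<And>k. k < q \<Longrightarrow> c k \<noteq> x"
  shows "Re (ip (p+q) y (mv (p+q) a y)) - x * sqn (p+q) y =
     (Re (ip p y (mv p a y)) - x * sqn p y)
     - Re (ip L (\<lambda>j. y (p - L + j)) (mv L (schurM p L q a ec c x) (\<lambda>j. y (p - L + j))))
     + (\<Sum>k<q. (c k - x) * (cmod (shifted_coord p L q a ec c x k y))\<^sup>2)"
proof -
  define w where "w = (\<lambda>s. y (p + s))"
  define X where "X = (\<Sum>r<p. \<Sum>s<q. cnj (y r) * a r (p + s) * w s)"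
  define b where "b = (\<lambda>s. \<Sum>r<p. cnj (a r (p + s)) * y r)"
  have oq: "orthon q q ec" using C by (simp add: eigsys_def)
  have har: "a (p + s) r = cnj (a r (p + s))" if "r < p" "s < q" for r s
    by (rule h[unfolded herm_def, rule_format]) (use that in auto)
  have "ip (p+q) y (mv (p+q) a y) = (\<Sum>r<p. cnj (y r) * mv (p+q) a y r) + (\<Sum>s<q. cnj (w s) * mv (p+q) a y (p + s))"
    unfolding ip_def sum_lessThan_add w_def ..
  also have "(\<Sum>r<p. cnj (y r) * mv (p+q) a y r) = ip p y (mv p a y) + X"
    unfolding mv_def sum_lessThan_add ip_def X_def w_def
    by (simp add: distrib_left sum.distrib sum_distrib_left mult_ac)
  also have "(\<Sum>s<q. cnj (w s) * mv (p+q) a y (p + s)) = (\<Sum>s<q. \<Sum>r<p. cnj (w s) * cnj (a r (p + s)) * y r) + ip q w (mv q (\<lambda>r s. a (p + r) (p + s)) w)"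
    unfolding mv_def sum_lessThan_add ip_def w_def
    using har by (simp add: distrib_left sum.distrib sum_distrib_left mult_ac)
  also have "(\<Sum>s<q. \<Sum>r<p. cnj (w s) * cnj (a r (p + s)) * y r) = cnj X"
    unfolding X_def by (subst sum.swap) (simp add: mult_ac)
  finally have 1: "Re (ip (p+q) y (mv (p+q) a y)) = Re (ip p y (mv p a y)) + 2 * Re X + Re (ip q w (mv q (\<lambda>r s. a (p + r) (p + s)) w))"
    by simp
  have "X = ip q b w"
    unfolding X_def b_def ip_def cnj_sum sum_distrib_right by (subst sum.swap) (simp add: mult_ac)
  then have X: "X = (\<Sum>k<q. cnj (ip q (ec k) b) * ip q (ec k) w)"
    by (simp only: orthon_parseval_ip[OF oq, of b w])
  have bk: "ip q (ec k) b = coupling p L q a ec k y" for k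
  proof -
    have "ip q (ec k) b = (\<Sum>r<p. (\<Sum>s<q. cnj (ec k s) * cnj (a r (p + s))) * y r)"
      unfolding b_def ip_def sum_distrib_left sum_distrib_right by (subst sum.swap) (simp add: mult_ac)
    also have "\<dots> = (\<Sum>r<(p-L)+L. (\<Sum>s<q. cnj (ec k s) * cnj (a r (p + s))) * y r)" using L by simp
    also have "\<dots> = coupling p L q a ec k y"
      unfolding sum_lessThan_add using band by (simp add: coupling_def coupling_coeff_def)
    finally show ?thesis .
  qed
  have s: "sqn (p+q) y = sqn p y + sqn q w"
    by (simp add: sqn_def sum_lessThan_add w_def)
  have M: "Re (ip L (\<lambda>j. y (p - L + j)) (mv L (schurM p L q a ec c x) (\<lambda>j. y (p - L + j))))
     = (\<Sum>k<q. (cmod (coupling p L q a ec k y))\<^sup>2 / (c k - x))"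
  proof -
    let ?y = "\<lambda>j. y (p - L + j)"
    have "ip L ?y (mv L (schurM p L q a ec c x) ?y) = (\<Sum>i<L. \<Sum>j<L. \<Sum>k<q. (cnj (?y i) * cnj (coupling_coeff p L q a ec k i)) * (coupling_coeff p L q a ec k j * ?y j) / complex_of_real (c k - x))"
      unfolding ip_def mv_def schurM_def by (simp add: sum_distrib_left sum_distrib_right mult_ac)
    also have "\<dots> = (\<Sum>k<q. \<Sum>i<L. \<Sum>j<L. (cnj (?y i) * cnj (coupling_coeff p L q a ec k i)) * (coupling_coeff p L q a ec k j * ?y j) / complex_of_real (c k - x))"
      by (subst (2) sum.swap, subst sum.swap, rule refl)
    also have "\<dots> = (\<Sum>k<q. cnj (coupling p L q a ec k y) * coupling p L q a ec k y / complex_of_real (c k - x))"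
      unfolding coupling_def by (simp add: sum_distrib_left sum_distrib_right sum_divide_distrib mult_ac)
    also have "\<dots> = complex_of_real (\<Sum>k<q. (cmod (coupling p L q a ec k y))\<^sup>2 / (c k - x))"
      unfolding cnj_mult_self of_real_sum of_real_divide ..
    finally show ?thesis by simp
  qed
  have "Re (ip q w (mv q (\<lambda>r s. a (p + r) (p + s)) w)) - x * sqn q w + 2 * Re X =
     (\<Sum>k<q. (c k - x) * (cmod (ip q (ec k) w))\<^sup>2 + 2 * Re (cnj (coupling p L q a ec k y) * ip q (ec k) w))"
    unfolding eigsys_form(1)[OF C] X bk orthon_parseval[OF oq, of w]
    by (simp add: left_diff_distrib sum.distrib sum_subtractf sum_distrib_left)
  also have "\<dots> = (\<Sum>k<q. (c k - x) * (cmod (shifted_coord p L q a ec c x k y))\<^sup>2 - (cmod (coupling p L q a ec k y))\<^sup>2 / (c k - x))"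
  proof (rule sum.cong[OF refl])
    fix k assume "k \<in> {..<q}"
    then have "c k - x \<noteq> 0" using x by simp
    from complete_square[OF this] 
    show "(c k - x) * (cmod (ip q (ec k) w))\<^sup>2 + 2 * Re (cnj (coupling p L q a ec k y) * ip q (ec k) w) =
      (c k - x) * (cmod (shifted_coord p L q a ec c x k y))\<^sup>2 - (cmod (coupling p L q a ec k y))\<^sup>2 / (c k - x)"
      by (simp add: shifted_coord_def w_def)
  qed
  finally show ?thesis unfolding 1 s M by (simp add: sum_subtractf distrib_left)
qed

text \<open>One half of the inertia formula for Schur complements. With more low eigenvalues than
  the bound, some nonzero low vector has no shifted coordinate below x, is orthogonal to the low
  eigenvectors of the upper block, and avoids the positive directions of the correction. All three
  parts of the decomposed form are then nonnegative while their sum is at most 0.\<close>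

lemma schur_count:
  assumes h: "herm (p + q) a" and A: "eigsys (p + q) a u d" and D: "eigsys p a v e"
    and C: "eigsys q (\<lambda>r s. a (p + r) (p + s)) ec c"
    and L: "L \<le> p" and band: "\<And>r s. r < p - L \<Longrightarrow> s < q \<Longrightarrow> a r (p + s) = 0"
    and x: "\<And>k. k < q \<Longrightarrow> c k \<noteq> x"
    and M: "eigsys L (schurM p L q a ec c x) f g"
  shows "eig_count (p + q) d x \<le> eig_count q c x + eig_count p e x + card {l\<in>{..<L}. 0 < g l}"
proof (rule ccontr)
  assume neg: "\<not> ?thesis"
  let ?n = "p + q"
  let ?S = "{i\<in>{..<?n}. d i \<le> x}" and ?T = "{i\<in>{..<q}. c i \<le> x}" and ?U = "{i\<in>{..<p}. e i \<le> x}" and ?P = "{l\<in>{..<L}. 0 < g l}"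
  let ?G = "(\<lambda>k i. shifted_coord p L q a ec c x k (u i)) ` ?T \<union> ((\<lambda>j i. ip p (v j) (u i)) ` ?U
     \<union> (\<lambda>l i. ip L (f l) (\<lambda>j. u i (p - L + j))) ` ?P)"
  have "card ?G \<le> card ?T + (card ?U + card ?P)"
    by (intro order_trans[OF card_Un_le] add_mono card_image_le) auto
  then have "card ?G < card ?S" using neg by (simp add: eig_count_def)
  from nontrivial_solution[OF _ _ this] obtain \<gamma> where \<gamma>: "\<exists>i\<in>?S. \<gamma> i \<noteq> 0"
    "\<forall>l\<in>?G. (\<Sum>i\<in>?S. l i * \<gamma> i) = 0" by auto
  define y where "y = (\<lambda>r. \<Sum>i\<in>?S. \<gamma> i * u i r)"
  have 1: "shifted_coord p L q a ec c x k y = 0" if "k < q" "c k \<le> x" for k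
    using \<gamma>(2) that unfolding y_def shifted_coord_sum by auto
  have 2: "ip p (v j) y = 0" if "j < p" "e j \<le> x" for j
  proof -
    have "ip p (v j) y = (\<Sum>i\<in>?S. ip p (v j) (u i) * \<gamma> i)"
      unfolding y_def ip_sum_right by (simp add: mult.commute)
    then show ?thesis using \<gamma>(2) that by auto
  qed
  let ?y = "\<lambda>j. y (p - L + j)"
  have 3: "ip L (f l) ?y = 0" if "l < L" "0 < g l" for l
  proof -
    have "ip L (f l) ?y = (\<Sum>i\<in>?S. ip L (f l) (\<lambda>j. u i (p - L + j)) * \<gamma> i)"
      unfolding y_def ip_sum_right by (simp add: mult.commute)
    then show ?thesis using \<gamma>(2) that by auto
  qed
  note lo = low_vector_form[OF A subset_refl y_def]
  have ynz: "sqn ?n y \<noteq> 0"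
    unfolding lo(2) using \<gamma>(1) by (subst sum_nonneg_eq_0_iff) auto
  have "Re (ip L ?y (mv L (schurM p L q a ec c x) ?y)) \<le> 0"
    unfolding eigsys_form(1)[OF M]
  proof (intro sum_nonpos)
    fix i assume "i \<in> {..<L}"
    then show "g i * (cmod (ip L (f i) ?y))\<^sup>2 \<le> 0"
      using 3[of i] by (cases "0 < g i") (auto intro: mult_nonpos_nonneg)
  qed
  moreover have s0: "0 \<le> (c k - x) * (cmod (shifted_coord p L q a ec c x k y))\<^sup>2" if "k < q" for k
    using 1[OF that] by (cases "c k \<le> x") auto
  moreover note D1 = high_vector_form[OF D 2]
  moreover note F = schur_form[OF h C L band x, of y]
  ultimately have le: "Re (ip p y (mv p a y)) - x * sqn p y + (\<Sum>k<q. (c k - x) * (cmod (shifted_coord p L q a ec c x k y))\<^sup>2) \<le> 0"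
    using lo(1) by linarith
  have "0 \<le> (\<Sum>k<q. (c k - x) * (cmod (shifted_coord p L q a ec c x k y))\<^sup>2)" using s0 by (intro sum_nonneg) auto
  \<comment> \<open>Equality holds throughout. Strictness in the upper block makes y vanish there,
    hence the couplings vanish, the shifted coordinates become plain ones, and these vanish
    too.\<close>
  then have yp: "sqn p y = 0" and ws: "(\<Sum>k<q. (c k - x) * (cmod (shifted_coord p L q a ec c x k y))\<^sup>2) = 0"
    using le D1 by (force, smt (verit))
  have y0: "y r = 0" if "r < p" for r using yp that by (simp add: sqn_eq_0)
  have b0: "coupling p L q a ec k y = 0" for k
    unfolding coupling_def using y0 L by (intro sum.neutral) auto
  have "ip q (ec k) (\<lambda>s. y (p + s)) = 0" if "k < q" for k
  proof -
    have "(c k - x) * (cmod (shifted_coord p L q a ec c x k y))\<^sup>2 = 0"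
      using ws s0 that by (subst (asm) sum_nonneg_eq_0_iff) auto
    then have "shifted_coord p L q a ec c x k y = 0" using x[OF that] by simp
    then show ?thesis using b0 by (simp add: shifted_coord_def)
  qed
  then have "sqn q (\<lambda>s. y (p + s)) = 0"
    using C unfolding eigsys_def by (subst orthon_parseval) auto
  then have "sqn ?n y = 0" using yp by (simp add: sqn_def sum_lessThan_add)
  then show False using ynz by simp
qed

lemma eigsys_uminus: "eigsys n a u d \<Longrightarrow> eigsys n (\<lambda>r s. - a r s) u (\<lambda>i. - d i)"
  by (simp add: eigsys_def mv_def sum_negf)

text \<open>Since x is not an eigenvalue, the reflected count has no tie to count twice.\<close>

lemma eig_count_uminus:
  assumes "\<And>i. i < n \<Longrightarrow> d i \<noteq> x"
  shows "eig_count n (\<lambda>i. - d i) (- x) + eig_count n d x = n"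
proof -
  have "{i\<in>{..<n}. - d i \<le> - x} \<union> {i\<in>{..<n}. d i \<le> x} = {..<n}" by auto
  moreover have "{i\<in>{..<n}. - d i \<le> - x} \<inter> {i\<in>{..<n}. d i \<le> x} = {}" using assms by force
  ultimately show ?thesis
    unfolding eig_count_def using card_Un_disjoint[of "{i\<in>{..<n}. - d i \<le> - x}" "{i\<in>{..<n}. d i \<le> x}"] by simp
qed

text \<open>The Schur complement of the common lower block acts on only L coordinates, so passing from
  the upper block to the whole matrix loses at most L eigenvalue crossings.\<close>

lemma schur_count_difference:
  assumes h: "herm (p + q) a" "herm (p + q) b"
    and A: "eigsys (p + q) a u d" and D: "eigsys p a v e"
    and A': "eigsys (p + q) b u' d'" and D': "eigsys p b v' e'"
    and C: "eigsys q (\<lambda>r s. a (p + r) (p + s)) ec c"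
    and L: "L \<le> p" and band: "\<And>r s. r < p - L \<Longrightarrow> s < q \<Longrightarrow> a r (p + s) = 0"
    and eq: "\<And>r s. p \<le> s \<Longrightarrow> b r s = a r s"
    and x: "\<And>k. k < q \<Longrightarrow> c k \<noteq> x" "\<And>k. k < p \<Longrightarrow> e k \<noteq> x" "\<And>k. k < p + q \<Longrightarrow> d k \<noteq> x"
  shows "eig_count (p + q) d' x + eig_count p e x \<le> eig_count (p + q) d x + eig_count p e' x + L"
proof -
  let ?M = "schurM p L q a ec c x"
  obtain f g where M: "eigsys L ?M f g" using eigsys_ev[OF herm_schurM] by blast
  \<comment> \<open>The correction reads only columns from p on, where \<open>a\<close> and
    \<open>b\<close> agree. It is therefore the same for both pencils.\<close>
  have Mb: "schurM p L q b ec c x = ?M"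
    by (intro ext) (simp add: schurM_def coupling_coeff_def eq)
  have Cb: "eigsys q (\<lambda>r s. b (p + r) (p + s)) ec c" using C by (simp add: eq)
  have 1: "eig_count (p + q) d' x \<le> eig_count q c x + eig_count p e' x + card {l\<in>{..<L}. 0 < g l}"
    by (rule schur_count[OF h(2) A' D' Cb L _ x(1)]) (use band eq M Mb in auto)
  \<comment> \<open>Reflecting all matrices turns the upper bound on counts into a lower bound for
    \<open>a\<close>; the correction changes its sign.\<close>
  have Mm: "schurM p L q (\<lambda>r s. - a r s) ec (\<lambda>k. - c k) (- x) = (\<lambda>r s. - ?M r s)"
  proof (intro ext)
    fix i j
    have m: "complex_of_real (- c k - - x) = - complex_of_real (c k - x)" for k by simp
    have s: "coupling_coeff p L q (\<lambda>r s. - a r s) ec k i = - coupling_coeff p L q a ec k i" for k i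
      by (simp add: coupling_coeff_def sum_negf)
    show "schurM p L q (\<lambda>r s. - a r s) ec (\<lambda>k. - c k) (- x) i j = - ?M i j"
      unfolding schurM_def m s sum_negf[symmetric]
      by (intro sum.cong refl) (simp del: of_real_diff)
  qed
  have hm: "herm (p + q) (\<lambda>r s. - a r s)" using h(1) unfolding herm_def by (metis complex_cnj_minus)
  have "eig_count (p + q) (\<lambda>i. - d i) (- x) \<le> eig_count q (\<lambda>i. - c i) (- x) + eig_count p (\<lambda>i. - e i) (- x) + card {l\<in>{..<L}. 0 < - g l}"
    by (rule schur_count[OF hm eigsys_uminus[OF A] eigsys_uminus[OF D] eigsys_uminus[OF C] L])
      (use band x eigsys_uminus[OF M] Mm in auto)
  moreover have "eig_count (p + q) (\<lambda>i. - d i) (- x) + eig_count (p + q) d x = p + q"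
    "eig_count q (\<lambda>i. - c i) (- x) + eig_count q c x = q" "eig_count p (\<lambda>i. - e i) (- x) + eig_count p e x = p"
    by (intro eig_count_uminus; use x in auto)+
  \<comment> \<open>Positive and negative directions of one matrix are disjoint, so the two
    inequalities together lose L and not 2L.\<close>
  moreover have "card {l\<in>{..<L}. 0 < g l} + card {l\<in>{..<L}. 0 < - g l} \<le> L"
  proof -
    have "card {l\<in>{..<L}. 0 < g l} + card {l\<in>{..<L}. 0 < - g l} = card ({l\<in>{..<L}. 0 < g l} \<union> {l\<in>{..<L}. 0 < - g l})"
      by (rule card_Un_disjoint[symmetric]) auto
    also have "\<dots> \<le> card {..<L}" by (intro card_mono) auto
    finally show ?thesis by simp
  qed
  ultimately show ?thesis using 1 by linarith
qed

section \<open>Block tridiagonal matrices\<close>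

text \<open>The infinite block matrix on flat indices, with site \<open>r div L + 1\<close> and
  component \<open>r mod L\<close>. Every truncation is the restriction of this one
  function.\<close>

definition jacobi_entry :: "nat \<Rightarrow> (nat \<Rightarrow> complex mat) \<Rightarrow> (nat \<Rightarrow> complex mat) \<Rightarrow> nat \<Rightarrow> nat \<Rightarrow> complex" where
  "jacobi_entry L T U r s = (let a = r div L + 1; i = r mod L; b = s div L + 1; k = s mod L in
      if a = b then U a $$ (i,k)
      else if b = a + 1 then T (a + 1) $$ (i,k)
      else if a = b + 1 then cnj (T a $$ (k,i))
      else 0)"

definition weight_entry :: "nat \<Rightarrow> nat \<Rightarrow> (nat \<Rightarrow> complex mat) \<Rightarrow> nat \<Rightarrow> nat \<Rightarrow> complex" where
  "weight_entry L N W r s = (if r div L = s div L \<and> r div L < N then W (r div L + 1) $$ (r mod L, s mod L) else 0)"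

lemma HN_eq_jacobi_entry: "HN L N T V W \<mu> = mat (N * L) (N * L) (\<lambda>(r,s). jacobi_entry L T (Vmu N V W \<mu>) r s)"
  unfolding HN_def jacobi_entry_def ..

lemma sum_blocks: "(\<Sum>r<K*L. f r) = (\<Sum>m<K. \<Sum>j<L. f (m * L + j))" for L K :: nat
proof -
  have "(\<Sum>j<L. f (m * L + j)) = sum f {m * L..<m * L + L}" for m
    using sum.shift_bounds_nat_ivl[of f 0 "m * L" L] by (simp add: atLeast0LessThan add.commute)
  then show ?thesis using sum.nat_group[of f L K] by simp
qed

lemma cmod_sum_mult_le:
  "(cmod (\<Sum>k<L. a k * x k))\<^sup>2 \<le> (\<Sum>k<L. (cmod (a k))\<^sup>2) * (\<Sum>k<L. (cmod (x k))\<^sup>2)"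
proof -
  have "cmod (\<Sum>k<L. a k * x k) \<le> (\<Sum>k<L. cmod (a k) * cmod (x k))"
    by (rule order_trans[OF norm_sum]) (simp add: norm_mult)
  then have "(cmod (\<Sum>k<L. a k * x k))\<^sup>2 \<le> (\<Sum>k<L. cmod (a k) * cmod (x k))\<^sup>2"
    by (intro power_mono) auto
  also have "\<dots> \<le> (\<Sum>k<L. (cmod (a k))\<^sup>2) * (\<Sum>k<L. (cmod (x k))\<^sup>2)"
    by (rule Cauchy_Schwarz_ineq_sum)
  finally show ?thesis .
qed

lemma matrix_sqn_le:
  assumes "\<And>i k. i < L \<Longrightarrow> k < L \<Longrightarrow> cmod (A i k) \<le> B"
  shows "(\<Sum>i<L. (cmod (\<Sum>k<L. A i k * x k))\<^sup>2) \<le> (real L * B)\<^sup>2 * (\<Sum>k<L. (cmod (x k))\<^sup>2)"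
proof -
  have "(cmod (\<Sum>k<L. A i k * x k))\<^sup>2 \<le> real L * B\<^sup>2 * (\<Sum>k<L. (cmod (x k))\<^sup>2)" if "i < L" for i
  proof -
    have "(\<Sum>k<L. (cmod (A i k))\<^sup>2) \<le> (\<Sum>k<L. B\<^sup>2)"
      using assms that by (intro sum_mono power_mono) auto
    then show ?thesis
      by (intro order_trans[OF cmod_sum_mult_le] mult_right_mono) (auto intro: sum_nonneg)
  qed
  then have "(\<Sum>i<L. (cmod (\<Sum>k<L. A i k * x k))\<^sup>2) \<le> (\<Sum>i<L. real L * B\<^sup>2 * (\<Sum>k<L. (cmod (x k))\<^sup>2))"
    by (intro sum_mono) auto
  then show ?thesis by (simp add: power_mult_distrib power2_eq_square mult_ac)
qed

lemma cmod_add_sq_le: "(cmod (a + b))\<^sup>2 \<le> 2 * ((cmod a)\<^sup>2 + (cmod b)\<^sup>2)"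
proof -
  have "(cmod (a + b))\<^sup>2 \<le> (cmod a + cmod b)\<^sup>2" by (intro power_mono norm_triangle_ineq) auto
  also have "\<dots> \<le> 2 * ((cmod a)\<^sup>2 + (cmod b)\<^sup>2)"
    using zero_le_power2[of "cmod a - cmod b"] by (simp add: power2_sum power2_diff)
  finally show ?thesis .
qed

section \<open>Growth of block norms along the three term recursion\<close>

definition block_sqnorm :: "nat \<Rightarrow> (nat \<Rightarrow> complex) \<Rightarrow> nat \<Rightarrow> real" where
  "block_sqnorm L x m = (\<Sum>j<L. (cmod (x (m * L + j)))\<^sup>2)"

lemma block_sqnorm_nonneg [simp]: "0 \<le> block_sqnorm L x m"
  by (simp add: block_sqnorm_def sum_nonneg)

text \<open>The recursion is solved for the block x multiplied by the invertible coefficient A, from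
  two known blocks y and z; it serves both directions. Of the fourth power, one square comes from
  the inverse \<open>A'\<close> and one from U and Z; the factor 2 comes from splitting the
  sum.\<close>

lemma three_term_step:
  fixes A A' U Z :: "nat \<Rightarrow> nat \<Rightarrow> complex"
  assumes B: "1 \<le> B"
    and A': "\<And>x i. i < L \<Longrightarrow> (\<Sum>k<L. A' i k * (\<Sum>j<L. A k j * x j)) = x i"
    and bd: "\<And>i k. i < L \<Longrightarrow> k < L \<Longrightarrow> cmod (A' i k) \<le> B"
      "\<And>i k. i < L \<Longrightarrow> k < L \<Longrightarrow> cmod (U i k) \<le> B"
      "\<And>i k. i < L \<Longrightarrow> k < L \<Longrightarrow> cmod (Z i k) \<le> B"
    and eq: "\<And>i. i < L \<Longrightarrow> (\<Sum>k<L. A i k * x k) = - ((\<Sum>k<L. U i k * y k) + (\<Sum>k<L. Z i k * z k))"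
  shows "(\<Sum>k<L. (cmod (x k))\<^sup>2) \<le> 2 * (real L * B)^4 * ((\<Sum>k<L. (cmod (y k))\<^sup>2) + (\<Sum>k<L. (cmod (z k))\<^sup>2))"
proof -
  have "(\<Sum>k<L. (cmod (x k))\<^sup>2) = (\<Sum>i<L. (cmod (\<Sum>k<L. A' i k * (\<Sum>j<L. A k j * x j)))\<^sup>2)"
    using A' by simp
  also have "\<dots> \<le> (real L * B)\<^sup>2 * (\<Sum>k<L. (cmod (\<Sum>j<L. A k j * x j))\<^sup>2)"
    by (rule matrix_sqn_le) (rule bd)
  also have "\<dots> \<le> (real L * B)\<^sup>2 * (\<Sum>k<L. 2 * ((cmod (\<Sum>j<L. U k j * y j))\<^sup>2 + (cmod (\<Sum>j<L. Z k j * z j))\<^sup>2))"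
  proof (intro mult_left_mono sum_mono)
    fix k assume "k \<in> {..<L}"
    then have "k < L" by simp
    show "(cmod (\<Sum>j<L. A k j * x j))\<^sup>2 \<le> 2 * ((cmod (\<Sum>j<L. U k j * y j))\<^sup>2 + (cmod (\<Sum>j<L. Z k j * z j))\<^sup>2)"
      unfolding eq[OF \<open>k < L\<close>] norm_minus_cancel by (rule cmod_add_sq_le)
  qed simp
  also have "\<dots> = (real L * B)\<^sup>2 * (2 * ((\<Sum>k<L. (cmod (\<Sum>j<L. U k j * y j))\<^sup>2) + (\<Sum>k<L. (cmod (\<Sum>j<L. Z k j * z j))\<^sup>2)))"
    by (simp add: sum.distrib flip: sum_distrib_left)
  also have "\<dots> \<le> (real L * B)\<^sup>2 * (2 * ((real L * B)\<^sup>2 * (\<Sum>k<L. (cmod (y k))\<^sup>2) + (real L * B)\<^sup>2 * (\<Sum>k<L. (cmod (z k))\<^sup>2)))"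
    by (intro mult_left_mono add_mono matrix_sqn_le bd) auto
  also have "\<dots> = 2 * (real L * B)^4 * ((\<Sum>k<L. (cmod (y k))\<^sup>2) + (\<Sum>k<L. (cmod (z k))\<^sup>2))"
    by (simp add: distrib_left power4_eq_xxxx power2_eq_square mult_ac)
  finally show ?thesis .
qed

text \<open>At \<open>m = 0\<close> there is no left neighbour, which is the Dirichlet condition;
  therefore \<open>s 0\<close> alone controls everything. The base \<open>2 * D + 1\<close> covers
  the two terms and is at least 1, so its powers increase.\<close>

lemma three_term_growth:
  fixes s :: "nat \<Rightarrow> real"
  assumes s: "\<And>m. 0 \<le> s m" and D: "0 \<le> D"
    and step: "\<And>m. m < N \<Longrightarrow> s (Suc m) \<le> D * (s m + (if m = 0 then 0 else s (m - 1)))"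
  shows "m \<le> N \<Longrightarrow> s m \<le> (2 * D + 1) ^ m * s 0"
proof (induction m rule: less_induct)
  case (less m)
  show ?case
  proof (cases m)
    case (Suc k)
    have k: "s k \<le> (2 * D + 1) ^ k * s 0" using less Suc by auto
    have k': "(if k = 0 then 0 else s (k - 1)) \<le> (2 * D + 1) ^ k * s 0"
    proof (cases k)
      case (Suc j)
      have "s j \<le> (2 * D + 1) ^ j * s 0" using less \<open>m = Suc k\<close> Suc by auto
      also have "\<dots> \<le> (2 * D + 1) ^ k * s 0"
        using D s Suc by (intro mult_right_mono power_increasing) auto
      finally show ?thesis using Suc by simp
    qed (use s in simp)
    have "s m \<le> D * (s k + (if k = 0 then 0 else s (k - 1)))" using step[of k] less Suc by simp
    also have "\<dots> \<le> D * ((2 * D + 1) ^ k * s 0 + (2 * D + 1) ^ k * s 0)"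
      using D by (intro mult_left_mono add_mono k k') auto
    also have "\<dots> = (2 * D) * ((2 * D + 1) ^ k * s 0)" by simp
    also have "\<dots> \<le> (2 * D + 1) * ((2 * D + 1) ^ k * s 0)"
      using D s by (intro mult_right_mono mult_nonneg_nonneg) auto
    finally show ?thesis using Suc by (simp add: mult_ac)
  qed simp
qed

text \<open>Going down there is no boundary condition to start from, so two adjacent blocks are
  needed as data and the induction carries both.\<close>

lemma three_term_decay:
  fixes s :: "nat \<Rightarrow> real"
  assumes s: "\<And>m. 0 \<le> s m" and D: "0 \<le> D"
    and step: "\<And>m. m \<le> n \<Longrightarrow> 0 < m \<Longrightarrow> s (m - 1) \<le> D * (s m + s (Suc m))"
  shows "s 0 \<le> (2 * D + 1) ^ n * (s n + s (Suc n))"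
proof -
  have "s (n - j) \<le> (2 * D + 1) ^ j * (s n + s (Suc n)) \<and> s (Suc (n - j)) \<le> (2 * D + 1) ^ j * (s n + s (Suc n))" if "j \<le> n" for j
    using that
  proof (induction j)
    case 0
    then show ?case using s by simp
  next
    case (Suc j)
    let ?c = "(2 * D + 1) ^ j * (s n + s (Suc n))"
    have ih: "s (n - j) \<le> ?c" "s (Suc (n - j)) \<le> ?c" using Suc by auto
    have c0: "0 \<le> ?c" using D s by (intro mult_nonneg_nonneg) auto
    have "s (n - Suc j) \<le> D * (s (n - j) + s (Suc (n - j)))" using step[of "n - j"] Suc.prems by simp
    also have "\<dots> \<le> D * (?c + ?c)" using D ih by (intro mult_left_mono add_mono) auto
    also have "\<dots> = (2 * D) * ?c" by simp
    also have "\<dots> \<le> (2 * D + 1) * ?c" using D c0 by (intro mult_right_mono) auto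
    finally have 1: "s (n - Suc j) \<le> (2 * D + 1) * ?c" .
    have "Suc (n - Suc j) = n - j" using Suc.prems by simp
    then have "s (Suc (n - Suc j)) \<le> ?c" using ih by simp
    also have "\<dots> \<le> (2 * D + 1) * ?c" using c0 D mult_right_mono[of 1 "2 * D + 1" ?c] by simp
    finally show ?case using 1 by (simp add: mult_ac)
  qed
  from this[of n] show ?thesis by simp
qed

lemma finite_family_bound:
  fixes f :: "'i \<Rightarrow> nat \<Rightarrow> nat \<Rightarrow> complex"
  assumes "finite S"
  shows "\<exists>B\<ge>1. \<forall>m\<in>S. \<forall>i<L. \<forall>k<L. cmod (f m i k) \<le> B"
proof -
  have "cmod (f m i k) \<le> 1 + (\<Sum>m\<in>S. \<Sum>i<L. \<Sum>k<L. cmod (f m i k))" if "m \<in> S" "i < L" "k < L" for m i k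
  proof -
    have "cmod (f m i k) \<le> (\<Sum>k<L. cmod (f m i k))" using that by (intro member_le_sum) auto
    also have "\<dots> \<le> (\<Sum>i<L. \<Sum>k<L. cmod (f m i k))"
      using that by (intro member_le_sum[of i _ "\<lambda>i. \<Sum>k<L. cmod (f m i k)"]) (auto intro: sum_nonneg)
    also have "\<dots> \<le> (\<Sum>m\<in>S. \<Sum>i<L. \<Sum>k<L. cmod (f m i k))"
      using that assms by (intro member_le_sum[of m _ "\<lambda>m. \<Sum>i<L. \<Sum>k<L. cmod (f m i k)"]) (auto intro!: sum_nonneg)
    finally show ?thesis by simp
  qed
  then show ?thesis
    by (intro exI[of _ "1 + (\<Sum>m\<in>S. \<Sum>i<L. \<Sum>k<L. cmod (f m i k))"]) (auto intro!: sum_nonneg)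
qed

lemma sum_three_blocks:
  fixes f :: "nat \<Rightarrow> complex"
  assumes "Suc m < K" and z: "\<And>b. b < K \<Longrightarrow> b \<noteq> m \<Longrightarrow> b \<noteq> Suc m \<Longrightarrow> Suc b \<noteq> m \<Longrightarrow> f b = 0"
  shows "(\<Sum>b<K. f b) = f (Suc m) + f m + (if 0 < m then f (m - 1) else 0)"
proof -
  have "(\<Sum>b<K. f b) = (\<Sum>b\<in>{Suc m, m} \<union> (if 0 < m then {m - 1} else {}). f b)"
  proof (intro sum.mono_neutral_right ballI)
    fix b assume "b \<in> {..<K} - ({Suc m, m} \<union> (if 0 < m then {m - 1} else {}))"
    then show "f b = 0" by (intro z) (auto split: if_splits)
  qed (use assms in auto)
  also have "\<dots> = f (Suc m) + f m + (if 0 < m then f (m - 1) else 0)"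
    by (auto simp: add.commute add.left_commute)
  finally show ?thesis .
qed

lemma jacobi_entry_block:
  assumes "i < L" "k < L"
  shows "jacobi_entry L T U (m * L + i) (b * L + k) = (if m = b then U (m + 1) $$ (i,k)
      else if b = m + 1 then T (m + 2) $$ (i,k)
      else if m = b + 1 then cnj (T (m + 1) $$ (k,i)) else 0)"
  using assms by (simp add: jacobi_entry_def Let_def)

text \<open>The assumption \<open>Suc m < K\<close> keeps away from the last block row, where the
  truncation drops a neighbour. The right side is thus free of K, which is used when comparing
  truncations.\<close>

lemma mv_jacobi_entry_block:
  assumes "Suc m < K" "i < L"
  shows "mv (K * L) (jacobi_entry L T U) x (m * L + i) = (\<Sum>k<L. T (m + 2) $$ (i,k) * x (Suc m * L + k))
    + (\<Sum>k<L. U (m + 1) $$ (i,k) * x (m * L + k))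
    + (if 0 < m then (\<Sum>k<L. cnj (T (m + 1) $$ (k,i)) * x ((m - 1) * L + k)) else 0)"
proof -
  have "mv (K * L) (jacobi_entry L T U) x (m * L + i) = (\<Sum>b<K. \<Sum>k<L. jacobi_entry L T U (m * L + i) (b * L + k) * x (b * L + k))"
    unfolding mv_def sum_blocks ..
  also have "\<dots> = (\<Sum>k<L. jacobi_entry L T U (m * L + i) (Suc m * L + k) * x (Suc m * L + k))
    + (\<Sum>k<L. jacobi_entry L T U (m * L + i) (m * L + k) * x (m * L + k))
    + (if 0 < m then \<Sum>k<L. jacobi_entry L T U (m * L + i) ((m - 1) * L + k) * x ((m - 1) * L + k) else 0)"
    using assms by (intro sum_three_blocks) (auto simp: jacobi_entry_block simp del: mult_Suc intro!: sum.neutral)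
  also have "(\<Sum>k<L. jacobi_entry L T U (m * L + i) (Suc m * L + k) * x (Suc m * L + k)) = (\<Sum>k<L. T (m + 2) $$ (i,k) * x (Suc m * L + k))"
    using assms by (intro sum.cong refl) (simp add: jacobi_entry_block del: mult_Suc)
  also have "(\<Sum>k<L. jacobi_entry L T U (m * L + i) (m * L + k) * x (m * L + k)) = (\<Sum>k<L. U (m + 1) $$ (i,k) * x (m * L + k))"
    using assms by (intro sum.cong refl) (simp add: jacobi_entry_block)
  also have "(if 0 < m then \<Sum>k<L. jacobi_entry L T U (m * L + i) ((m - 1) * L + k) * x ((m - 1) * L + k) else 0)
     = (if 0 < m then (\<Sum>k<L. cnj (T (m + 1) $$ (k,i)) * x ((m - 1) * L + k)) else 0)"
    using assms by (auto intro!: sum.cong simp: jacobi_entry_block)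
  finally show ?thesis .
qed

section \<open>Entrywise inverses and bounds for quadratic forms\<close>

lemma invertible_mat_entries:
  assumes "T \<in> carrier_mat L L" "invertible_mat (T :: complex mat)"
  shows "\<exists>S. (\<forall>i<L. \<forall>j<L. (\<Sum>k<L. S i k * T $$ (k,j)) = (if i = j then 1 else 0)) \<and>
     (\<forall>i<L. \<forall>j<L. (\<Sum>k<L. T $$ (i,k) * S k j) = (if i = j then 1 else 0))"
proof -
  obtain B where B: "inverts_mat T B" "inverts_mat B T" using assms by (auto simp: invertible_mat_def)
  have 1: "T * B = 1\<^sub>m L" using B(1) assms by (simp add: inverts_mat_def)
  have "dim_col B = L" using arg_cong[OF 1, of dim_col] by simp
  moreover have 2: "B * T = 1\<^sub>m (dim_row B)" using B(2) by (simp add: inverts_mat_def)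
  then have "dim_row B = L" using assms(1) by (metis carrier_matD(2) index_mult_mat(3) index_one_mat(3))
  ultimately have cB: "B \<in> carrier_mat L L" by auto
  have "(\<Sum>k<L. B $$ (i,k) * T $$ (k,j)) = (if i = j then 1 else 0)" if "i < L" "j < L" for i j
    using arg_cong[OF 2, of "\<lambda>M. M $$ (i,j)"] that cB assms(1) by (simp add: scalar_prod_def atLeast0LessThan)
  moreover have "(\<Sum>k<L. T $$ (i,k) * B $$ (k,j)) = (if i = j then 1 else 0)" if "i < L" "j < L" for i j
    using arg_cong[OF 1, of "\<lambda>M. M $$ (i,j)"] that cB assms(1) by (simp add: scalar_prod_def atLeast0LessThan)
  ultimately show ?thesis by (intro exI[of _ "\<lambda>i j. B $$ (i,j)"]) auto
qed

lemma left_inverse_apply: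
  fixes S A :: "nat \<Rightarrow> nat \<Rightarrow> complex"
  assumes "\<And>i j. i < L \<Longrightarrow> j < L \<Longrightarrow> (\<Sum>k<L. S i k * A k j) = (if i = j then 1 else 0)" "i < L"
  shows "(\<Sum>k<L. S i k * (\<Sum>j<L. A k j * x j)) = x i"
proof -
  have "(\<Sum>k<L. S i k * (\<Sum>j<L. A k j * x j)) = (\<Sum>j<L. (\<Sum>k<L. S i k * A k j) * x j)"
    unfolding sum_distrib_left sum_distrib_right by (subst sum.swap) (simp add: mult_ac)
  also have "\<dots> = (\<Sum>j<L. if i = j then x j else 0)" using assms by (intro sum.cong) auto
  finally show ?thesis using assms(2) by simp
qed

lemma quad_form_eq_ip: "quad_form L A v = ip L v (mv L (\<lambda>i j. A $$ (i,j)) v)"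
  by (simp add: quad_form_def ip_def mv_def sum_distrib_left mult_ac)

lemma hermitian_mat_eigsys:
  assumes "hermitian_mat L A"
  shows "\<exists>u d. eigsys L (\<lambda>i j. A $$ (i,j)) u d"
proof -
  have "herm L (\<lambda>i j. A $$ (i,j))" using assms unfolding hermitian_mat_def herm_def by blast
  then show ?thesis using eigsys_ev by blast
qed

lemma quad_form_upper:
  assumes "hermitian_mat L A"
  shows "\<exists>c\<ge>0. \<forall>v. Re (quad_form L A v) \<le> c * (\<Sum>j<L. (cmod (v j))\<^sup>2)"
proof -
  obtain u d where e: "eigsys L (\<lambda>i j. A $$ (i,j)) u d" using hermitian_mat_eigsys[OF assms] by blast
  have o: "orthon L L u" using e by (simp add: eigsys_def)
  let ?c = "\<Sum>i<L. \<bar>d i\<bar>"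
  have c: "d i \<le> ?c" if "i < L" for i
    using member_le_sum[of i "{..<L}" "\<lambda>i. \<bar>d i\<bar>"] that by auto
  have "Re (quad_form L A v) \<le> ?c * sqn L v" for v
    unfolding quad_form_eq_ip eigsys_form(1)[OF e] orthon_parseval[OF o, of v] sum_distrib_left
    by (intro sum_mono mult_right_mono c) auto
  then show ?thesis by (intro exI[of _ ?c]) (auto simp: sqn_def intro: sum_nonneg)
qed

lemma pos_def_lower:
  assumes "pos_def L A"
  shows "\<exists>c>0. \<forall>v. c * (\<Sum>j<L. (cmod (v j))\<^sup>2) \<le> Re (quad_form L A v)"
proof -
  have "hermitian_mat L A" using assms by (simp add: pos_def_def)
  then obtain u d where e: "eigsys L (\<lambda>i j. A $$ (i,j)) u d" using hermitian_mat_eigsys by blast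
  have o: "orthon L L u" using e by (simp add: eigsys_def)
  have d: "0 < d i" if "i < L" for i
  proof -
    have ii: "ip L (u i) (u i) = 1" using o that by (simp add: orthon_def)
    then have "sqn L (u i) \<noteq> 0" by (simp add: ip_self)
    then have "\<exists>j<L. u i j \<noteq> 0" by (simp add: sqn_eq_0)
    then have "0 < Re (quad_form L A (u i))" using assms by (simp add: pos_def_def)
    also have "quad_form L A (u i) = ip L (u i) (\<lambda>r. complex_of_real (d i) * u i r)"
      unfolding quad_form_eq_ip using e that by (intro ip_cong) (auto simp: eigsys_def)
    finally show ?thesis using ii by (simp add: ip_scale_right)
  qed
  \<comment> \<open>The smallest eigenvalue, with 1 inserted so that the set is nonempty even for
    \<open>L = 0\<close>.\<close>
  let ?c = "Min (insert 1 (d ` {..<L}))"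
  have "?c * sqn L v \<le> Re (quad_form L A v)" for v
    unfolding quad_form_eq_ip eigsys_form(1)[OF e] orthon_parseval[OF o, of v] sum_distrib_left
    by (intro sum_mono mult_right_mono) auto
  moreover have "0 < ?c" using d by auto
  ultimately show ?thesis by (intro exI[of _ ?c]) (auto simp: sqn_def)
qed

lemma weight_entry_form:
  assumes "N \<le> K" "1 \<le> L"
  shows "ip (K * L) x (mv (K * L) (weight_entry L N W) x) = (\<Sum>m<N. quad_form L (W (m + 1)) (\<lambda>j. x (m * L + j)))"
proof -
  have w: "weight_entry L N W (m * L + i) (b * L + k) = (if m = b \<and> m < N then W (m + 1) $$ (i,k) else 0)" if "i < L" "k < L" for m b i k
    using that by (simp add: weight_entry_def)
  have "mv (K * L) (weight_entry L N W) x (m * L + i) = (if m < N then \<Sum>k<L. W (m + 1) $$ (i,k) * x (m * L + k) else 0)" if "i < L" "m < K" for m i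
  proof -
    have "mv (K * L) (weight_entry L N W) x (m * L + i) = (\<Sum>b<K. if m = b then (if m < N then \<Sum>k<L. W (m + 1) $$ (i,k) * x (m * L + k) else 0) else 0)"
      unfolding mv_def sum_blocks using w that by (intro sum.cong) auto
    then show ?thesis using that by simp
  qed
  then have "ip (K * L) x (mv (K * L) (weight_entry L N W) x) = (\<Sum>m<K. if m < N then \<Sum>i<L. cnj (x (m * L + i)) * (\<Sum>k<L. W (m + 1) $$ (i,k) * x (m * L + k)) else 0)"
    unfolding ip_def sum_blocks by (intro sum.cong refl) auto
  also have "\<dots> = (\<Sum>m<N. quad_form L (W (m + 1)) (\<lambda>j. x (m * L + j)))"
    using assms(1) by (intro sum.mono_neutral_cong_right) (auto simp: quad_form_def sum_distrib_left mult_ac)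
  finally show ?thesis .
qed

section \<open>The pencil of truncations\<close>

lemma eig_count_mono: "s \<le> t \<Longrightarrow> eig_count n d s \<le> eig_count n d t"
  unfolding eig_count_def by (intro card_mono) auto

text \<open>\<open>kth_eig\<close> is an infimum. Reading off counts from it requires a nonempty set
  here, which \<open>k \<le> n\<close> provides, and a set bounded below in the next lemma, which
  \<open>1 \<le> k\<close> provides.\<close>

lemma kth_eig_less:
  assumes e: "eigsys n a u d" and k: "k \<le> n" and lt: "kth_eig (mat n n (\<lambda>(r,s). a r s)) k < E"
  shows "\<exists>t<E. k \<le> eig_count n d t"
proof -
  obtain R where "\<forall>i<n. d i \<in> {-R..R}" using exists_bound_finite_families[of 0 n d d] by auto
  then have "{i\<in>{..<n}. d i \<le> R} = {..<n}" by auto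
  then have "k \<le> eig_count n d R" using k by (simp add: eig_count_def)
  then have "{t. k \<le> eig_count n d t} \<noteq> {}" by blast
  then show ?thesis
    using cInf_lessD[of "{t. k \<le> eig_count n d t}" E] lt unfolding kth_eig_def ev_count_le_eigsys[OF e] by auto
qed

lemma kth_eig_greater:
  assumes e: "eigsys n a u d" and k: "1 \<le> k" and lt: "t < kth_eig (mat n n (\<lambda>(r,s). a r s)) k"
  shows "eig_count n d t < k"
proof (rule ccontr)
  assume neg: "\<not> ?thesis"
  obtain R where R: "0 \<le> R" "\<forall>i<n. d i \<in> {-R..R}" using exists_bound_finite_families[of 0 n d d] by auto
  have "bdd_below {t. k \<le> eig_count n d t}"
  proof (rule bdd_belowI)
    fix s assume s: "s \<in> {t. k \<le> eig_count n d t}"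
    show "- R - 1 \<le> s"
    proof (rule ccontr)
      assume "\<not> ?thesis"
      then have e: "{i\<in>{..<n}. d i \<le> s} = {}" using R by force
      have "eig_count n d s = 0" unfolding eig_count_def e by simp
      then show False using s k by simp
    qed
  qed
  then have "Inf {t. k \<le> eig_count n d t} \<le> t" using neg by (intro cInf_lower) auto
  then show False using lt unfolding kth_eig_def ev_count_le_eigsys[OF e] by simp
qed

text \<open>The crossing inequalities are strict, so each passing index k still separates the two
  counts at all levels near E; finitely many k share one \<delta>. All passing indices then lie
  between the two counts, which must differ by at least their number.\<close>

lemma kth_eig_pass_count:
  assumes e0: "eigsys n a u d" and e1: "eigsys n b v e"
    and m: "1 \<le> m" and pass: "m \<le> card {k \<in> {1..n}. kth_eig (mat n n (\<lambda>(r,s). a r s)) k < E \<and> E < kth_eig (mat n n (\<lambda>(r,s). b r s)) k}"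
  shows "\<exists>\<delta>>0. \<forall>t\<in>{E-\<delta>..E+\<delta>}. eig_count n e t + m \<le> eig_count n d t"
proof -
  define P where "P = {k \<in> {1..n}. kth_eig (mat n n (\<lambda>(r,s). a r s)) k < E \<and> E < kth_eig (mat n n (\<lambda>(r,s). b r s)) k}"
  have fin: "finite P" by (simp add: P_def)
  have "\<forall>\<^sub>F \<delta> in at_right (0::real). \<forall>t\<in>{E-\<delta>..E+\<delta>}. eig_count n e t < k \<and> k \<le> eig_count n d t" if "k \<in> P" for k
  proof -
    have k: "k \<in> {1..n}" "kth_eig (mat n n (\<lambda>(r,s). a r s)) k < E" "E < kth_eig (mat n n (\<lambda>(r,s). b r s)) k"
      using that by (auto simp: P_def)
    obtain t0 where t0: "t0 < E" "k \<le> eig_count n d t0" using kth_eig_less[OF e0 _ k(2)] k(1) by auto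
    define t1 where "t1 = kth_eig (mat n n (\<lambda>(r,s). b r s)) k"
    have t1: "E < t1" "\<And>t. t < t1 \<Longrightarrow> eig_count n e t < k"
      using k kth_eig_greater[OF e1, of k] by (auto simp: t1_def)
    have "\<forall>t\<in>{E-\<delta>..E+\<delta>}. eig_count n e t < k \<and> k \<le> eig_count n d t" if "\<delta> < min (E - t0) (t1 - E)" for \<delta>
    proof (intro ballI conjI)
      fix t assume t: "t \<in> {E-\<delta>..E+\<delta>}"
      show "eig_count n e t < k" using t that by (intro t1(2)) auto
      have "eig_count n d t0 \<le> eig_count n d t" using t that by (intro eig_count_mono) auto
      then show "k \<le> eig_count n d t" using t0(2) by simp
    qed
    moreover have "\<forall>\<^sub>F \<delta> in at_right (0::real). \<delta> < min (E - t0) (t1 - E)"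
      using t0(1) t1(1) by (intro eventually_at_right_less[THEN eventually_mono] order_tendstoD(2)[OF tendsto_ident_at]) auto
    ultimately show ?thesis by (auto elim!: eventually_mono)
  qed
  then have "\<forall>\<^sub>F \<delta> in at_right (0::real). \<forall>k\<in>P. \<forall>t\<in>{E-\<delta>..E+\<delta>}. eig_count n e t < k \<and> k \<le> eig_count n d t"
    using fin by (intro eventually_ball_finite) auto
  then obtain b where b: "b > (0::real)" "\<forall>\<delta>>0. \<delta> < b \<longrightarrow> (\<forall>k\<in>P. \<forall>t\<in>{E-\<delta>..E+\<delta>}. eig_count n e t < k \<and> k \<le> eig_count n d t)"
    unfolding eventually_at_right_field by auto
  show ?thesis
  proof (intro exI[of _ "b / 2"] conjI ballI)
    fix t assume t: "t \<in> {E - b / 2..E + b / 2}"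
    have *: "eig_count n e t < k \<and> k \<le> eig_count n d t" if "k \<in> P" for k
      using b(2)[rule_format, of "b / 2" k t] b(1) t that by simp
    then have "P \<subseteq> {eig_count n e t<..eig_count n d t}" by auto
    then have "card P \<le> eig_count n d t - eig_count n e t" using card_mono[of "{eig_count n e t<..eig_count n d t}" P] by simp
    moreover have "m \<le> card P" using pass by (simp add: P_def)
    moreover have "eig_count n e t \<le> eig_count n d t"
    proof -
      have "P \<noteq> {}" using \<open>m \<le> card P\<close> m by auto
      then show ?thesis using * by fastforce
    qed
    ultimately show "eig_count n e t + m \<le> eig_count n d t" by linarith
  qed (use b in simp)
qed

lemma neg_of_sum_zero: "x + y + z = 0 \<Longrightarrow> z = - (y + x)" for x y z :: complex
  by (simp add: eq_neg_iff_add_eq_0 add_ac del: minus_add_distrib)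

text \<open>The standing assumptions on the finite blocks. The limit point property and the measures
  \<rho> are named in the lemmas that pass to infinite K.\<close>

locale block_jacobi =
  fixes L N :: nat and T V W :: "nat \<Rightarrow> complex mat" and n0 :: nat
  assumes L_pos: "1 \<le> L"
    and T: "\<And>n. 2 \<le> n \<Longrightarrow> T n \<in> carrier_mat L L \<and> invertible_mat (T n)"
    and V: "\<And>n. 1 \<le> n \<Longrightarrow> hermitian_mat L (V n)"
    and W: "\<And>n. 1 \<le> n \<Longrightarrow> n \<le> N \<Longrightarrow> real_psd L (W n)"
    and n0: "1 \<le> n0" "n0 < N"
    and Wpos: "pos_def L (W n0)" "pos_def L (W (n0 + 1))"
begin

definition Hmat :: "real \<Rightarrow> nat \<Rightarrow> nat \<Rightarrow> complex" where
  "Hmat \<mu> = (\<lambda>r s. jacobi_entry L T V r s + complex_of_real \<mu> * weight_entry L N W r s)"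

lemma mod_L: "r mod L < L"
  using L_pos by simp

lemma W_herm: "1 \<le> n \<Longrightarrow> n \<le> N \<Longrightarrow> hermitian_mat L (W n)"
  using W by (simp add: real_psd_def)

lemma W_carrier: "1 \<le> n \<Longrightarrow> n \<le> N \<Longrightarrow> W n \<in> carrier_mat L L"
  using W_herm unfolding hermitian_mat_def by blast

lemma jacobi_entry_Vmu: "jacobi_entry L T (Vmu N V W \<mu>) = Hmat \<mu>"
proof (intro ext)
  fix r s
  have "(V n + complex_of_real \<mu> \<cdot>\<^sub>m W n) $$ (r mod L, s mod L) = V n $$ (r mod L, s mod L) + complex_of_real \<mu> * W n $$ (r mod L, s mod L)"
    if "1 \<le> n" "n \<le> N" for n
    using carrier_matD[OF W_carrier[OF that]] mod_L by simp
  then show "jacobi_entry L T (Vmu N V W \<mu>) r s = Hmat \<mu> r s"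
    by (auto simp: jacobi_entry_def Hmat_def weight_entry_def Vmu_def Let_def)
qed

lemma herm_jacobi_entry: "herm n (jacobi_entry L T V)"
  unfolding herm_def
proof (intro allI impI)
  fix r s
  have "V (r div L + 1) $$ (r mod L, s mod L) = cnj (V (r div L + 1) $$ (s mod L, r mod L))"
    using V[of "r div L + 1"] mod_L unfolding hermitian_mat_def by (metis le_add2)
  then show "jacobi_entry L T V r s = cnj (jacobi_entry L T V s r)"
    unfolding jacobi_entry_def Let_def by (cases "r div L = s div L") (auto simp: add.commute)
qed

lemma herm_weight_entry: "herm n (weight_entry L N W)"
  unfolding herm_def
proof (intro allI impI)
  fix r s
  have "W (r div L + 1) $$ (r mod L, s mod L) = cnj (W (r div L + 1) $$ (s mod L, r mod L))" if "r div L < N"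
    using W_herm[of "r div L + 1"] mod_L that unfolding hermitian_mat_def by (metis Suc_eq_plus1 Suc_leI le_add2)
  then show "weight_entry L N W r s = cnj (weight_entry L N W s r)"
    unfolding weight_entry_def by auto
qed

lemma herm_Hmat: "herm n (Hmat \<mu>)"
  unfolding herm_def
proof (intro allI impI)
  fix r s assume rs: "r < n" "s < n"
  have j: "jacobi_entry L T V r s = cnj (jacobi_entry L T V s r)" using herm_jacobi_entry[unfolded herm_def, rule_format, OF rs] .
  have w: "weight_entry L N W r s = cnj (weight_entry L N W s r)" using herm_weight_entry[unfolded herm_def, rule_format, OF rs] .
  show "Hmat \<mu> r s = cnj (Hmat \<mu> s r)"
    unfolding Hmat_def complex_cnj_add complex_cnj_mult complex_cnj_complex_of_real
    by (simp only: j[symmetric] w[symmetric])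
qed

lemma HN_eq_Hmat: "HN L N T V W \<mu> = mat (N * L) (N * L) (\<lambda>(r,s). Hmat \<mu> r s)"
  unfolding HN_eq_jacobi_entry jacobi_entry_Vmu ..

lemma weight_entry_form_nonneg:
  assumes "N \<le> K"
  shows "0 \<le> Re (ip (K * L) x (mv (K * L) (weight_entry L N W) x))"
proof -
  have "0 \<le> Re (quad_form L (W (m + 1)) v)" if "m < N" for m v
    using W[of "m + 1"] that by (auto simp: real_psd_def)
  then show ?thesis
    unfolding weight_entry_form[OF assms L_pos] Re_sum by (intro sum_nonneg) auto
qed

lemma eigen_block_eq:
  assumes "m < N" "N < K" "i < L"
    and ev: "\<And>r. r < K * L \<Longrightarrow> mv (K * L) (Hmat \<mu>) x r = complex_of_real d * x r"
  shows "(\<Sum>k<L. T (m + 2) $$ (i,k) * x (Suc m * L + k))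
    + (\<Sum>k<L. (V (m + 1) $$ (i,k) + complex_of_real \<mu> * W (m + 1) $$ (i,k) - (if i = k then complex_of_real d else 0)) * x (m * L + k))
    + (if 0 < m then (\<Sum>k<L. cnj (T (m + 1) $$ (k,i)) * x ((m - 1) * L + k)) else 0) = 0"
proof -
  have "m * L + i < Suc m * L" using assms by simp
  also have "\<dots> \<le> K * L" using assms by (intro mult_right_mono) auto
  finally have r: "m * L + i < K * L" .
  have U: "Vmu N V W \<mu> (m + 1) $$ (i,k) = V (m + 1) $$ (i,k) + complex_of_real \<mu> * W (m + 1) $$ (i,k)" if "k < L" for k
    using carrier_matD[OF W_carrier[of "m + 1"]] assms that by (simp add: Vmu_def)
  have e1: "(\<Sum>k<L. T (m + 2) $$ (i,k) * x (Suc m * L + k))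
    + (\<Sum>k<L. Vmu N V W \<mu> (m + 1) $$ (i,k) * x (m * L + k))
    + (if 0 < m then (\<Sum>k<L. cnj (T (m + 1) $$ (k,i)) * x ((m - 1) * L + k)) else 0) = complex_of_real d * x (m * L + i)"
    using ev[OF r] assms by (subst mv_jacobi_entry_block[symmetric]) (auto simp: jacobi_entry_Vmu)
  have e2: "(\<Sum>k<L. (V (m + 1) $$ (i,k) + complex_of_real \<mu> * W (m + 1) $$ (i,k) - (if i = k then complex_of_real d else 0)) * x (m * L + k))
     = (\<Sum>k<L. Vmu N V W \<mu> (m + 1) $$ (i,k) * x (m * L + k)) - complex_of_real d * x (m * L + i)"
  proof -
    have "(\<Sum>k<L. (V (m + 1) $$ (i,k) + complex_of_real \<mu> * W (m + 1) $$ (i,k) - (if i = k then complex_of_real d else 0)) * x (m * L + k))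
     = (\<Sum>k<L. Vmu N V W \<mu> (m + 1) $$ (i,k) * x (m * L + k) - (if i = k then complex_of_real d * x (m * L + k) else 0))"
    proof (rule sum.cong[OF refl])
      fix k assume "k \<in> {..<L}"
      then have "k < L" by simp
      show "(V (m + 1) $$ (i,k) + complex_of_real \<mu> * W (m + 1) $$ (i,k) - (if i = k then complex_of_real d else 0)) * x (m * L + k)
        = Vmu N V W \<mu> (m + 1) $$ (i,k) * x (m * L + k) - (if i = k then complex_of_real d * x (m * L + k) else 0)"
        unfolding U[OF \<open>k < L\<close>] by (simp add: left_diff_distrib)
    qed
    then show ?thesis using assms(3) by (simp add: sum_subtractf)
  qed
  have e3: "p + (q - e) + z = 0" if "p + q + z = e" for p q z e :: complex
    using that by (simp add: algebra_simps)
  show ?thesis unfolding e2 by (rule e3[OF e1])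
qed

text \<open>The first N block rows do not see K, so the constant is uniform in K, in the compact
  range of \<mu>, and in eigenvalues bounded by R. Block m belongs to site m + 1, hence
  \<open>n0 - 1\<close> and \<open>n0\<close> are the two sites with positive weight.\<close>

lemma eigenvector_block_bounds:
  "\<exists>C\<ge>1. \<forall>K>N. \<forall>\<mu>\<in>{\<mu>0..\<mu>1}. \<forall>d x. \<bar>d\<bar> \<le> R \<longrightarrow>
     (\<forall>r<K * L. mv (K * L) (Hmat \<mu>) x r = complex_of_real d * x r) \<longrightarrow>
     (\<forall>m\<le>N. block_sqnorm L x m \<le> C * block_sqnorm L x 0) \<and> block_sqnorm L x 0 \<le> C * (block_sqnorm L x (n0 - 1) + block_sqnorm L x n0)"
proof -
  have "\<forall>n. \<exists>S. 2 \<le> n \<longrightarrow> (\<forall>i<L. \<forall>j<L. (\<Sum>k<L. S i k * T n $$ (k,j)) = (if i = j then 1 else 0)) \<and>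
     (\<forall>i<L. \<forall>j<L. (\<Sum>k<L. T n $$ (i,k) * S k j) = (if i = j then 1 else 0))"
  proof
    fix n
    show "\<exists>S. 2 \<le> n \<longrightarrow> (\<forall>i<L. \<forall>j<L. (\<Sum>k<L. S i k * T n $$ (k,j)) = (if i = j then 1 else 0)) \<and>
     (\<forall>i<L. \<forall>j<L. (\<Sum>k<L. T n $$ (i,k) * S k j) = (if i = j then 1 else 0))"
      using invertible_mat_entries[of "T n" L] T[of n] by (cases "2 \<le> n") auto
  qed
  then obtain S where S: "\<And>n i j. 2 \<le> n \<Longrightarrow> i < L \<Longrightarrow> j < L \<Longrightarrow> (\<Sum>k<L. S n i k * T n $$ (k,j)) = (if i = j then 1 else 0)"
     "\<And>n i j. 2 \<le> n \<Longrightarrow> i < L \<Longrightarrow> j < L \<Longrightarrow> (\<Sum>k<L. T n $$ (i,k) * S n k j) = (if i = j then 1 else 0)"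
    unfolding choice_iff by blast
  obtain BS where BS: "1 \<le> BS" "\<forall>m\<in>{..N+1}. \<forall>i<L. \<forall>k<L. cmod (S m i k) \<le> BS"
    using finite_family_bound[of "{..N+1}" L S] by auto
  obtain BT where BT: "1 \<le> BT" "\<forall>m\<in>{..N+1}. \<forall>i<L. \<forall>k<L. cmod (T m $$ (i,k)) \<le> BT"
    using finite_family_bound[of "{..N+1}" L "\<lambda>m i k. T m $$ (i,k)"] by auto
  obtain BV where BV: "1 \<le> BV" "\<forall>m\<in>{..N+1}. \<forall>i<L. \<forall>k<L. cmod (V m $$ (i,k)) \<le> BV"
    using finite_family_bound[of "{..N+1}" L "\<lambda>m i k. V m $$ (i,k)"] by auto
  obtain BW where BW: "1 \<le> BW" "\<forall>m\<in>{..N+1}. \<forall>i<L. \<forall>k<L. cmod (W m $$ (i,k)) \<le> BW"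
    using finite_family_bound[of "{..N+1}" L "\<lambda>m i k. W m $$ (i,k)"] by auto
  define M where "M = \<bar>\<mu>0\<bar> + \<bar>\<mu>1\<bar>"
  \<comment> \<open>One common bound for the inverses, the off-diagonal blocks, and the diagonal
    blocks shifted by the eigenvalue.\<close>
  define B where "B = BS + BT + BV + M * BW + \<bar>R\<bar>"
  have M0: "0 \<le> M" by (simp add: M_def)
  then have MW: "0 \<le> M * BW" using BW by simp
  have B1: "1 \<le> B" using BS BT BV MW by (simp add: B_def)
  have bS: "cmod (S m i k) \<le> B" if "m \<le> N + 1" "i < L" "k < L" for m i k
    using BS BT BV MW that unfolding B_def by (smt (verit) atMost_iff)
  have bT: "cmod (T m $$ (i,k)) \<le> B" if "m \<le> N + 1" "i < L" "k < L" for m i k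
    using BS BT BV MW that unfolding B_def by (smt (verit) atMost_iff)
  define D where "D = 2 * (real L * B)^4"
  have D0: "0 \<le> D" by (simp add: D_def)
  define C where "C = (2 * D + 1) ^ N"
  have C1: "1 \<le> C" using D0 by (simp add: C_def)
  show ?thesis
  proof (intro exI[of _ C] conjI allI impI ballI C1)
    fix K \<mu> d x m
    assume K: "N < K" and \<mu>: "\<mu> \<in> {\<mu>0..\<mu>1}" and d: "\<bar>d\<bar> \<le> R"
      and ev: "\<forall>r<K * L. mv (K * L) (Hmat \<mu>) x r = complex_of_real d * x r"
    define U where "U = (\<lambda>m i k. V (m + 1) $$ (i,k) + complex_of_real \<mu> * W (m + 1) $$ (i,k) - (if i = k then complex_of_real d else 0))"
    have bU: "cmod (U m i k) \<le> B" if "m < N" "i < L" "k < L" for m i k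
    proof -
      have "cmod (V (m + 1) $$ (i,k)) \<le> BV" "cmod (W (m + 1) $$ (i,k)) \<le> BW" using BV BW that by auto
      moreover have "\<bar>\<mu>\<bar> \<le> M" using \<mu> by (auto simp: M_def)
      ultimately have "cmod (V (m + 1) $$ (i,k)) + \<bar>\<mu>\<bar> * cmod (W (m + 1) $$ (i,k)) \<le> BV + M * BW"
        using M0 by (intro add_mono mult_mono) auto
      moreover have "cmod (U m i k) \<le> cmod (V (m + 1) $$ (i,k)) + \<bar>\<mu>\<bar> * cmod (W (m + 1) $$ (i,k)) + \<bar>d\<bar>"
        unfolding U_def
        by (intro order_trans[OF norm_triangle_ineq4] add_mono order_trans[OF norm_triangle_ineq]) (auto simp: norm_mult)
      ultimately show ?thesis using d BS BT unfolding B_def by linarith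
    qed
    have eq: "(\<Sum>k<L. T (m + 2) $$ (i,k) * x (Suc m * L + k)) + (\<Sum>k<L. U m i k * x (m * L + k))
      + (if 0 < m then (\<Sum>k<L. cnj (T (m + 1) $$ (k,i)) * x ((m - 1) * L + k)) else 0) = 0" if "m < N" "i < L" for m i
      unfolding U_def by (rule eigen_block_eq) (use K ev that in auto)
    have up: "block_sqnorm L x (Suc m) \<le> D * (block_sqnorm L x m + (if m = 0 then 0 else block_sqnorm L x (m - 1)))" if m: "m < N" for m
    proof -
      \<comment> \<open>At \<open>m = 0\<close> a zero block stands in for the missing left
        neighbour, so the same step applies.\<close>
      define Z where "Z = (\<lambda>i k. if 0 < m then cnj (T (m + 1) $$ (k,i)) else 0)"
      define z where "z = (\<lambda>k. if 0 < m then x ((m - 1) * L + k) else 0)"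
      have "(\<Sum>k<L. (cmod (x (Suc m * L + k)))\<^sup>2) \<le> 2 * (real L * B)^4 * ((\<Sum>k<L. (cmod (x (m * L + k)))\<^sup>2) + (\<Sum>k<L. (cmod (z k))\<^sup>2))"
      proof (rule three_term_step[OF B1, where A = "\<lambda>i k. T (m + 2) $$ (i,k)" and A' = "S (m + 2)" and U = "U m" and Z = Z])
        show "(\<Sum>k<L. S (m + 2) i k * (\<Sum>j<L. T (m + 2) $$ (k,j) * x j)) = x i" if "i < L" for x i
          by (rule left_inverse_apply[OF S(1)]) (use that in auto)
        show "(\<Sum>k<L. T (m + 2) $$ (i,k) * x (Suc m * L + k)) = - ((\<Sum>k<L. U m i k * x (m * L + k)) + (\<Sum>k<L. Z i k * z k))" if "i < L" for i
          using eq[OF m that] unfolding Z_def z_def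
          by (cases "0 < m") (simp_all add: eq_neg_iff_add_eq_0 add.assoc del: mult_Suc minus_add_distrib)
        show "cmod (Z i k) \<le> B" if "i < L" "k < L" for i k
          using bT[of "m + 1" k i] B1 that m by (auto simp: Z_def)
      qed (use bS bU m in auto)
      then show ?thesis by (auto simp: block_sqnorm_def D_def z_def)
    qed
    have down: "block_sqnorm L x (m - 1) \<le> D * (block_sqnorm L x m + block_sqnorm L x (Suc m))" if m: "0 < m" "m < N" for m
    proof -
      have "(\<Sum>k<L. (cmod (x ((m - 1) * L + k)))\<^sup>2) \<le> 2 * (real L * B)^4 * ((\<Sum>k<L. (cmod (x (m * L + k)))\<^sup>2) + (\<Sum>k<L. (cmod (x (Suc m * L + k)))\<^sup>2))"
      \<comment> \<open>Downwards the block to be inverted is the adjoint of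
        \<open>T (m + 1)\<close>; its inverse is the adjoint of S, by the identity T S = 1.\<close>
      proof (rule three_term_step[OF B1, where A = "\<lambda>i k. cnj (T (m + 1) $$ (k,i))" and A' = "\<lambda>i k. cnj (S (m + 1) k i)" and U = "U m" and Z = "\<lambda>i k. T (m + 2) $$ (i,k)"])
        show "(\<Sum>k<L. cnj (S (m + 1) k i) * (\<Sum>j<L. cnj (T (m + 1) $$ (j,k)) * x j)) = x i" if "i < L" for x i
        proof (rule left_inverse_apply[OF _ that])
          fix i j assume ij: "i < L" "j < L"
          have "(\<Sum>k<L. cnj (S (m + 1) k i) * cnj (T (m + 1) $$ (j,k))) = cnj (\<Sum>k<L. T (m + 1) $$ (j,k) * S (m + 1) k i)"
            by (simp add: mult.commute)
          also have "\<dots> = (if i = j then 1 else 0)" using S(2)[of "m + 1" j i] m ij by auto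
          finally show "(\<Sum>k<L. cnj (S (m + 1) k i) * cnj (T (m + 1) $$ (j,k))) = (if i = j then 1 else 0)" .
        qed
        show "(\<Sum>k<L. cnj (T (m + 1) $$ (k,i)) * x ((m - 1) * L + k)) = - ((\<Sum>k<L. U m i k * x (m * L + k)) + (\<Sum>k<L. T (m + 2) $$ (i,k) * x (Suc m * L + k)))" if "i < L" for i
          using neg_of_sum_zero[OF eq[OF m(2) that, unfolded if_P[OF m(1)]]] .
      qed (use bS bT bU m in auto)
      then show ?thesis by (auto simp: block_sqnorm_def D_def)
    qed
    show "block_sqnorm L x m \<le> C * block_sqnorm L x 0" if m: "m \<le> N"
    proof -
      have "block_sqnorm L x m \<le> (2 * D + 1) ^ m * block_sqnorm L x 0"
        by (rule three_term_growth[OF _ D0 up m]) auto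
      also have "\<dots> \<le> C * block_sqnorm L x 0"
        unfolding C_def using D0 m by (intro mult_right_mono power_increasing) auto
      finally show ?thesis .
    qed
    show "block_sqnorm L x 0 \<le> C * (block_sqnorm L x (n0 - 1) + block_sqnorm L x n0)"
    proof -
      have "block_sqnorm L x 0 \<le> (2 * D + 1) ^ (n0 - 1) * (block_sqnorm L x (n0 - 1) + block_sqnorm L x (Suc (n0 - 1)))"
        by (rule three_term_decay[OF _ D0 down]) (use n0 in auto)
      also have "\<dots> \<le> C * (block_sqnorm L x (n0 - 1) + block_sqnorm L x (Suc (n0 - 1)))"
        unfolding C_def using D0 n0 by (intro mult_right_mono power_increasing) auto
      finally show ?thesis using n0 by simp
    qed
  qed
qed

section \<open>Weighted and unweighted Green functions\<close>

lemma weight_entry_form_upper: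
  "\<exists>c\<ge>0. \<forall>K\<ge>N. \<forall>x. Re (ip (K * L) x (mv (K * L) (weight_entry L N W) x)) \<le> c * (\<Sum>m<N. block_sqnorm L x m)"
proof -
  have "\<forall>m. \<exists>c. m < N \<longrightarrow> 0 \<le> c \<and> (\<forall>v. Re (quad_form L (W (m + 1)) v) \<le> c * (\<Sum>j<L. (cmod (v j))\<^sup>2))"
    using quad_form_upper W_herm by (metis Suc_eq_plus1 Suc_leI le_add2)
  then obtain c where c: "\<And>m. m < N \<Longrightarrow> 0 \<le> c m" "\<And>m v. m < N \<Longrightarrow> Re (quad_form L (W (m + 1)) v) \<le> c m * (\<Sum>j<L. (cmod (v j))\<^sup>2)"
    by metis
  let ?c = "\<Sum>m<N. c m"
  have cm: "c m \<le> ?c" if "m < N" for m using that c by (intro member_le_sum) auto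
  have "Re (ip (K * L) x (mv (K * L) (weight_entry L N W) x)) \<le> ?c * (\<Sum>m<N. block_sqnorm L x m)" if "N \<le> K" for K x
    unfolding weight_entry_form[OF that L_pos] Re_sum sum_distrib_left[of ?c]
  proof (rule sum_mono)
    fix m assume "m \<in> {..<N}"
    then have m: "m < N" by simp
    have "Re (quad_form L (W (m + 1)) (\<lambda>j. x (m * L + j))) \<le> c m * block_sqnorm L x m"
      using c(2)[OF m] by (simp add: block_sqnorm_def)
    also have "\<dots> \<le> ?c * block_sqnorm L x m" by (intro mult_right_mono cm m) auto
    finally show "Re (quad_form L (W (m + 1)) (\<lambda>j. x (m * L + j))) \<le> ?c * block_sqnorm L x m" .
  qed
  then show ?thesis using c(1) by (intro exI[of _ ?c]) (auto intro: sum_nonneg)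
qed

lemma weight_entry_form_lower:
  "\<exists>c>0. \<forall>K\<ge>N. \<forall>x. c * (block_sqnorm L x (n0 - 1) + block_sqnorm L x n0) \<le> Re (ip (K * L) x (mv (K * L) (weight_entry L N W) x))"
proof -
  obtain c1 where c1: "0 < c1" "\<And>v. c1 * (\<Sum>j<L. (cmod (v j))\<^sup>2) \<le> Re (quad_form L (W n0) v)"
    using pos_def_lower[OF Wpos(1)] by blast
  obtain c2 where c2: "0 < c2" "\<And>v. c2 * (\<Sum>j<L. (cmod (v j))\<^sup>2) \<le> Re (quad_form L (W (n0 + 1)) v)"
    using pos_def_lower[OF Wpos(2)] by blast
  have "min c1 c2 * (block_sqnorm L x (n0 - 1) + block_sqnorm L x n0) \<le> Re (ip (K * L) x (mv (K * L) (weight_entry L N W) x))" if "N \<le> K" for K x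
  proof -
    have nn: "0 \<le> Re (quad_form L (W (m + 1)) v)" if "m < N" for m v
      using W[of "m + 1"] that by (auto simp: real_psd_def)
    have "min c1 c2 * (block_sqnorm L x (n0 - 1) + block_sqnorm L x n0) \<le> c1 * block_sqnorm L x (n0 - 1) + c2 * block_sqnorm L x n0"
      unfolding distrib_left by (intro add_mono mult_right_mono) auto
    also have "\<dots> \<le> Re (quad_form L (W n0) (\<lambda>j. x ((n0 - 1) * L + j))) + Re (quad_form L (W (n0 + 1)) (\<lambda>j. x (n0 * L + j)))"
      using c1(2) c2(2) by (intro add_mono) (auto simp: block_sqnorm_def)
    also have "\<dots> = (\<Sum>m\<in>{n0 - 1, n0}. Re (quad_form L (W (m + 1)) (\<lambda>j. x (m * L + j))))"
      using n0 by simp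
    also have "\<dots> \<le> (\<Sum>m<N. Re (quad_form L (W (m + 1)) (\<lambda>j. x (m * L + j))))"
      using n0 nn by (intro sum_mono2) auto
    finally show ?thesis unfolding weight_entry_form[OF that L_pos] Re_sum .
  qed
  then show ?thesis using c1 c2 by (intro exI[of _ "min c1 c2"]) auto
qed

text \<open>The imaginary part of the trace of the site 1 block of the resolvent at x + i\<epsilon>,
  in spectral form. \<open>weighted_green\<close> is the trace of the resolvent against the weight,
  again its imaginary part.\<close>

definition site1_green :: "nat \<Rightarrow> real \<Rightarrow> real \<Rightarrow> real \<Rightarrow> real" where
  "site1_green K \<epsilon> x \<mu> = (\<Sum>k<K * L. poisson \<epsilon> (eigval_of (K * L) (Hmat \<mu>) k - x) * block_sqnorm L (eigvec_of (K * L) (Hmat \<mu>) k) 0)"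

definition weighted_green :: "nat \<Rightarrow> real \<Rightarrow> real \<Rightarrow> real \<Rightarrow> real" where
  "weighted_green K \<epsilon> x \<mu> = (\<Sum>k<K * L. poisson \<epsilon> (eigval_of (K * L) (Hmat \<mu>) k - x) *
     Re (ip (K * L) (eigvec_of (K * L) (Hmat \<mu>) k) (mv (K * L) (weight_entry L N W) (eigvec_of (K * L) (Hmat \<mu>) k))))"

text \<open>Completeness gives each coordinate total weight 1. The errors from distant eigenvalues
  are therefore bounded independently of K, however many there are.\<close>

lemma sum_block_sqnorm_eigenvectors:
  assumes "m < K"
  shows "(\<Sum>k<K * L. block_sqnorm L (eigvec_of (K * L) (Hmat \<mu>) k) m) = real L"
proof -
  have o: "orthon (K * L) (K * L) (eigvec_of (K * L) (Hmat \<mu>))"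
    using eigsys_ev[OF herm_Hmat] by (simp add: eigsys_def)
  have "(\<Sum>k<K * L. (cmod (eigvec_of (K * L) (Hmat \<mu>) k r))\<^sup>2) = 1" if "r < K * L" for r
  proof -
    have "complex_of_real (\<Sum>k<K * L. (cmod (eigvec_of (K * L) (Hmat \<mu>) k r))\<^sup>2) = 1"
      using orthon_complete[OF o that that] by (simp add: complex_norm_square del: of_real_power)
    then show ?thesis by (metis of_real_eq_1_iff)
  qed
  moreover have "m * L + j < K * L" if "j < L" for j
  proof -
    have "m * L + j < Suc m * L" using that by simp
    also have "\<dots> \<le> K * L" using assms by (intro mult_right_mono) auto
    finally show ?thesis .
  qed
  ultimately show ?thesis unfolding block_sqnorm_def by (subst sum.swap) simp
qed

lemma poisson_far: "0 < \<epsilon> \<Longrightarrow> 1 \<le> \<bar>t\<bar> \<Longrightarrow> poisson \<epsilon> t \<le> \<epsilon>"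
proof -
  assume "0 < \<epsilon>" "1 \<le> \<bar>t\<bar>"
  then have "1 \<le> t\<^sup>2 + \<epsilon>\<^sup>2" using power_mono[of 1 "\<bar>t\<bar>" 2] by (simp add: add_increasing2)
  then show ?thesis using \<open>0 < \<epsilon>\<close> unfolding poisson_def by (simp add: divide_le_eq)
qed

text \<open>Away from the energy the Poisson weights are at most the imaginary part, which leaves only
  eigenvectors with bounded eigenvalues, where the transfer matrices are bounded.\<close>

lemma site1_green_weighted_green_compare:
  "\<exists>C>0. \<forall>K>N. \<forall>\<mu>\<in>{\<mu>0..\<mu>1}. \<forall>\<epsilon>>0. \<forall>x\<in>{E-1..E+1}.
     site1_green K \<epsilon> x \<mu> \<le> C * weighted_green K \<epsilon> x \<mu> + C * \<epsilon> \<and> weighted_green K \<epsilon> x \<mu> \<le> C * site1_green K \<epsilon> x \<mu> + C * \<epsilon>"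
proof -
  \<comment> \<open>The radius is \<open>\<bar>E\<bar> + 2\<close> because x lies within 1 of E and
    a near eigenvalue within 1 of x.\<close>
  obtain C where C: "1 \<le> C" and CB: "\<And>K \<mu> d x. K > N \<Longrightarrow> \<mu> \<in> {\<mu>0..\<mu>1} \<Longrightarrow> \<bar>d\<bar> \<le> \<bar>E\<bar> + 2 \<Longrightarrow>
     (\<forall>r<K * L. mv (K * L) (Hmat \<mu>) x r = complex_of_real d * x r) \<Longrightarrow>
     (\<forall>m\<le>N. block_sqnorm L x m \<le> C * block_sqnorm L x 0) \<and> block_sqnorm L x 0 \<le> C * (block_sqnorm L x (n0 - 1) + block_sqnorm L x n0)"
    using eigenvector_block_bounds[of \<mu>0 \<mu>1 "\<bar>E\<bar> + 2"] by blast
  obtain w1 where w1: "0 \<le> w1" "\<And>K x. N \<le> K \<Longrightarrow> Re (ip (K * L) x (mv (K * L) (weight_entry L N W) x)) \<le> w1 * (\<Sum>m<N. block_sqnorm L x m)"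
    using weight_entry_form_upper by blast
  obtain w0 where w0: "0 < w0" "\<And>K x. N \<le> K \<Longrightarrow> w0 * (block_sqnorm L x (n0 - 1) + block_sqnorm L x n0) \<le> Re (ip (K * L) x (mv (K * L) (weight_entry L N W) x))"
    using weight_entry_form_lower by blast
  \<comment> \<open>The first two terms are the main and the error constant for bounding
    \<open>site1_green\<close>, the last two those for \<open>weighted_green\<close>.\<close>
  define C' where "C' = C / w0 + real L + w1 * real N * C + w1 * real N * real L"
  have C'p: "0 < C'" using C w0 w1 L_pos unfolding C'_def
    by (intro add_pos_nonneg divide_pos_pos mult_nonneg_nonneg) auto
  have "site1_green K \<epsilon> x \<mu> \<le> C' * weighted_green K \<epsilon> x \<mu> + C' * \<epsilon> \<and> weighted_green K \<epsilon> x \<mu> \<le> C' * site1_green K \<epsilon> x \<mu> + C' * \<epsilon>"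
    if K: "K > N" and \<mu>: "\<mu> \<in> {\<mu>0..\<mu>1}" and \<epsilon>: "\<epsilon> > 0" and x: "x \<in> {E-1..E+1}" for K \<mu> \<epsilon> x
  proof -
    let ?n = "K * L"
    define u where "u = eigvec_of ?n (Hmat \<mu>)"
    define d where "d = eigval_of ?n (Hmat \<mu>)"
    define w where "w = (\<lambda>k. Re (ip ?n (u k) (mv ?n (weight_entry L N W) (u k))))"
    have es: "eigsys ?n (Hmat \<mu>) u d" unfolding u_def d_def by (rule eigsys_ev[OF herm_Hmat])
    have wn: "0 \<le> w k" for k unfolding w_def using K by (intro weight_entry_form_nonneg) auto
    have pn: "0 \<le> poisson \<epsilon> (d k - x)" for k using \<epsilon> by simp
    have g: "site1_green K \<epsilon> x \<mu> = (\<Sum>k<?n. poisson \<epsilon> (d k - x) * block_sqnorm L (u k) 0)" by (simp add: site1_green_def u_def d_def)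
    have F: "weighted_green K \<epsilon> x \<mu> = (\<Sum>k<?n. poisson \<epsilon> (d k - x) * w k)" by (simp add: weighted_green_def u_def d_def w_def)
    have g0: "0 \<le> site1_green K \<epsilon> x \<mu>" unfolding g using pn by (intro sum_nonneg mult_nonneg_nonneg) auto
    have F0: "0 \<le> weighted_green K \<epsilon> x \<mu>" unfolding F using pn wn by (intro sum_nonneg mult_nonneg_nonneg) auto
    have near: "(\<forall>m\<le>N. block_sqnorm L (u k) m \<le> C * block_sqnorm L (u k) 0) \<and> block_sqnorm L (u k) 0 \<le> C * (block_sqnorm L (u k) (n0 - 1) + block_sqnorm L (u k) n0)"
      if "k < ?n" "\<bar>d k - x\<bar> < 1" for k
      by (rule CB[OF K \<mu>, of "d k"]) (use that x es in \<open>auto simp: eigsys_def\<close>)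
    have far: "poisson \<epsilon> (d k - x) \<le> \<epsilon>" if "\<not> \<bar>d k - x\<bar> < 1" for k
      using that by (intro poisson_far \<epsilon>) auto
    have sb: "(\<Sum>k<?n. block_sqnorm L (u k) m) = real L" if "m < K" for m
      unfolding u_def using that by (rule sum_block_sqnorm_eigenvectors)
    have "poisson \<epsilon> (d k - x) * block_sqnorm L (u k) 0 \<le> (C / w0) * (poisson \<epsilon> (d k - x) * w k) + \<epsilon> * block_sqnorm L (u k) 0" if "k < ?n" for k
    proof (cases "\<bar>d k - x\<bar> < 1")
      case True
      have "block_sqnorm L (u k) 0 \<le> C * (block_sqnorm L (u k) (n0 - 1) + block_sqnorm L (u k) n0)" using near[OF that True] by simp
      also have "\<dots> = (C / w0) * (w0 * (block_sqnorm L (u k) (n0 - 1) + block_sqnorm L (u k) n0))" using w0 by simp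
      also have "\<dots> \<le> (C / w0) * w k"
        unfolding w_def using w0 C K by (intro mult_left_mono w0(2)) auto
      finally have "poisson \<epsilon> (d k - x) * block_sqnorm L (u k) 0 \<le> poisson \<epsilon> (d k - x) * ((C / w0) * w k)"
        using pn by (rule mult_left_mono)
      moreover have "0 \<le> \<epsilon> * block_sqnorm L (u k) 0" using \<epsilon> by simp
      ultimately show ?thesis by (simp add: mult_ac)
    next
      case False
      have "poisson \<epsilon> (d k - x) * block_sqnorm L (u k) 0 \<le> \<epsilon> * block_sqnorm L (u k) 0" using far[OF False] by (intro mult_right_mono) auto
      moreover have "0 \<le> (C / w0) * (poisson \<epsilon> (d k - x) * w k)" using pn wn w0 C by (intro mult_nonneg_nonneg) auto
      ultimately show ?thesis by linarith
    qed
    then have "site1_green K \<epsilon> x \<mu> \<le> (\<Sum>k<?n. (C / w0) * (poisson \<epsilon> (d k - x) * w k) + \<epsilon> * block_sqnorm L (u k) 0)"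
      unfolding g by (intro sum_mono) auto
    also have "\<dots> = (C / w0) * weighted_green K \<epsilon> x \<mu> + \<epsilon> * real L"
      unfolding F sum.distrib sum_distrib_left[symmetric] using sb[of 0] K by simp
    also have "\<dots> \<le> C' * weighted_green K \<epsilon> x \<mu> + C' * \<epsilon>"
    proof -
      have "C / w0 \<le> C'" "real L \<le> C'" unfolding C'_def using C w0 w1 by auto
      then show ?thesis using F0 \<epsilon> by (subst mult.commute[of \<epsilon>]) (intro add_mono mult_right_mono, auto)
    qed
    finally have 1: "site1_green K \<epsilon> x \<mu> \<le> C' * weighted_green K \<epsilon> x \<mu> + C' * \<epsilon>" .
    have wle: "w k \<le> w1 * (\<Sum>m<N. block_sqnorm L (u k) m)" for k unfolding w_def using K by (intro w1(2)) auto
    have "poisson \<epsilon> (d k - x) * w k \<le> (w1 * real N * C) * (poisson \<epsilon> (d k - x) * block_sqnorm L (u k) 0) + \<epsilon> * (w1 * (\<Sum>m<N. block_sqnorm L (u k) m))" if "k < ?n" for k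
    proof (cases "\<bar>d k - x\<bar> < 1")
      case True
      have "(\<Sum>m<N. block_sqnorm L (u k) m) \<le> (\<Sum>m<N. C * block_sqnorm L (u k) 0)"
        using near[OF that True] by (intro sum_mono) auto
      then have "w k \<le> w1 * (real N * (C * block_sqnorm L (u k) 0))"
        using mult_left_mono[OF _ w1(1)] wle[of k] by (fastforce intro: order_trans)
      then have "poisson \<epsilon> (d k - x) * w k \<le> poisson \<epsilon> (d k - x) * (w1 * (real N * (C * block_sqnorm L (u k) 0)))"
        using pn by (intro mult_left_mono) auto
      moreover have "0 \<le> \<epsilon> * (w1 * (\<Sum>m<N. block_sqnorm L (u k) m))" using \<epsilon> w1 by (intro mult_nonneg_nonneg sum_nonneg) auto
      ultimately show ?thesis by (simp add: mult_ac)
    next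
      case False
      have "poisson \<epsilon> (d k - x) * w k \<le> \<epsilon> * (w1 * (\<Sum>m<N. block_sqnorm L (u k) m))"
        using far[OF False] wle[of k] wn[of k] \<epsilon> by (intro mult_mono) auto
      moreover have "0 \<le> (w1 * real N * C) * (poisson \<epsilon> (d k - x) * block_sqnorm L (u k) 0)" using pn w1 C by (intro mult_nonneg_nonneg) auto
      ultimately show ?thesis by linarith
    qed
    then have "weighted_green K \<epsilon> x \<mu> \<le> (\<Sum>k<?n. (w1 * real N * C) * (poisson \<epsilon> (d k - x) * block_sqnorm L (u k) 0) + \<epsilon> * (w1 * (\<Sum>m<N. block_sqnorm L (u k) m)))"
      unfolding F by (intro sum_mono) auto
    also have "\<dots> = (w1 * real N * C) * site1_green K \<epsilon> x \<mu> + \<epsilon> * (w1 * (\<Sum>k<?n. \<Sum>m<N. block_sqnorm L (u k) m))"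
      unfolding g by (simp add: sum.distrib flip: sum_distrib_left)
    also have "(\<Sum>k<?n. \<Sum>m<N. block_sqnorm L (u k) m) = real N * real L"
      using sb K by (subst sum.swap) simp
    also have "(w1 * real N * C) * site1_green K \<epsilon> x \<mu> + \<epsilon> * (w1 * (real N * real L)) \<le> C' * site1_green K \<epsilon> x \<mu> + C' * \<epsilon>"
    proof -
      have "w1 * real N * C \<le> C'" "w1 * (real N * real L) \<le> C'" unfolding C'_def using C w0 w1 by auto
      then show ?thesis using g0 \<epsilon> by (subst mult.commute[of \<epsilon>]) (intro add_mono mult_right_mono, auto)
    qed
    finally show ?thesis using 1 by blast
  qed
  then show ?thesis using C'p by blast
qed


section \<open>Integration over the coupling and counting at large K\<close>

lemma mv_Hmat: "mv n (Hmat \<mu>) x r = mv n (jacobi_entry L T V) x r + complex_of_real \<mu> * mv n (weight_entry L N W) x r"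
  by (simp add: mv_def Hmat_def distrib_right sum.distrib sum_distrib_left mult.assoc)

lemma Hmat_form: "Re (ip n x (mv n (Hmat \<mu>) x)) = Re (ip n x (mv n (jacobi_entry L T V) x)) + \<mu> * Re (ip n x (mv n (weight_entry L N W) x))"
proof -
  have "ip n x (mv n (Hmat \<mu>) x) = ip n x (mv n (jacobi_entry L T V) x) + complex_of_real \<mu> * ip n x (mv n (weight_entry L N W) x)"
    by (simp add: mv_Hmat[abs_def] ip_add_right ip_scale_right)
  then show ?thesis by simp
qed

lemma weighted_green_has_integral:
  assumes "\<mu>0 \<le> \<mu>1" "0 < \<epsilon>"
  shows "(weighted_green K \<epsilon> x has_integral ((\<Sum>k<K * L. arctan ((eigval_of (K * L) (Hmat \<mu>1) k - x) / \<epsilon>))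
     - (\<Sum>k<K * L. arctan ((eigval_of (K * L) (Hmat \<mu>0) k - x) / \<epsilon>)))) {\<mu>0..\<mu>1}"
proof -
  have "((\<lambda>\<mu>. \<Sum>k<K * L. arctan ((eigval_of (K * L) (Hmat \<mu>) k - x) / \<epsilon>)) has_real_derivative weighted_green K \<epsilon> x \<mu>) (at \<mu>)" for \<mu>
    using trace_function_derivative[OF herm_jacobi_entry herm_weight_entry arctan_scaled_expansion[OF assms(2)], folded Hmat_def]
    unfolding weighted_green_def .
  then show ?thesis
    using assms(1) by (intro fundamental_theorem_of_calculus)
      (auto intro: has_field_derivative_at_within simp flip: has_real_derivative_iff_has_vector_derivative)
qed

text \<open>The min-max comparison with no functionals at all: raising \<mu> raises the form, since
  the weight is positive semi-definite.\<close>

lemma eig_count_Hmat_antimono: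
  assumes "\<mu>0 \<le> \<mu>1" "N \<le> K"
  shows "eig_count (K * L) (eigval_of (K * L) (Hmat \<mu>1)) t \<le> eig_count (K * L) (eigval_of (K * L) (Hmat \<mu>0)) t"
proof -
  have "eig_count (K * L) (eigval_of (K * L) (Hmat \<mu>1)) t \<le> eig_count (K * L) (eigval_of (K * L) (Hmat \<mu>0)) t + card ({} :: (nat \<Rightarrow> complex) set)"
    by (rule eig_count_le_functionals[OF eigsys_ev[OF herm_Hmat] eigsys_ev[OF herm_Hmat]])
      (use assms weight_entry_form_nonneg in \<open>auto simp: Hmat_form intro: mult_right_mono\<close>)
  then show ?thesis by simp
qed

text \<open>On vectors that vanish on the first N sites the two forms agree, and N L coordinate
  functionals cut these out, whatever K is.\<close>

lemma eig_count_Hmat_finite_rank: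
  assumes "N \<le> K"
  shows "eig_count (K * L) (eigval_of (K * L) (Hmat \<mu>0)) t \<le> eig_count (K * L) (eigval_of (K * L) (Hmat \<mu>1)) t + N * L"
proof -
  define F where "F = (\<lambda>r0 r. if r = r0 then 1 else 0 :: complex) ` {..<N * L}"
  have NK: "N * L \<le> K * L" using assms by simp
  have "eig_count (K * L) (eigval_of (K * L) (Hmat \<mu>0)) t \<le> eig_count (K * L) (eigval_of (K * L) (Hmat \<mu>1)) t + card F"
  proof (rule eig_count_le_functionals[OF eigsys_ev[OF herm_Hmat] eigsys_ev[OF herm_Hmat]])
    fix x assume x: "\<forall>l\<in>F. (\<Sum>r<K * L. l r * x r) = 0"
    have x0: "x s = 0" if "s < N * L" for s
    proof -
      have "(\<lambda>r. if r = s then 1 else 0) \<in> F" using that by (auto simp: F_def)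
      from x[rule_format, OF this] have "(\<Sum>r<K * L. (if r = s then 1 else 0) * x r) = 0" .
      moreover have "(\<Sum>r<K * L. (if r = s then 1 else 0) * x r) = (\<Sum>r<K * L. if r = s then x r else 0)"
        by (intro sum.cong) auto
      ultimately show ?thesis using that NK by simp
    qed
    have "weight_entry L N W r s * x s = 0" for r s
    proof (cases "s div L < N")
      case True
      then have "s < N * L" using L_pos by (simp add: div_less_iff_less_mult)
      then show ?thesis using x0 by simp
    qed (auto simp: weight_entry_def)
    then have "mv n (weight_entry L N W) x r = 0" for n r unfolding mv_def by (intro sum.neutral) auto
    then show "Re (ip (K * L) x (mv (K * L) (Hmat \<mu>1) x)) \<le> Re (ip (K * L) x (mv (K * L) (Hmat \<mu>0) x))"
      unfolding Hmat_form by (simp add: ip_def)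
  qed (simp add: F_def)
  also have "card F \<le> N * L" unfolding F_def using card_image_le[of "{..<N * L}"] by simp
  finally show ?thesis by simp
qed

lemma weight_entry_zero: "N * L \<le> s \<Longrightarrow> weight_entry L N W r s = 0"
  using L_pos div_le_mono[of "N * L" s L] by (auto simp: weight_entry_def)

text \<open>The window comes from the crossings of the N-site matrix and hence serves all K; the
  exceptional set X is allowed to depend on K.\<close>

lemma eig_count_Hmat_pass:
  assumes pass: "2 * L \<le> card {k \<in> {1..N * L}.
                 kth_eig (HN L N T V W \<mu>0) k < E \<and> E < kth_eig (HN L N T V W \<mu>1) k}"
  shows "\<exists>\<delta>>0. \<forall>K>N. \<exists>X. finite X \<and> (\<forall>t\<in>{E-\<delta>..E+\<delta>} - X.
    eig_count (K * L) (eigval_of (K * L) (Hmat \<mu>1)) t + 1 \<le> eig_count (K * L) (eigval_of (K * L) (Hmat \<mu>0)) t)"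
proof -
  note ev = eigsys_ev[OF herm_Hmat]
  have "1 \<le> 2 * L" using L_pos by simp
  from kth_eig_pass_count[OF ev ev this pass[unfolded HN_eq_Hmat]]
  obtain \<delta> where \<delta>: "0 < \<delta>" "\<And>t. t \<in> {E-\<delta>..E+\<delta>} \<Longrightarrow>
    eig_count (N * L) (eigval_of (N * L) (Hmat \<mu>1)) t + 2 * L \<le> eig_count (N * L) (eigval_of (N * L) (Hmat \<mu>0)) t" by auto
  have "\<exists>X. finite X \<and> (\<forall>t\<in>{E-\<delta>..E+\<delta>} - X.
    eig_count (K * L) (eigval_of (K * L) (Hmat \<mu>1)) t + 1 \<le> eig_count (K * L) (eigval_of (K * L) (Hmat \<mu>0)) t)" if K: "N < K" for K
  proof -
    define p where "p = N * L"
    define q where "q = (K - N) * L"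
    have pq: "K * L = p + q" using K by (simp add: p_def q_def flip: add_mult_distrib)
    have Lp: "L \<le> p" using n0 by (simp add: p_def)
    have hC: "herm q (\<lambda>r s. Hmat \<mu>0 (p + r) (p + s))"
      unfolding herm_def
      by (intro allI impI, rule herm_Hmat[of "p + q" \<mu>0, unfolded herm_def, rule_format]) auto
    define c where "c = eigval_of q (\<lambda>r s. Hmat \<mu>0 (p + r) (p + s))"
    note C = eigsys_ev[OF hC, folded c_def]
    define d where "d = eigval_of (p + q) (Hmat \<mu>0)"
    define e where "e = eigval_of p (Hmat \<mu>0)"
    \<comment> \<open>Such an r belongs to a site before N, which is not a neighbour of any site
      beyond N.\<close>
    have band: "Hmat \<mu>0 r (p + s) = 0" if "r < p - L" for r s
    proof -
      have "r + L < N * L" using that by (simp add: p_def)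
      then have "(r + L) div L < N" by (rule less_mult_imp_div_less)
      moreover have "(r + L) div L = r div L + 1" using L_pos by (intro div_add_self2) simp
      ultimately have r: "r div L + 1 < N" by simp
      have s: "N \<le> (p + s) div L" using L_pos div_le_mono[of "N * L" "p + s" L] by (simp add: p_def)
      then have "jacobi_entry L T V r (p + s) = 0" using r by (simp add: jacobi_entry_def Let_def)
      then show ?thesis using weight_entry_zero[of "p + s" r] by (simp add: Hmat_def p_def)
    qed
    have eq: "Hmat \<mu>1 r s = Hmat \<mu>0 r s" if "p \<le> s" for r s
      using weight_entry_zero[of s r] that by (simp add: Hmat_def p_def)
    \<comment> \<open>Levels at which the Schur complement is undefined, or at which the reflected
      counts have a tie.\<close>
    define X where "X = c ` {..<q} \<union> e ` {..<p} \<union> d ` {..<p + q}"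
    have "eig_count (p + q) (eigval_of (p + q) (Hmat \<mu>1)) t + 1 \<le> eig_count (p + q) (eigval_of (p + q) (Hmat \<mu>0)) t"
      if t: "t \<in> {E-\<delta>..E+\<delta>} - X" for t
    proof -
      have "eig_count (p + q) (eigval_of (p + q) (Hmat \<mu>1)) t + eig_count p e t \<le> eig_count (p + q) d t + eig_count p (eigval_of p (Hmat \<mu>1)) t + L"
        by (rule schur_count_difference[OF herm_Hmat herm_Hmat ev[of "p + q" \<mu>0, folded d_def] ev[of p \<mu>0, folded e_def] ev ev C Lp band eq])
          (use t in \<open>auto simp: X_def\<close>)
      moreover have "eig_count p (eigval_of p (Hmat \<mu>1)) t + 2 * L \<le> eig_count p e t"
        using \<delta>(2)[of t] t by (simp add: p_def e_def)
      ultimately show ?thesis using L_pos by (simp add: d_def)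
    qed
    then show ?thesis unfolding pq by (intro exI[of _ X]) (auto simp: X_def)
  qed
  then show ?thesis using \<delta>(1) by blast
qed

text \<open>Stated for every value G of the integral, so that integrability can be supplied later
  from continuity in \<mu>.\<close>

lemma site1_green_integral_bounds:
  assumes le: "\<mu>0 \<le> \<mu>1"
    and pass: "2 * L \<le> card {k \<in> {1..N * L}.
                 kth_eig (HN L N T V W \<mu>0) k < E \<and> E < kth_eig (HN L N T V W \<mu>1) k}"
  shows "\<exists>\<delta>>0. \<exists>\<epsilon>0>0. \<exists>c>0. \<exists>C. \<forall>K>N. \<forall>\<epsilon>. 0 < \<epsilon> \<longrightarrow> \<epsilon> < \<epsilon>0 \<longrightarrow> (\<forall>x\<in>{E-\<delta><..<E+\<delta>}. \<forall>G.
    (site1_green K \<epsilon> x has_integral G) {\<mu>0..\<mu>1} \<longrightarrow> c \<le> G \<and> G \<le> C)"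
proof -
  obtain C where C: "0 < C" and CB: "\<And>K \<mu> \<epsilon> x. K > N \<Longrightarrow> \<mu> \<in> {\<mu>0..\<mu>1} \<Longrightarrow> 0 < \<epsilon> \<Longrightarrow> x \<in> {E-1..E+1} \<Longrightarrow>
     site1_green K \<epsilon> x \<mu> \<le> C * weighted_green K \<epsilon> x \<mu> + C * \<epsilon> \<and> weighted_green K \<epsilon> x \<mu> \<le> C * site1_green K \<epsilon> x \<mu> + C * \<epsilon>"
    using site1_green_weighted_green_compare[of \<mu>0 \<mu>1 E] by blast
  obtain \<delta> where \<delta>: "0 < \<delta>" "\<And>K. N < K \<Longrightarrow> \<exists>X. finite X \<and> (\<forall>t\<in>{E-\<delta>..E+\<delta>} - X.
    eig_count (K * L) (eigval_of (K * L) (Hmat \<mu>1)) t + 1 \<le> eig_count (K * L) (eigval_of (K * L) (Hmat \<mu>0)) t)"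
    using eig_count_Hmat_pass[OF pass] by blast
  define D where "D = \<mu>1 - \<mu>0"
  have D0: "0 \<le> D" using le by (simp add: D_def)
  \<comment> \<open>The bound \<open>\<delta> / 2\<close> puts both ends of the window at least
    \<epsilon> away from x, so each arctangent contributes pi/4. The last bound makes the error
    \<open>C * \<epsilon> * D\<close> at most 1/2, with \<open>D + 1\<close> avoiding division by
    zero.\<close>
  define \<epsilon>0 where "\<epsilon>0 = min (\<delta> / 2) (min 1 (1 / (2 * C * (D + 1))))"
  have \<epsilon>0: "0 < \<epsilon>0" using \<delta> C D0 by (simp add: \<epsilon>0_def)
  have "1 / C \<le> G \<and> G \<le> C * (real (N * L) * pi) + C * D"
    if K: "N < K" and e: "0 < \<epsilon>" "\<epsilon> < \<epsilon>0" and x: "x \<in> {E - min 1 (\<delta>/2)<..<E + min 1 (\<delta>/2)}"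
      and G: "(site1_green K \<epsilon> x has_integral G) {\<mu>0..\<mu>1}" for K \<epsilon> x G
  proof -
    define F where "F = (\<Sum>k<K * L. arctan ((eigval_of (K * L) (Hmat \<mu>1) k - x) / \<epsilon>)) - (\<Sum>k<K * L. arctan ((eigval_of (K * L) (Hmat \<mu>0) k - x) / \<epsilon>))"
    have F: "(weighted_green K \<epsilon> x has_integral F) {\<mu>0..\<mu>1}" unfolding F_def by (rule weighted_green_has_integral[OF le e(1)])
    have x1: "x \<in> {E-1..E+1}" using x by auto
    have e': "C * \<epsilon> * D \<le> 1/2" "\<epsilon> \<le> 1" "\<epsilon> \<le> \<delta> / 2"
    proof -
      have "\<epsilon> \<le> 1 / (2 * C * (D + 1))" using e by (simp add: \<epsilon>0_def)
      then have "\<epsilon> * (2 * C * (D + 1)) \<le> 1" using C D0 by (simp add: pos_le_divide_eq)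
      moreover have "C * \<epsilon> * D \<le> C * \<epsilon> * (D + 1)" using C e by simp
      moreover have "2 * (C * \<epsilon> * (D + 1)) = \<epsilon> * (2 * C * (D + 1))" by (simp add: mult_ac)
      ultimately show "C * \<epsilon> * D \<le> 1/2" by linarith
    qed (use e in \<open>auto simp: \<epsilon>0_def\<close>)
    have const: "((\<lambda>\<mu>. C * \<epsilon>) has_integral (C * \<epsilon> * D)) {\<mu>0..\<mu>1}"
      using has_integral_const_real[of "C * \<epsilon>" \<mu>0 \<mu>1] le by (simp add: D_def mult_ac)
    have "F \<le> C * G + C * \<epsilon> * D"
      by (rule has_integral_le[OF F has_integral_add[OF has_integral_mult_right[OF G] const]])
        (use CB[OF K _ e(1) x1] in auto)
    moreover have "G \<le> C * F + C * \<epsilon> * D"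
      by (rule has_integral_le[OF G has_integral_add[OF has_integral_mult_right[OF F] const]])
        (use CB[OF K _ e(1) x1] in auto)
    moreover have "F \<le> real (N * L) * pi"
      unfolding F_def by (rule arctan_sum_upper[OF e(1)]) (rule eig_count_Hmat_finite_rank, use K in simp)
    moreover have "pi / 2 \<le> F"
    proof -
      obtain X where X: "finite X" "\<And>t. t\<in>{E-\<delta>..E+\<delta>} - X \<Longrightarrow>
        eig_count (K * L) (eigval_of (K * L) (Hmat \<mu>1)) t + 1 \<le> eig_count (K * L) (eigval_of (K * L) (Hmat \<mu>0)) t"
        using \<delta>(2)[OF K] by blast
      have "arctan ((E + \<delta> - x) / \<epsilon>) - arctan ((E - \<delta> - x) / \<epsilon>) \<le> F"
        unfolding F_def by (rule arctan_sum_lower[OF e(1) eig_count_Hmat_antimono X]) (use le K \<delta> in auto)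
      moreover have "pi / 4 \<le> arctan ((E + \<delta> - x) / \<epsilon>)"
        unfolding arctan_one[symmetric] using e e' x by (intro arctan_monotone') (auto simp: pos_le_divide_eq)
      moreover have "arctan ((E - \<delta> - x) / \<epsilon>) \<le> arctan (- 1)"
        using e e' x by (intro arctan_monotone') (auto simp: pos_divide_le_eq)
      then have "arctan ((E - \<delta> - x) / \<epsilon>) \<le> - (pi / 4)"
        by (simp add: arctan_minus arctan_one)
      ultimately show ?thesis by simp
    qed
    moreover have "C * \<epsilon> * D \<le> C * D" using C D0 e' mult_right_mono[of \<epsilon> 1 "C * D"] by (simp add: mult_ac)
    moreover have "C * F \<le> C * (real (N * L) * pi)" using \<open>F \<le> real (N * L) * pi\<close> C by (intro mult_left_mono) auto
    \<comment> \<open>Here pi/2 minus the error 1/2 is still at least 1.\<close>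
    moreover have "1 \<le> C * G" using \<open>pi / 2 \<le> F\<close> \<open>F \<le> C * G + C * \<epsilon> * D\<close> e'(1) pi_gt3 by linarith
    ultimately have "1 \<le> C * G" "G \<le> C * (real (N * L) * pi) + C * D" by linarith+
    then show ?thesis using C by (simp add: pos_divide_le_eq mult.commute)
  qed
  moreover have "0 < min 1 (\<delta>/2)" "0 < 1 / C" using \<delta> C by auto
  ultimately show ?thesis using \<epsilon>0 by (metis (no_types, lifting))
qed

end

section \<open>Resolvents of the truncations\<close>

text \<open>Column i of the resolvent of a at z, in spectral form.\<close>

definition resolvent_col :: "nat \<Rightarrow> (nat \<Rightarrow> nat \<Rightarrow> complex) \<Rightarrow> complex \<Rightarrow> nat \<Rightarrow> nat \<Rightarrow> complex" where
  "resolvent_col n a z i r = (\<Sum>k<n. (cnj (eigvec_of n a k i) / (complex_of_real (eigval_of n a k) - z)) * eigvec_of n a k r)"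

lemma resolvent_col_eq:
  assumes h: "herm n a" and z: "Im z \<noteq> 0" and ir: "i < n" "r < n"
  shows "mv n a (resolvent_col n a z i) r - z * resolvent_col n a z i r = (if r = i then 1 else 0)"
proof -
  note e = eigsys_ev[OF h]
  have o: "orthon n n (eigvec_of n a)" using e by (simp add: eigsys_def)
  let ?c = "\<lambda>k. cnj (eigvec_of n a k i) / (complex_of_real (eigval_of n a k) - z)"
  have nz: "complex_of_real (eigval_of n a k) - z \<noteq> 0" for k using z by (auto simp: complex_eq_iff)
  have "mv n a (resolvent_col n a z i) r = (\<Sum>k<n. ?c k * mv n a (eigvec_of n a k) r)"
    unfolding resolvent_col_def mv_sum ..
  also have "\<dots> = (\<Sum>k<n. ?c k * (complex_of_real (eigval_of n a k) * eigvec_of n a k r))"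
    using e ir by (intro sum.cong) (auto simp: eigsys_def)
  finally have "mv n a (resolvent_col n a z i) r - z * resolvent_col n a z i r = (\<Sum>k<n. ?c k * (complex_of_real (eigval_of n a k) * eigvec_of n a k r) - z * (?c k * eigvec_of n a k r))"
    by (simp add: resolvent_col_def sum_subtractf sum_distrib_left)
  also have "\<dots> = (\<Sum>k<n. eigvec_of n a k r * cnj (eigvec_of n a k i))"
  proof (rule sum.cong[OF refl])
    fix k
    have "?c k * (complex_of_real (eigval_of n a k) * eigvec_of n a k r) - z * (?c k * eigvec_of n a k r)
       = ?c k * (complex_of_real (eigval_of n a k) - z) * eigvec_of n a k r"
      by (simp only: left_diff_distrib right_diff_distrib mult_ac)
    then show "?c k * (complex_of_real (eigval_of n a k) * eigvec_of n a k r) - z * (?c k * eigvec_of n a k r) = eigvec_of n a k r * cnj (eigvec_of n a k i)"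
      using nz[of k] by simp
  qed
  also have "\<dots> = (if r = i then 1 else 0)" by (rule orthon_complete[OF o ir(2,1)])
  finally show ?thesis .
qed

text \<open>The imaginary part of the inner product of y with (a - z) y loses the Hermitian term and
  leaves Im z times the squared norm; Cauchy-Schwarz does the rest. It is stated for arbitrary y and
  f because it is also applied to differences of approximate solutions.\<close>

lemma resolvent_col_bound:
  assumes h: "herm n a" and z: "Im z \<noteq> 0"
    and f: "\<And>r. r < n \<Longrightarrow> mv n a y r - z * y r = f r"
  shows "sqn n y \<le> sqn n f / (Im z)\<^sup>2"
proof -
  have "ip n y f = ip n y (\<lambda>r. mv n a y r - z * y r)" using f by (intro ip_cong) auto
  also have "\<dots> = ip n y (mv n a y) - z * complex_of_real (sqn n y)"
    by (simp add: ip_diff_right ip_scale_right ip_self)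
  finally have "Im (ip n y f) = - Im z * sqn n y" using herm_ip_real[OF h, of y] by simp
  then have "\<bar>Im z\<bar> * sqn n y \<le> cmod (ip n y f)"
    using abs_Im_le_cmod[of "ip n y f"] by (simp add: abs_mult)
  then have "(\<bar>Im z\<bar> * sqn n y)\<^sup>2 \<le> (cmod (ip n y f))\<^sup>2" by (intro power_mono) auto
  also have "\<dots> \<le> sqn n y * sqn n f"
    using cmod_sum_mult_le[of "\<lambda>r. cnj (y r)" f n] by (simp add: ip_def sqn_def)
  finally have *: "((Im z)\<^sup>2 * sqn n y) * sqn n y \<le> sqn n f * sqn n y"
    by (simp add: power_mult_distrib power2_eq_square[of "sqn n y"] mult_ac)
  show ?thesis
  proof (cases "sqn n y = 0")
    case False
    then have "0 < sqn n y" using sqn_nonneg[of n y] by linarith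
    then have "(Im z)\<^sup>2 * sqn n y \<le> sqn n f" using * by simp
    then show ?thesis using z by (simp add: pos_le_divide_eq mult.commute)
  qed simp
qed

lemma sqn_delta: "i < n \<Longrightarrow> sqn n (\<lambda>r. if r = i then 1 else 0) = 1"
  by (simp add: sqn_def if_distrib[of cmod] if_distrib[of "\<lambda>x. x\<^sup>2"] cong: if_cong)

lemma resolvent_col_norm:
  assumes "herm n a" "Im z \<noteq> 0" "i < n"
  shows "sqn n (resolvent_col n a z i) \<le> 1 / (Im z)\<^sup>2"
  using resolvent_col_bound[OF assms(1,2), of "resolvent_col n a z i" "\<lambda>r. if r = i then 1 else 0"] resolvent_col_eq[OF assms]
  by (simp add: sqn_delta assms(3))

lemma cmod_sq_le_sqn: "r < n \<Longrightarrow> (cmod (y r))\<^sup>2 \<le> sqn n y"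
  unfolding sqn_def by (rule member_le_sum[of r _ "\<lambda>r. (cmod (y r))\<^sup>2"]) auto

lemma sqn_add_le: "sqn n (\<lambda>r. x r + y r) \<le> 2 * (sqn n x + sqn n y)"
  unfolding sqn_def sum.distrib[symmetric] sum_distrib_left by (intro sum_mono cmod_add_sq_le)

lemma sqn_scale: "sqn n (\<lambda>r. c * x r) = (cmod c)\<^sup>2 * sqn n x"
  by (simp add: sqn_def norm_mult power_mult_distrib sum_distrib_left)

lemma sqn_mv_le: "sqn n (mv n w y) \<le> (\<Sum>r<n. \<Sum>s<n. (cmod (w r s))\<^sup>2) * sqn n y"
  unfolding sqn_def mv_def sum_distrib_right by (intro sum_mono) (simp add: sum_distrib_right[symmetric] cmod_sum_mult_le)

context block_jacobi
begin

lemma site1_green_eq_resolvent_col: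
  assumes "0 < K"
  shows "site1_green K \<epsilon> x \<mu> = (\<Sum>i<L. Im (resolvent_col (K * L) (Hmat \<mu>) (Complex x \<epsilon>) i i))"
proof -
  have "Im ((cnj u / (complex_of_real d - Complex x \<epsilon>)) * u) = poisson \<epsilon> (d - x) * (cmod u)\<^sup>2" for u d
  proof -
    have "(cnj u / (complex_of_real d - Complex x \<epsilon>)) * u = complex_of_real ((cmod u)\<^sup>2) * inverse (complex_of_real d - Complex x \<epsilon>)"
      unfolding cnj_mult_self[symmetric] by (simp add: divide_inverse mult_ac)
    then have "Im ((cnj u / (complex_of_real d - Complex x \<epsilon>)) * u) = (cmod u)\<^sup>2 * Im (inverse (complex_of_real d - Complex x \<epsilon>))"
      by (simp only: Im_complex_of_real Re_complex_of_real times_complex.sel)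
    also have "Im (inverse (complex_of_real d - Complex x \<epsilon>)) = poisson \<epsilon> (d - x)" by (simp add: poisson_def)
    finally show ?thesis by simp
  qed
  then show ?thesis
    unfolding site1_green_def resolvent_col_def Im_sum block_sqnorm_def
    by (subst sum.swap) (simp add: sum_distrib_left)
qed

text \<open>The second resolvent identity makes the truncated Green function Lipschitz in all parameters.\<close>

lemma resolvent_col_lipschitz:
  assumes e: "0 < \<epsilon>" and i: "i < n"
  shows "\<exists>B. B-lipschitz_on UNIV (\<lambda>p. resolvent_col n (Hmat (fst p)) (Complex (snd p) \<epsilon>) i i)"
proof -
  define S where "S = (\<Sum>r<n. \<Sum>s<n. (cmod (weight_entry L N W r s))\<^sup>2)"
  have S0: "0 \<le> S" unfolding S_def by (intro sum_nonneg) auto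
  define B where "B = sqrt (2 * (S + 1) / \<epsilon>^4)"
  have "dist (resolvent_col n (Hmat \<mu>) (Complex x \<epsilon>) i i) (resolvent_col n (Hmat \<mu>') (Complex x' \<epsilon>) i i) \<le> B * dist (\<mu>, x) (\<mu>', x')" for \<mu> x \<mu>' x'
  proof -
    define y where "y = resolvent_col n (Hmat \<mu>) (Complex x \<epsilon>) i"
    define y' where "y' = resolvent_col n (Hmat \<mu>') (Complex x' \<epsilon>) i"
    \<comment> \<open>The residual: \<open>y - y'\<close> solves the equation at the parameters
      \<mu>, x with this right side. Bounding \<open>y'\<close> and then \<open>y - y'\<close> costs
      \<open>1 / \<epsilon>\<^sup>2\<close> each, which explains \<open>\<epsilon>^4\<close> in
      \<open>B\<close>.\<close>
    define f where "f = (\<lambda>r. complex_of_real (\<mu>' - \<mu>) * mv n (weight_entry L N W) y' r + complex_of_real (x - x') * y' r)"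
    have im: "Im (Complex x \<epsilon>) \<noteq> 0" "Im (Complex x' \<epsilon>) \<noteq> 0" using e by auto
    have "mv n (Hmat \<mu>) (\<lambda>r. y r - y' r) r - Complex x \<epsilon> * (y r - y' r) = f r" if "r < n" for r
    proof -
      have 1: "mv n (Hmat \<mu>) y r - Complex x \<epsilon> * y r = (if r = i then 1 else 0)"
        unfolding y_def by (rule resolvent_col_eq[OF herm_Hmat im(1) i that])
      have 2: "mv n (Hmat \<mu>') y' r - Complex x' \<epsilon> * y' r = (if r = i then 1 else 0)"
        unfolding y'_def by (rule resolvent_col_eq[OF herm_Hmat im(2) i that])
      have 3: "mv n (Hmat \<mu>) (\<lambda>r. y r - y' r) r = mv n (Hmat \<mu>) y r - mv n (Hmat \<mu>) y' r"
        by (simp add: mv_def right_diff_distrib sum_subtractf)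
      have 4: "Complex x \<epsilon> - Complex x' \<epsilon> = complex_of_real (x - x')" by (simp add: complex_eq_iff)
      have 5: "mv n (Hmat \<mu>') y' r - mv n (Hmat \<mu>) y' r = complex_of_real (\<mu>' - \<mu>) * mv n (weight_entry L N W) y' r"
        unfolding mv_Hmat by (simp add: left_diff_distrib)
      have "mv n (Hmat \<mu>) (\<lambda>r. y r - y' r) r - Complex x \<epsilon> * (y r - y' r)
         = (mv n (Hmat \<mu>) y r - Complex x \<epsilon> * y r) - (mv n (Hmat \<mu>') y' r - Complex x' \<epsilon> * y' r)
           + (mv n (Hmat \<mu>') y' r - mv n (Hmat \<mu>) y' r) + (Complex x \<epsilon> - Complex x' \<epsilon>) * y' r"
        unfolding 3 by (simp only: left_diff_distrib right_diff_distrib) simp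
      also have "\<dots> = f r" unfolding 1 2 5 4 f_def by simp
      finally show ?thesis .
    qed
    from resolvent_col_bound[OF herm_Hmat im(1) this]
    have "(cmod (y i - y' i))\<^sup>2 \<le> sqn n f / \<epsilon>\<^sup>2"
      using cmod_sq_le_sqn[OF i, of "\<lambda>r. y r - y' r"] by simp
    also have "sqn n f \<le> 2 * ((S + 1) * ((\<mu> - \<mu>')\<^sup>2 + (x - x')\<^sup>2) * (1 / \<epsilon>\<^sup>2))"
    proof -
      have y': "sqn n y' \<le> 1 / \<epsilon>\<^sup>2" unfolding y'_def using resolvent_col_norm[OF herm_Hmat im(2) i] by simp
      have "sqn n f \<le> 2 * ((\<mu>' - \<mu>)\<^sup>2 * sqn n (mv n (weight_entry L N W) y') + (x - x')\<^sup>2 * sqn n y')"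
        unfolding f_def by (rule order_trans[OF sqn_add_le]) (simp add: sqn_scale del: of_real_diff)
      also have "\<dots> \<le> 2 * ((\<mu>' - \<mu>)\<^sup>2 * (S * sqn n y') + (x - x')\<^sup>2 * sqn n y')"
        unfolding S_def by (intro mult_left_mono add_mono sqn_mv_le) auto
      also have "\<dots> = 2 * (((\<mu> - \<mu>')\<^sup>2 * S + (x - x')\<^sup>2) * sqn n y')"
        by (simp add: algebra_simps power2_commute[of \<mu>' \<mu>])
      also have "\<dots> \<le> 2 * (((S + 1) * ((\<mu> - \<mu>')\<^sup>2 + (x - x')\<^sup>2)) * (1 / \<epsilon>\<^sup>2))"
        using S0 by (intro mult_left_mono mult_mono y') (auto simp: algebra_simps)
      finally show ?thesis by simp
    qed
    finally have "(cmod (y i - y' i))\<^sup>2 \<le> 2 * ((S + 1) * ((\<mu> - \<mu>')\<^sup>2 + (x - x')\<^sup>2) * (1 / \<epsilon>\<^sup>2)) / \<epsilon>\<^sup>2"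
      by (simp add: divide_right_mono)
    also have "\<dots> = (2 * (S + 1) / \<epsilon>^4) * ((\<mu> - \<mu>')\<^sup>2 + (x - x')\<^sup>2)"
    proof -
      have "2 * (A * Q * (1 / \<epsilon>\<^sup>2)) / \<epsilon>\<^sup>2 = (2 * A / \<epsilon>^4) * Q" for A Q :: real
        by (simp add: power4_eq_xxxx power2_eq_square mult.assoc)
      then show ?thesis .
    qed
    finally have "cmod (y i - y' i) \<le> sqrt ((2 * (S + 1) / \<epsilon>^4) * ((\<mu> - \<mu>')\<^sup>2 + (x - x')\<^sup>2))"
      by (rule real_le_rsqrt)
    also have "\<dots> = B * dist (\<mu>, x) (\<mu>', x')"
      unfolding real_sqrt_mult B_def dist_prod_def by (simp add: dist_real_def)
    finally show ?thesis by (simp add: dist_norm y_def y'_def)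
  qed
  moreover have "0 \<le> B" using S0 by (simp add: B_def)
  ultimately have "B-lipschitz_on UNIV (\<lambda>p. resolvent_col n (Hmat (fst p)) (Complex (snd p) \<epsilon>) i i)"
    by (intro lipschitz_onI) (auto simp: split_paired_all)
  then show ?thesis by blast
qed

text \<open>Joint continuity later yields the joint measurability for exchanging integrals. It is
  drawn from resolvents, as the chosen eigenvectors may vary wildly with \<mu>.\<close>

lemma site1_green_continuous:
  assumes "0 < \<epsilon>" "0 < K"
  shows "continuous_on UNIV (\<lambda>p. site1_green K \<epsilon> (snd p) (fst p))"
proof -
  have "continuous_on UNIV (\<lambda>p. resolvent_col (K * L) (Hmat (fst p)) (Complex (snd p) \<epsilon>) i i)" if "i < L" for i
  proof -
    have "L \<le> K * L" using assms by simp
    with that have "i < K * L" by linarith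
    then show ?thesis using resolvent_col_lipschitz[OF assms(1)] lipschitz_on_continuous_on by blast
  qed
  then show ?thesis unfolding site1_green_eq_resolvent_col[OF assms(2)] by (intro continuous_intros) auto
qed

lemma site1_green_bounds:
  assumes "0 < \<epsilon>" "0 < K"
  shows "0 \<le> site1_green K \<epsilon> x \<mu>" "site1_green K \<epsilon> x \<mu> \<le> real L / \<epsilon>"
proof -
  show "0 \<le> site1_green K \<epsilon> x \<mu>" unfolding site1_green_def using assms by (intro sum_nonneg mult_nonneg_nonneg) auto
  have p: "poisson \<epsilon> t \<le> 1 / \<epsilon>" for t
  proof -
    have "\<epsilon> * \<epsilon> \<le> t\<^sup>2 + \<epsilon>\<^sup>2" by (simp add: power2_eq_square)
    then show ?thesis unfolding poisson_def using assms
      by (simp add: divide_le_eq pos_le_divide_eq add_nonneg_pos)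
  qed
  have "site1_green K \<epsilon> x \<mu> \<le> (\<Sum>k<K * L. (1 / \<epsilon>) * block_sqnorm L (eigvec_of (K * L) (Hmat \<mu>) k) 0)"
    unfolding site1_green_def by (intro sum_mono mult_right_mono p) auto
  also have "\<dots> = real L / \<epsilon>" unfolding sum_distrib_left[symmetric] sum_block_sqnorm_eigenvectors[OF assms(2)] by simp
  finally show "site1_green K \<epsilon> x \<mu> \<le> real L / \<epsilon>" .
qed

end

section \<open>The limit point case\<close>

definition flatten :: "nat \<Rightarrow> cseq \<Rightarrow> nat \<Rightarrow> complex" where
  "flatten L \<phi> r = \<phi> (r div L + 1) (r mod L)"

lemma flatten_block: "j < L \<Longrightarrow> flatten L \<phi> (m * L + j) = \<phi> (Suc m) j"
  by (simp add: flatten_def)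

lemma sqn_flatten: "sqn (K * L) (flatten L \<phi>) = (\<Sum>m<K. site_sqnorm L \<phi> (Suc m))"
  unfolding sqn_def sum_blocks site_sqnorm_def by (intro sum.cong refl) (simp add: flatten_block)

lemma site_sqnorm_nonneg [simp]: "0 \<le> site_sqnorm L \<phi> n"
  by (simp add: site_sqnorm_def sum_nonneg)

lemma site_sqnorm_zero: "valid_seq L \<phi> \<Longrightarrow> site_sqnorm L \<phi> 0 = 0"
  by (simp add: site_sqnorm_def valid_seq_def)

lemma sqn_flatten_le:
  assumes "summable (site_sqnorm L \<phi>)"
  shows "sqn (K * L) (flatten L \<phi>) \<le> (l2norm L \<phi>)\<^sup>2"
proof -
  have "sqn (K * L) (flatten L \<phi>) \<le> (\<Sum>n<Suc K. site_sqnorm L \<phi> n)"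
    unfolding sqn_flatten sum.lessThan_Suc_shift by simp
  also have "\<dots> \<le> (\<Sum>n. site_sqnorm L \<phi> n)" by (rule sum_le_suminf[OF assms]) auto
  also have "\<dots> = (l2norm L \<phi>)\<^sup>2" unfolding l2norm_def using suminf_nonneg[OF assms] by simp
  finally show ?thesis .
qed

lemma l2norm_less_sq:
  assumes "summable (site_sqnorm L \<phi>)" "l2norm L \<phi> < e"
  shows "(\<Sum>n. site_sqnorm L \<phi> n) < e\<^sup>2"
proof -
  have "0 \<le> (\<Sum>n. site_sqnorm L \<phi> n)" by (rule suminf_nonneg[OF assms(1)]) simp
  then have "(\<Sum>n. site_sqnorm L \<phi> n) = (l2norm L \<phi>)\<^sup>2" and "0 \<le> l2norm L \<phi>" by (auto simp: l2norm_def)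
  then show ?thesis using assms(2) by (simp add: power_strict_mono)
qed

lemma jac_eq_mv:
  assumes "Suc m < K" "i < L"
  shows "jac L T U \<phi> (Suc m) i = mv (K * L) (jacobi_entry L T U) (flatten L \<phi>) (m * L + i)"
proof -
  have a: "flatten L \<phi> (m * L + k) = \<phi> (Suc m) k" "flatten L \<phi> (Suc m * L + k) = \<phi> (Suc (Suc m)) k" if "k < L" for m k
    using flatten_block[OF that] by blast+
  have b: "flatten L \<phi> ((m - 1) * L + k) = \<phi> m k" if "k < L" "0 < m" for k
    using flatten_block[OF that(1), of \<phi> "m - 1"] that by simp
  have "mv (K * L) (jacobi_entry L T U) (flatten L \<phi>) (m * L + i) = (\<Sum>k<L. T (m + 2) $$ (i,k) * \<phi> (Suc (Suc m)) k)
    + (\<Sum>k<L. U (m + 1) $$ (i,k) * \<phi> (Suc m) k)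
    + (if 0 < m then (\<Sum>k<L. cnj (T (m + 1) $$ (k,i)) * \<phi> m k) else 0)"
    unfolding mv_jacobi_entry_block[OF assms] using a b by (auto intro!: arg_cong2[of _ _ _ _ "(+)"] sum.cong simp del: mult_Suc)
  also have "\<dots> = jac L T U \<phi> (Suc m) i"
    using assms(2) unfolding jac_def by (cases "0 < m") (simp_all add: sum.distrib)
  finally show ?thesis ..
qed

text \<open>With one more block the last row also has its right neighbour, and on this extra block
  the sequence is zero. Truncation is thus exact on such sequences.\<close>

lemma flatten_jac_eq_mv:
  assumes r: "r < K * L" and z: "\<And>n j. K \<le> n \<Longrightarrow> \<phi> n j = 0"
  shows "flatten L (jac L T U \<phi>) r = mv (K * L) (jacobi_entry L T U) (flatten L \<phi>) r"
proof -
  have L: "0 < L" using r by (cases L) auto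
  define m i where "m = r div L" and "i = r mod L"
  have ri: "r = m * L + i" "i < L" using L by (auto simp: m_def i_def)
  have "m < K" unfolding m_def using r by (rule less_mult_imp_div_less)
  have "flatten L (jac L T U \<phi>) r = jac L T U \<phi> (Suc m) i" unfolding ri(1) by (rule flatten_block[OF ri(2)])
  also have "\<dots> = mv (Suc K * L) (jacobi_entry L T U) (flatten L \<phi>) r"
    unfolding ri(1) using \<open>m < K\<close> ri(2) by (intro jac_eq_mv) auto
  also have "\<dots> = mv (K * L) (jacobi_entry L T U) (flatten L \<phi>) r"
  proof -
    have "flatten L \<phi> s = 0" if "K * L \<le> s" for s
      using that div_le_mono[of "K * L" s L] L by (simp add: flatten_def z)
    then show ?thesis unfolding mv_def by (intro sum.mono_neutral_right) auto
  qed
  finally show ?thesis .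
qed

lemma valid_jac: "valid_seq L (jac L T U \<phi>)"
  by (simp add: valid_seq_def jac_def)

lemma l2inner_finite:
  assumes "\<And>n j. n = 0 \<or> K < n \<Longrightarrow> a n j = 0 \<or> b n j = 0"
  shows "l2inner L a b = ip (K * L) (flatten L a) (flatten L b)"
proof -
  have "l2inner L a b = (\<Sum>n<Suc K. \<Sum>j<L. cnj (a n j) * b n j)"
    unfolding l2inner_def using assms by (intro suminf_finite sum.neutral) (auto simp: not_less)
  also have "\<dots> = (\<Sum>m<K. \<Sum>j<L. cnj (a (Suc m) j) * b (Suc m) j)"
    unfolding sum.lessThan_Suc_shift using assms by (auto intro!: sum.neutral)
  also have "\<dots> = ip (K * L) (flatten L a) (flatten L b)"
    unfolding ip_def sum_blocks by (intro sum.cong refl) (simp add: flatten_block)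
  finally show ?thesis .
qed

context block_jacobi
begin

text \<open>The maximal operator is contained in the adjoint: against a finitely supported sequence,
  summation by parts is hermiticity of a large truncation.\<close>

lemma in_adjoint_graph:
  assumes "l2 L \<psi>" "l2 L (jac L T V \<psi>)"
  shows "(\<psi>, jac L T V \<psi>) \<in> adjoint_graph L (min_graph L T V)"
proof -
  have "l2inner L (jac L T V \<phi>) \<psi> = l2inner L \<phi> (jac L T V \<psi>)" if fs: "finsupp L \<phi>" for \<phi>
  proof -
    obtain M where M: "\<And>n j. n > M \<Longrightarrow> \<phi> n j = 0" using fs unfolding finsupp_def by blast
    \<comment> \<open>The image of \<phi> reaches one site beyond M, and in the last row, where the
      truncation differs from the operator on \<psi>, \<phi> vanishes.\<close>
    define K where "K = M + 2"
    have v: "\<phi> 0 j = 0" "\<psi> 0 j = 0" for j using fs assms(1) by (auto simp: finsupp_def l2_def valid_seq_def)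
    have "jac L T V \<phi> n j = 0" if "n = 0 \<or> K < n" for n j
      using that M unfolding jac_def K_def by (auto intro!: sum.neutral)
    then have "l2inner L (jac L T V \<phi>) \<psi> = ip (K * L) (flatten L (jac L T V \<phi>)) (flatten L \<psi>)"
      by (intro l2inner_finite) auto
    also have "\<dots> = ip (K * L) (mv (K * L) (jacobi_entry L T V) (flatten L \<phi>)) (flatten L \<psi>)"
      by (intro ip_cong refl flatten_jac_eq_mv M) (auto simp: K_def)
    also have "\<dots> = ip (K * L) (flatten L \<phi>) (mv (K * L) (jacobi_entry L T V) (flatten L \<psi>))"
      by (rule herm_ip[OF herm_jacobi_entry, symmetric])
    also have "\<dots> = ip (K * L) (flatten L \<phi>) (flatten L (jac L T V \<psi>))"
    proof -
      have "cnj (flatten L \<phi> (m * L + j)) * mv (K * L) (jacobi_entry L T V) (flatten L \<psi>) (m * L + j) = cnj (flatten L \<phi> (m * L + j)) * flatten L (jac L T V \<psi>) (m * L + j)"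
        if "m < K" "j < L" for m j
      proof (cases "Suc m < K")
        case True
        then show ?thesis using jac_eq_mv[OF True that(2), of T V \<psi>] that(2) by (simp add: flatten_block)
      next
        case False
        then have "Suc m > M" using that by (simp add: K_def)
        then show ?thesis using M that(2) by (simp add: flatten_block)
      qed
      then show ?thesis unfolding ip_def sum_blocks by (intro sum.cong refl) auto
    qed
    also have "\<dots> = l2inner L \<phi> (jac L T V \<psi>)"
      using v M by (intro l2inner_finite[symmetric]) (auto simp: K_def)
    finally show ?thesis .
  qed
  then show ?thesis using assms unfolding adjoint_graph_def min_graph_def by auto
qed

definition Wop :: "real \<Rightarrow> cseq \<Rightarrow> cseq" where
  "Wop \<mu> \<phi> n j = (if 1 \<le> n \<and> n \<le> N \<and> j < L then complex_of_real \<mu> * (\<Sum>k<L. W n $$ (j,k) * \<phi> n k) else 0)"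

lemma jac_Vmu: "jac L T (Vmu N V W \<mu>) \<phi> n j = jac L T V \<phi> n j + Wop \<mu> \<phi> n j"
proof (cases "n = 0 \<or> L \<le> j")
  case False
  have "Vmu N V W \<mu> n $$ (j,k) = V n $$ (j,k) + (if 1 \<le> n \<and> n \<le> N then complex_of_real \<mu> * W n $$ (j,k) else 0)" if "k < L" for k
    using carrier_matD[OF W_carrier[of n]] that False by (auto simp: Vmu_def)
  then show ?thesis using False unfolding jac_def Wop_def
    by (auto simp: distrib_right sum.distrib sum_distrib_left mult.assoc)
qed (auto simp: jac_def Wop_def)

text \<open>The perturbation acts site by site with a common bound, so it preserves graph
  approximations.\<close>

lemma site_sqnorm_Wop: "\<exists>c\<ge>0. \<forall>\<phi> n. site_sqnorm L (Wop \<mu> \<phi>) n \<le> c * site_sqnorm L \<phi> n"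
proof -
  obtain B where B: "1 \<le> B" "\<forall>m\<in>{..N}. \<forall>i<L. \<forall>k<L. cmod (W m $$ (i,k)) \<le> B"
    using finite_family_bound[of "{..N}" L "\<lambda>m i k. W m $$ (i,k)"] by auto
  have "site_sqnorm L (Wop \<mu> \<phi>) n \<le> (\<mu>\<^sup>2 * (real L * B)\<^sup>2) * site_sqnorm L \<phi> n" for \<phi> n
  proof (cases "1 \<le> n \<and> n \<le> N")
    case True
    then have "site_sqnorm L (Wop \<mu> \<phi>) n = \<mu>\<^sup>2 * (\<Sum>i<L. (cmod (\<Sum>k<L. W n $$ (i,k) * \<phi> n k))\<^sup>2)"
      by (simp add: site_sqnorm_def Wop_def norm_mult power_mult_distrib flip: sum_distrib_left)
    also have "\<dots> \<le> \<mu>\<^sup>2 * ((real L * B)\<^sup>2 * (\<Sum>k<L. (cmod (\<phi> n k))\<^sup>2))"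
      using B True by (intro mult_left_mono matrix_sqn_le) auto
    finally show ?thesis by (simp add: site_sqnorm_def mult.assoc)
  next
    case False
    then have "site_sqnorm L (Wop \<mu> \<phi>) n = 0" by (auto simp: site_sqnorm_def Wop_def)
    then show ?thesis by simp
  qed
  then show ?thesis by (intro exI[of _ "\<mu>\<^sup>2 * (real L * B)\<^sup>2"]) auto
qed

end

lemma site_sqnorm_add_le: "site_sqnorm L (\<lambda>n j. x n j + y n j) n \<le> 2 * (site_sqnorm L x n + site_sqnorm L y n)"
  unfolding site_sqnorm_def sum.distrib[symmetric] sum_distrib_left by (intro sum_mono cmod_add_sq_le)

lemma summable_sqnorm_finite_change:
  assumes "summable (site_sqnorm L x)" "\<And>n j. n > M \<Longrightarrow> y n j = x n j"
  shows "summable (site_sqnorm L y)"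
proof -
  have "\<forall>\<^sub>F n in sequentially. site_sqnorm L y n = site_sqnorm L x n"
    using assms(2) by (intro eventually_sequentiallyI[of "Suc M"]) (simp add: site_sqnorm_def)
  then show ?thesis using assms(1) summable_cong by metis
qed

context block_jacobi
begin

text \<open>The limit point assumption concerns the operator at \<mu> = 0. The perturbation is
  bounded and lives on N sites, so \<psi> lies in the maximal domain of the unperturbed operator,
  and its approximants there also work for the perturbed one.\<close>

lemma in_graph_closure_Vmu:
  assumes lp: "ess_self_adjoint L (min_graph L T V)"
    and \<psi>: "l2 L \<psi>" and \<eta>: "l2 L (jac L T (Vmu N V W \<mu>) \<psi>)"
  shows "(\<psi>, jac L T (Vmu N V W \<mu>) \<psi>) \<in> graph_closure L (min_graph L T (Vmu N V W \<mu>))"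
proof -
  let ?U = "Vmu N V W \<mu>"
  have "summable (site_sqnorm L (jac L T V \<psi>))"
    by (rule summable_sqnorm_finite_change[of L "jac L T ?U \<psi>" N]) (use \<eta> in \<open>auto simp: l2_def jac_Vmu Wop_def\<close>)
  then have "l2 L (jac L T V \<psi>)" by (simp add: l2_def valid_jac)
  then have mem: "(\<psi>, jac L T V \<psi>) \<in> graph_closure L (min_graph L T V)"
    using in_adjoint_graph[OF \<psi>] lp by (simp add: ess_self_adjoint_def)
  obtain c where c: "0 \<le> c" "\<And>\<phi> n. site_sqnorm L (Wop \<mu> \<phi>) n \<le> c * site_sqnorm L \<phi> n"
    using site_sqnorm_Wop by blast
  have "\<exists>(a, b)\<in>min_graph L T ?U. l2norm L (\<lambda>n j. \<psi> n j - a n j) < e \<and> l2norm L (\<lambda>n j. jac L T ?U \<psi> n j - b n j) < e"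
    if "0 < e" for e
  proof -
    \<comment> \<open>The perturbed error satisfies: squared norm at most
      \<open>2 * (1 + c) * e'\<^sup>2\<close>. The added 1 makes this strictly less than
      \<open>e\<^sup>2\<close>.\<close>
    define e' where "e' = e / sqrt (2 * (1 + c) + 1)"
    have sq: "1 \<le> sqrt (2 * (1 + c) + 1)" using c by simp
    have e': "0 < e'" unfolding e'_def using that sq by (intro divide_pos_pos) linarith+
    have "e * 1 \<le> e * sqrt (2 * (1 + c) + 1)" using that sq by (intro mult_left_mono) auto
    then have "e' \<le> e" unfolding e'_def using sq by (subst pos_divide_le_eq) linarith+
    note e' = e' this
    obtain a where a: "finsupp L a" "l2norm L (\<lambda>n j. \<psi> n j - a n j) < e'" "l2norm L (\<lambda>n j. jac L T V \<psi> n j - jac L T V a n j) < e'"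
      using mem e'(1) unfolding graph_closure_def min_graph_def by auto
    obtain M where M: "\<And>n j. n > M \<Longrightarrow> a n j = 0" using a(1) unfolding finsupp_def by blast
    define x where "x = (\<lambda>n j. \<psi> n j - a n j)"
    define y where "y = (\<lambda>n j. jac L T V \<psi> n j - jac L T V a n j)"
    define w where "w = (\<lambda>n j. jac L T ?U \<psi> n j - jac L T ?U a n j)"
    have sx: "summable (site_sqnorm L x)"
      by (rule summable_sqnorm_finite_change[of L \<psi> M]) (use \<psi> M in \<open>auto simp: l2_def x_def\<close>)
    have ja: "jac L T V a n j = 0" if "n > M + 1" for n j
      using that M unfolding jac_def by (auto intro!: sum.neutral)
    have sy: "summable (site_sqnorm L y)"
      by (rule summable_sqnorm_finite_change[of L "jac L T V \<psi>" "M + 1"]) (use \<open>l2 L (jac L T V \<psi>)\<close> ja in \<open>auto simp: l2_def y_def\<close>)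
    have "w n j = y n j + Wop \<mu> x n j" for n j
      by (simp add: w_def y_def x_def jac_Vmu Wop_def right_diff_distrib sum_subtractf)
    then have "w = (\<lambda>n j. y n j + Wop \<mu> x n j)" by blast
    then have le: "site_sqnorm L w n \<le> 2 * (site_sqnorm L y n + c * site_sqnorm L x n)" for n
      using site_sqnorm_add_le[of L y "Wop \<mu> x" n] c(2)[of x n] by simp
    have s2: "summable (\<lambda>n. 2 * (site_sqnorm L y n + c * site_sqnorm L x n))"
      by (intro summable_mult summable_add sx sy)
    have sw: "summable (site_sqnorm L w)"
      by (rule summable_comparison_test'[OF s2]) (use le in simp)
    have nx: "(\<Sum>n. site_sqnorm L x n) < e'\<^sup>2" and ny: "(\<Sum>n. site_sqnorm L y n) < e'\<^sup>2"
      using l2norm_less_sq[OF sx] l2norm_less_sq[OF sy] a(2,3) by (auto simp: x_def y_def)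
    have "(\<Sum>n. site_sqnorm L w n) \<le> (\<Sum>n. 2 * (site_sqnorm L y n + c * site_sqnorm L x n))"
      by (rule suminf_le[OF le sw s2])
    also have "\<dots> = 2 * ((\<Sum>n. site_sqnorm L y n) + c * (\<Sum>n. site_sqnorm L x n))"
      by (simp add: suminf_mult suminf_add[symmetric] sx sy summable_mult summable_add)
    also have "\<dots> \<le> 2 * (e'\<^sup>2 + c * e'\<^sup>2)"
      using nx ny c by (intro mult_left_mono add_mono) auto
    also have "\<dots> < (2 * (1 + c) + 1) * e'\<^sup>2" using e'(1) by (simp add: algebra_simps)
    also have "\<dots> = e\<^sup>2" using c sq by (simp add: e'_def power_divide)
    finally have "l2norm L w < e" unfolding l2norm_def using that by (intro real_less_lsqrt) auto
    then show ?thesis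
      unfolding min_graph_def using a e' by (intro bexI[of _ "(a, jac L T ?U a)"]) (auto simp: w_def)
  qed
  then show ?thesis using \<psi> \<eta> unfolding graph_closure_def by blast
qed

end

section \<open>Convergence of the truncated Green functions\<close>

lemma flatten_site1: "i < L \<Longrightarrow> flatten L (site1_vec i) r = (if r = i then 1 else 0)"
  unfolding flatten_def site1_vec_def by (cases "r div L = 0") (auto simp: div_eq_0_iff)

lemma l2inner_site1: "i < L \<Longrightarrow> l2inner L (site1_vec i) \<psi> = \<psi> 1 i"
proof -
  assume i: "i < L"
  have "l2inner L (site1_vec i) \<psi> = ip (1 * L) (flatten L (site1_vec i)) (flatten L \<psi>)"
    by (rule l2inner_finite) (auto simp: site1_vec_def)
  also have "\<dots> = (\<Sum>r<L. if r = i then flatten L \<psi> r else 0)"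
    unfolding ip_def flatten_site1[OF i] by (intro sum.cong) auto
  also have "\<dots> = \<psi> 1 i" using i by (simp add: flatten_def)
  finally show ?thesis .
qed

context block_jacobi
begin

text \<open>Strong resolvent convergence. A finitely supported \<open>a\<close> near \<psi> in graph
  norm solves every large truncated equation up to a small residual, and the resolvent bound makes
  it close to the truncated solution.\<close>

lemma resolvent_col_tendsto:
  assumes cl: "(\<psi>, \<eta>) \<in> graph_closure L (min_graph L T (Vmu N V W \<mu>))"
    and eq: "\<And>n j. \<eta> n j - z * \<psi> n j = site1_vec i n j"
    and z: "Im z \<noteq> 0" and i: "i < L"
  shows "(\<lambda>K. resolvent_col (K * L) (Hmat \<mu>) z i i) \<longlonglongrightarrow> \<psi> 1 i"
proof (rule tendstoI)
  fix e :: real assume e: "0 < e"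
  let ?U = "Vmu N V W \<mu>"
  \<comment> \<open>The distance of \<open>a\<close> from the truncated solution is at most
    \<open>q * e'\<close>, and from \<psi> at site 1 less than \<open>e'\<close>; hence the divisor
    \<open>q + 1\<close> below.\<close>
  define q where "q = sqrt (2 * (1 + (cmod z)\<^sup>2)) / \<bar>Im z\<bar>"
  have q0: "0 \<le> q" by (simp add: q_def)
  define e' where "e' = e / (q + 1)"
  have e': "0 < e'" using e q0 by (simp add: e'_def)
  obtain a where a: "finsupp L a" "l2norm L (\<lambda>n j. \<psi> n j - a n j) < e'" "l2norm L (\<lambda>n j. \<eta> n j - jac L T ?U a n j) < e'"
    using cl e' unfolding graph_closure_def min_graph_def by auto
  obtain M where M: "\<And>n j. n > M \<Longrightarrow> a n j = 0" using a(1) unfolding finsupp_def by blast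
  define x where "x = (\<lambda>n j. \<psi> n j - a n j)"
  define h where "h = (\<lambda>n j. \<eta> n j - jac L T ?U a n j)"
  have l2: "l2 L \<psi>" "l2 L \<eta>" using cl by (auto simp: graph_closure_def)
  have ja: "jac L T ?U a n j = 0" if "n > M + 1" for n j
    using that M unfolding jac_def by (auto intro!: sum.neutral)
  have sx: "summable (site_sqnorm L x)"
    by (rule summable_sqnorm_finite_change[of L \<psi> M]) (use l2 M in \<open>auto simp: l2_def x_def\<close>)
  have sh: "summable (site_sqnorm L h)"
    by (rule summable_sqnorm_finite_change[of L \<eta> "M + 1"]) (use l2 ja in \<open>auto simp: l2_def h_def\<close>)
  have nn: "0 \<le> l2norm L x" "0 \<le> l2norm L h"
    using suminf_nonneg[OF sx] suminf_nonneg[OF sh] by (auto simp: l2norm_def)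
  have bx: "sqn (K * L) (flatten L x) \<le> e'\<^sup>2" and bh: "sqn (K * L) (flatten L h) \<le> e'\<^sup>2" for K
    using sqn_flatten_le[OF sx, of K] sqn_flatten_le[OF sh, of K] power_mono[OF less_imp_le nn(1), of e' 2]
      power_mono[OF less_imp_le nn(2), of e' 2] a(2,3) by (auto simp: x_def h_def)
  have "dist (resolvent_col (K * L) (Hmat \<mu>) z i i) (\<psi> 1 i) < e" if K: "M + 2 \<le> K" for K
  proof -
    let ?n = "K * L"
    have "L \<le> ?n" using K by simp
    with i have i': "i < ?n" by linarith
    define y where "y = resolvent_col ?n (Hmat \<mu>) z i"
    define f where "f = (\<lambda>r. flatten L h r + (- z) * flatten L x r)"
    have "mv ?n (Hmat \<mu>) (\<lambda>r. y r - flatten L a r) r - z * (y r - flatten L a r) = f r" if r: "r < ?n" for r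
    proof -
      have 1: "mv ?n (Hmat \<mu>) y r - z * y r = (if r = i then 1 else 0)"
        unfolding y_def by (rule resolvent_col_eq[OF herm_Hmat z i' r])
      have 2: "mv ?n (Hmat \<mu>) (flatten L a) r = flatten L (jac L T ?U a) r"
        unfolding jacobi_entry_Vmu[symmetric] by (rule flatten_jac_eq_mv[OF r, symmetric]) (use M K in auto)
      have 3: "(if r = i then 1 else 0) = flatten L \<eta> r - z * flatten L \<psi> r"
        using eq flatten_site1[OF i, of r] by (simp add: flatten_def)
      have 4: "mv ?n (Hmat \<mu>) (\<lambda>r. y r - flatten L a r) r = mv ?n (Hmat \<mu>) y r - mv ?n (Hmat \<mu>) (flatten L a) r"
        by (simp add: mv_def right_diff_distrib sum_subtractf)
      have "mv ?n (Hmat \<mu>) (\<lambda>r. y r - flatten L a r) r - z * (y r - flatten L a r)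
        = (mv ?n (Hmat \<mu>) y r - z * y r) - flatten L (jac L T ?U a) r + z * flatten L a r"
        unfolding 4 2 by (simp add: right_diff_distrib)
      also have "\<dots> = f r" unfolding 1 3 f_def by (simp add: flatten_def h_def x_def right_diff_distrib)
      finally show ?thesis .
    qed
    from resolvent_col_bound[OF herm_Hmat z this]
    have "(cmod (y i - flatten L a i))\<^sup>2 \<le> sqn ?n f / (Im z)\<^sup>2"
      using cmod_sq_le_sqn[OF i', of "\<lambda>r. y r - flatten L a r"] by simp
    also have "sqn ?n f \<le> 2 * (1 + (cmod z)\<^sup>2) * e'\<^sup>2"
    proof -
      have "sqn ?n f \<le> 2 * (sqn ?n (flatten L h) + (cmod z)\<^sup>2 * sqn ?n (flatten L x))"
        unfolding f_def by (rule order_trans[OF sqn_add_le]) (unfold sqn_scale, simp)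
      also have "\<dots> \<le> 2 * (e'\<^sup>2 + (cmod z)\<^sup>2 * e'\<^sup>2)"
        using bx bh by (intro mult_left_mono add_mono) auto
      finally show ?thesis by (simp add: algebra_simps)
    qed
    finally have "(cmod (y i - flatten L a i))\<^sup>2 \<le> 2 * (1 + (cmod z)\<^sup>2) * e'\<^sup>2 / (Im z)\<^sup>2"
      by (simp add: divide_right_mono)
    then have "cmod (y i - flatten L a i) \<le> sqrt (2 * (1 + (cmod z)\<^sup>2) * e'\<^sup>2 / (Im z)\<^sup>2)"
      by (rule real_le_rsqrt)
    also have "\<dots> = q * e'"
      unfolding real_sqrt_divide real_sqrt_mult q_def using e' by simp
    finally have 1: "cmod (y i - flatten L a i) \<le> q * e'" .
    have "(cmod (flatten L x i))\<^sup>2 \<le> (l2norm L x)\<^sup>2"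
      using cmod_sq_le_sqn[OF i', of "flatten L x"] sqn_flatten_le[OF sx, of K] by simp
    then have "cmod (flatten L x i) \<le> l2norm L x" using nn(1) by (rule power2_le_imp_le)
    then have 2: "cmod (flatten L x i) < e'" using a(2) by (simp add: x_def)
    have "y i - \<psi> 1 i = (y i - flatten L a i) - flatten L x i" using i by (simp add: flatten_def x_def)
    then have "cmod (y i - \<psi> 1 i) \<le> cmod (y i - flatten L a i) + cmod (flatten L x i)"
      by (metis norm_triangle_ineq4)
    also have "\<dots> < q * e' + e'" using 1 2 by linarith
    also have "\<dots> = (q + 1) * e'" by (simp add: distrib_right)
    also have "\<dots> = e" using q0 by (simp add: e'_def)
    finally show ?thesis by (simp add: dist_norm y_def)
  qed
  then show "\<forall>\<^sub>F K in sequentially. dist (resolvent_col (K * L) (Hmat \<mu>) z i i) (\<psi> 1 i) < e"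
    by (rule eventually_sequentiallyI)
qed

text \<open>A pointwise limit of truncated resolvent vectors is square summable and solves the equation,
  and essential self-adjointness puts it into the domain of the closure.\<close>

lemma resolvent_vector_exists:
  assumes lp: "ess_self_adjoint L (min_graph L T V)"
    and z: "Im z \<noteq> 0" and i: "i < L"
  shows "\<exists>\<psi> \<eta>. (\<psi>, \<eta>) \<in> graph_closure L (min_graph L T (Vmu N V W \<mu>)) \<and> (\<forall>n j. \<eta> n j - z * \<psi> n j = site1_vec i n j)"
proof -
  let ?U = "Vmu N V W \<mu>"
  define y where "y = (\<lambda>K r. if r < K * L then resolvent_col (K * L) (Hmat \<mu>) z i r else 0)"
  have L0: "0 < L" using i by simp
  have yn: "sqn (K * L) (y K) \<le> 1 / (Im z)\<^sup>2" for K
  proof (cases "K = 0")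
    case False
    then have "L \<le> K * L" by simp
    with i have "i < K * L" by linarith
    then have "sqn (K * L) (resolvent_col (K * L) (Hmat \<mu>) z i) \<le> 1 / (Im z)\<^sup>2" by (rule resolvent_col_norm[OF herm_Hmat z])
    then show ?thesis by (simp add: y_def sqn_def)
  qed (simp add: sqn_def)
  have yb: "cmod (y K r) \<le> 1 / \<bar>Im z\<bar>" for K r
  proof (cases "r < K * L")
    case True
    have "(cmod (y K r))\<^sup>2 \<le> (1 / \<bar>Im z\<bar>)\<^sup>2"
      using cmod_sq_le_sqn[OF True, of "y K"] yn[of K] by (simp add: power_divide)
    then show ?thesis by (rule power2_le_imp_le) simp
  qed (simp add: y_def)
  \<comment> \<open>A diagonal argument over the countably many coordinates, all bounded by 1/|Im
    z|.\<close>
  obtain k :: "nat \<Rightarrow> nat" where k: "strict_mono k" "\<And>r. \<exists>l. (\<lambda>n. y (k n) r) \<longlonglongrightarrow> l"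
    by (rule function_convergent_subsequence[of "UNIV :: nat set" y "1 / \<bar>Im z\<bar>"]) (use yb that in auto)
  then obtain l where l: "\<And>r. (\<lambda>n. y (k n) r) \<longlonglongrightarrow> l r" by metis
  have kl: "\<forall>\<^sub>F n in sequentially. m \<le> k n" for m
    using k(1) by (intro eventually_sequentiallyI[of m]) (meson le_trans strict_mono_imp_increasing)
  define \<psi> where "\<psi> = (\<lambda>n j. if n = 0 \<or> L \<le> j then 0 else l ((n - 1) * L + j))"
  have flatten: "flatten L \<psi> r = l r" for r using mod_less_divisor[OF L0, of r] by (simp add: flatten_def \<psi>_def)
  have v: "valid_seq L \<psi>" by (auto simp: valid_seq_def \<psi>_def)
  have ln: "sqn (m * L) l \<le> 1 / (Im z)\<^sup>2" for m
  proof (rule tendsto_upperbound)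
    show "(\<lambda>n. sqn (m * L) (y (k n))) \<longlonglongrightarrow> sqn (m * L) l"
      unfolding sqn_def by (intro tendsto_intros l)
    show "\<forall>\<^sub>F n in sequentially. sqn (m * L) (y (k n)) \<le> 1 / (Im z)\<^sup>2"
      using kl[of m]
    proof eventually_elim
      case (elim n)
      then have "m * L \<le> k n * L" by simp
      then have "sqn (m * L) (y (k n)) \<le> sqn (k n * L) (y (k n))"
        unfolding sqn_def by (intro sum_mono2) auto
      then show ?case using yn[of "k n"] by linarith
    qed
  qed simp
  have "summable (site_sqnorm L \<psi>)"
  proof (rule summableI_nonneg_bounded)
    fix m
    have "(\<Sum>n<m. site_sqnorm L \<psi> n) \<le> (\<Sum>n<Suc m. site_sqnorm L \<psi> n)" by simp
    also have "\<dots> = sqn (m * L) (flatten L \<psi>)"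
      unfolding sum.lessThan_Suc_shift sqn_flatten using site_sqnorm_zero[OF v] by simp
    also have "\<dots> \<le> 1 / (Im z)\<^sup>2" using ln by (simp add: flatten[abs_def])
    finally show "(\<Sum>n<m. site_sqnorm L \<psi> n) \<le> 1 / (Im z)\<^sup>2" .
  qed simp
  then have l2: "l2 L \<psi>" using v by (simp add: l2_def)
  have jac: "jac L T ?U \<psi> n j = z * \<psi> n j + site1_vec i n j" for n j
  proof (cases "n = 0 \<or> L \<le> j")
    case True
    then show ?thesis using i by (auto simp: jac_def \<psi>_def site1_vec_def)
  next
    case False
    then obtain m where n: "n = Suc m" by (cases n) auto
    have j: "j < L" using False by simp
    let ?r = "m * L + j" and ?K = "Suc (Suc m)"
    \<comment> \<open>A row involves at most three blocks, so for large truncations it is the same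
      finite equation and passes to the pointwise limit.\<close>
    have ev: "\<forall>\<^sub>F n in sequentially. mv (?K * L) (jacobi_entry L T ?U) (y (k n)) ?r - z * y (k n) ?r = (if ?r = i then 1 else 0)"
      using kl[of ?K]
    proof eventually_elim
      case (elim n)
      have "?r < Suc m * L" using j by simp
      also have "\<dots> \<le> k n * L" using elim by (intro mult_right_mono) auto
      finally have r: "?r < k n * L" .
      have "L \<le> k n * L" using elim by simp
      with i have i': "i < k n * L" by linarith
      have "mv (?K * L) (jacobi_entry L T ?U) (y (k n)) ?r = mv (k n * L) (jacobi_entry L T ?U) (y (k n)) ?r"
        using elim j by (subst (1 2) mv_jacobi_entry_block) auto
      also have "\<dots> = mv (k n * L) (Hmat \<mu>) (resolvent_col (k n * L) (Hmat \<mu>) z i) ?r"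
        unfolding jacobi_entry_Vmu mv_def by (intro sum.cong) (auto simp: y_def)
      finally show ?case using resolvent_col_eq[OF herm_Hmat z i' r, of \<mu>] r by (simp add: y_def)
    qed
    have lim: "(\<lambda>n. mv (?K * L) (jacobi_entry L T ?U) (y (k n)) ?r - z * y (k n) ?r) \<longlonglongrightarrow> mv (?K * L) (jacobi_entry L T ?U) l ?r - z * l ?r"
      unfolding mv_def by (intro tendsto_intros l)
    have "mv (?K * L) (jacobi_entry L T ?U) l ?r - z * l ?r = (if ?r = i then 1 else 0)"
      by (rule LIMSEQ_unique[OF lim tendsto_eventually[OF ev]])
    moreover have "jac L T ?U \<psi> n j = mv (?K * L) (jacobi_entry L T ?U) l ?r"
      unfolding n using jac_eq_mv[of m ?K j L T ?U \<psi>] j by (simp add: flatten[abs_def])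
    moreover have "l ?r = \<psi> n j" using j by (simp add: n \<psi>_def)
    moreover have "(if ?r = i then 1 else 0) = site1_vec i n j"
      using flatten_site1[OF i, of ?r] flatten_block[OF j, of "site1_vec i" m] n by simp
    ultimately show ?thesis by (simp add: algebra_simps)
  qed
  \<comment> \<open>Off site 1 the image is z times \<psi>, so it is square summable along with
    \<psi>.\<close>
  have "summable (site_sqnorm L (jac L T ?U \<psi>))"
  proof (rule summable_sqnorm_finite_change[of L "\<lambda>n j. z * \<psi> n j" 1])
    have "site_sqnorm L (\<lambda>n j. z * \<psi> n j) = (\<lambda>n. (cmod z)\<^sup>2 * site_sqnorm L \<psi> n)"
      by (rule ext) (simp add: site_sqnorm_def norm_mult power_mult_distrib sum_distrib_left)
    then show "summable (site_sqnorm L (\<lambda>n j. z * \<psi> n j))"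
      using l2 by (simp add: l2_def summable_mult)
  qed (simp add: jac site1_vec_def)
  then have "l2 L (jac L T ?U \<psi>)" by (simp add: l2_def valid_jac)
  from in_graph_closure_Vmu[OF lp l2 this] show ?thesis
    using jac by (intro exI[of _ \<psi>] exI[of _ "jac L T ?U \<psi>"]) simp
qed

text \<open>\<open>site1_spectral_diag\<close> constrains \<rho> only through vectors of the graph
  that solve the resolvent equation; their existence is what links \<rho> to the
  truncations.\<close>

lemma stieltjes_eq_limit:
  assumes lp: "ess_self_adjoint L (min_graph L T V)"
    and rho: "site1_spectral_diag L (graph_closure L (min_graph L T (Vmu N V W \<mu>))) \<rho>"
    and z: "Im z \<noteq> 0" and i: "i < L"
  shows "(\<lambda>K. resolvent_col (K * L) (Hmat \<mu>) z i i) \<longlonglongrightarrow> (\<integral>x. inverse (complex_of_real x - z) \<partial>\<rho> i)"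
proof -
  obtain \<psi> \<eta> where p: "(\<psi>, \<eta>) \<in> graph_closure L (min_graph L T (Vmu N V W \<mu>))" "\<And>n j. \<eta> n j - z * \<psi> n j = site1_vec i n j"
    using resolvent_vector_exists[OF lp z i] by blast
  have "l2inner L (site1_vec i) \<psi> = (\<integral>x. inverse (complex_of_real x - z) \<partial>\<rho> i)"
    using rho i z p unfolding site1_spectral_diag_def by blast
  then show ?thesis using resolvent_col_tendsto[OF p z i] by (simp add: l2inner_site1[OF i])
qed

end

section \<open>Averaging over the coupling\<close>

lemma poisson_even: "poisson \<epsilon> (t - x) = poisson \<epsilon> (x - t)"
  by (simp add: poisson_def power2_commute)

lemma poisson_measurable [measurable]: "poisson \<epsilon> \<in> borel_measurable borel"
  unfolding poisson_def[abs_def] by measurable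

lemma nn_integral_poisson_Icc:
  assumes "0 < \<epsilon>" "a \<le> b"
  shows "(\<integral>\<^sup>+x. ennreal (poisson \<epsilon> (t - x)) * indicator {a..b} x \<partial>lborel)
     = ennreal (arctan ((b - t) / \<epsilon>) - arctan ((a - t) / \<epsilon>))"
proof (rule nn_integral_FTC_Icc)
  show "(\<lambda>x. poisson \<epsilon> (t - x)) \<in> borel_measurable borel" by measurable
  show "((\<lambda>x. arctan ((x - t) / \<epsilon>)) has_real_derivative poisson \<epsilon> (t - x)) (at x)" for x
    unfolding poisson_even[of \<epsilon> t] by (rule arctan_scaled_derivative[OF assms(1)])
qed (use assms in auto)

definition psmooth :: "real \<Rightarrow> real set \<Rightarrow> real \<Rightarrow> ennreal" where
  "psmooth \<epsilon> U t = (\<integral>\<^sup>+x. ennreal (poisson \<epsilon> (t - x)) * indicator U x \<partial>lborel)"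

lemma psmooth_measurable [measurable]:
  assumes [measurable]: "U \<in> sets borel"
  shows "psmooth \<epsilon> U \<in> borel_measurable borel"
  unfolding psmooth_def[abs_def] by measurable

lemma psmooth_le_pi:
  assumes "0 < \<epsilon>" "U \<subseteq> {a..b}" "a \<le> b"
  shows "psmooth \<epsilon> U t \<le> ennreal pi"
proof -
  have "psmooth \<epsilon> U t \<le> (\<integral>\<^sup>+x. ennreal (poisson \<epsilon> (t - x)) * indicator {a..b} x \<partial>lborel)"
    unfolding psmooth_def using assms(2) by (intro nn_integral_mono mult_left_mono) (auto simp: indicator_def)
  also have "\<dots> \<le> ennreal pi"
    unfolding nn_integral_poisson_Icc[OF assms(1,3)]
    using arctan_ubound[of "(b - t) / \<epsilon>"] arctan_lbound[of "(a - t) / \<epsilon>"] by (intro ennreal_leI) linarith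
  finally show ?thesis .
qed

text \<open>An interval of radius \<epsilon> around t already carries half of the total mass pi, and
  pi/2 is at least 1.\<close>

lemma psmooth_ge_1:
  assumes "0 < \<epsilon>" "{t-\<epsilon>..t+\<epsilon>} \<subseteq> U"
  shows "1 \<le> psmooth \<epsilon> U t"
proof -
  have "1 \<le> pi / 2" using pi_gt3 by simp
  then have "1 \<le> ennreal (pi / 2)" by (metis ennreal_1 ennreal_leI)
  also have "pi / 2 = arctan (((t + \<epsilon>) - t) / \<epsilon>) - arctan (((t - \<epsilon>) - t) / \<epsilon>)"
    using assms(1) by (simp add: arctan_minus arctan_one)
  also have "ennreal \<dots> = (\<integral>\<^sup>+x. ennreal (poisson \<epsilon> (t - x)) * indicator {t-\<epsilon>..t+\<epsilon>} x \<partial>lborel)"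
    using assms(1) by (intro nn_integral_poisson_Icc[symmetric]) auto
  also have "\<dots> \<le> psmooth \<epsilon> U t"
    unfolding psmooth_def using assms(2) by (intro nn_integral_mono mult_left_mono) (auto simp: indicator_def)
  finally show ?thesis .
qed

text \<open>At distance at least d the kernel is bounded by \<epsilon> divided by the square of d,
  and a compact set has finite length.\<close>

lemma psmooth_tendsto_0:
  assumes K: "compact K" "t \<notin> K" and e: "\<And>n. 0 < e n" "e \<longlonglongrightarrow> 0"
  shows "(\<lambda>n. psmooth (e n) K t) \<longlonglongrightarrow> 0"
proof -
  obtain d where d: "0 < d" "\<And>x. x \<in> K \<Longrightarrow> d \<le> dist t x"
    using separate_point_closed[OF compact_imp_closed[OF K(1)] K(2)] by blast
  have fin: "emeasure lborel K < \<infinity>" using K(1) by (rule emeasure_compact_finite)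
  have le: "psmooth (e n) K t \<le> ennreal (e n / d\<^sup>2) * emeasure lborel K" for n
  proof -
    have "psmooth (e n) K t \<le> (\<integral>\<^sup>+x. ennreal (e n / d\<^sup>2) * indicator K x \<partial>lborel)"
      unfolding psmooth_def
    proof (rule nn_integral_mono)
      fix x
      have "poisson (e n) (t - x) \<le> e n / d\<^sup>2" if "x \<in> K"
      proof -
        have "d\<^sup>2 \<le> \<bar>t - x\<bar>\<^sup>2" using d that by (intro power_mono) (auto simp: dist_real_def)
        then have "d\<^sup>2 \<le> (t - x)\<^sup>2 + (e n)\<^sup>2" by (simp add: add_increasing2)
        then show ?thesis unfolding poisson_def using d e(1)[of n] by (intro divide_left_mono mult_pos_pos add_nonneg_pos) auto
      qed
      then show "ennreal (poisson (e n) (t - x)) * indicator K x \<le> ennreal (e n / d\<^sup>2) * indicator K x"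
        by (auto simp: indicator_def intro: ennreal_leI)
    qed
    also have "\<dots> = ennreal (e n / d\<^sup>2) * emeasure lborel K"
      using K(1) by (intro nn_integral_cmult_indicator) (auto intro: borel_compact)
    finally show ?thesis .
  qed
  have "(\<lambda>n. e n / d\<^sup>2) \<longlonglongrightarrow> 0" using tendsto_divide[OF e(2) tendsto_const[of "d\<^sup>2"]] d(1) by simp
  then have "(\<lambda>n. ennreal (e n / d\<^sup>2)) \<longlonglongrightarrow> ennreal 0" by (rule tendsto_ennrealI)
  then have "(\<lambda>n. ennreal (e n / d\<^sup>2) * emeasure lborel K) \<longlonglongrightarrow> ennreal 0 * emeasure lborel K"
    using fin by (intro tendsto_mult_ennreal tendsto_const) auto
  then have "(\<lambda>n. ennreal (e n / d\<^sup>2) * emeasure lborel K) \<longlonglongrightarrow> 0" by simp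
  then show ?thesis
    by (rule tendsto_sandwich[OF _ _ tendsto_const, rotated 2]) (use le in auto)
qed

text \<open>Both directions use only the measurability of the Poisson integrals of the family, never that
  of the measures themselves: the integral over the parameter is a lower integral, so it suffices to
  compare with Fatou's lemma on an open neighbourhood, and with the reverse Fatou lemma on a compact subset.\<close>

lemma averaged_null_sets_iff:
  fixes \<rho> :: "real \<Rightarrow> nat \<Rightarrow> real measure" and G :: "real \<Rightarrow> real \<Rightarrow> real \<Rightarrow> real"
  assumes sets: "\<And>\<mu> i. \<mu> \<in> {\<mu>0..\<mu>1} \<Longrightarrow> i < L \<Longrightarrow> sets (\<rho> \<mu> i) = sets borel"
    and fin: "\<And>\<mu> i. \<mu> \<in> {\<mu>0..\<mu>1} \<Longrightarrow> i < L \<Longrightarrow> finite_measure (\<rho> \<mu> i)"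
    and mass: "\<And>\<mu> i. \<mu> \<in> {\<mu>0..\<mu>1} \<Longrightarrow> i < L \<Longrightarrow> emeasure (\<rho> \<mu> i) UNIV \<le> 1"
    and poisson: "\<And>\<mu> \<epsilon> x. \<mu> \<in> {\<mu>0..\<mu>1} \<Longrightarrow> 0 < \<epsilon> \<Longrightarrow> (\<Sum>i<L. \<integral>\<^sup>+t. ennreal (poisson \<epsilon> (t - x)) \<partial>\<rho> \<mu> i) = ennreal (G \<epsilon> x \<mu>)"
    and meas: "\<And>\<epsilon>. 0 < \<epsilon> \<Longrightarrow> (\<lambda>p. G \<epsilon> (snd p) (fst p)) \<in> borel_measurable (borel \<Otimes>\<^sub>M borel)"
    and pos: "0 < \<delta>" "0 < \<epsilon>0" "0 < c"
    and bounds: "\<And>\<epsilon> x. 0 < \<epsilon> \<Longrightarrow> \<epsilon> < \<epsilon>0 \<Longrightarrow> x \<in> {E-\<delta><..<E+\<delta>} \<Longrightarrow>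
      ennreal c \<le> (\<integral>\<^sup>+\<mu>. ennreal (G \<epsilon> x \<mu>) * indicator {\<mu>0..\<mu>1} \<mu> \<partial>lborel) \<and>
      (\<integral>\<^sup>+\<mu>. ennreal (G \<epsilon> x \<mu>) * indicator {\<mu>0..\<mu>1} \<mu> \<partial>lborel) \<le> ennreal C"
    and \<Delta>: "\<Delta> \<in> sets borel" "\<Delta> \<subseteq> {E-\<delta><..<E+\<delta>}"
  shows "(\<integral>\<^sup>+ \<mu>\<in>{\<mu>0..\<mu>1}. (\<Sum>i<L. emeasure (\<rho> \<mu> i) \<Delta>) \<partial>lborel) = 0 \<longleftrightarrow> emeasure lborel \<Delta> = 0"
proof -
  define I where "I = {\<mu>0..\<mu>1}"
  have [measurable]: "I \<in> sets borel" by (simp add: I_def)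
  \<comment> \<open>The offset 2 keeps also the first term strictly below \<epsilon>0.\<close>
  define e where "e = (\<lambda>n::nat. \<epsilon>0 / real (n + 2))"
  have e0: "0 < e n" "e n < \<epsilon>0" for n
    using pos by (auto simp: e_def pos_divide_less_eq)
  have elim: "e \<longlonglongrightarrow> 0"
  proof -
    have "(\<lambda>n. \<epsilon>0 * inverse (real (Suc (Suc n)))) \<longlonglongrightarrow> \<epsilon>0 * 0"
      by (intro tendsto_mult tendsto_const LIMSEQ_Suc[OF LIMSEQ_inverse_real_of_nat])
    then show ?thesis by (simp add: e_def divide_inverse add.commute)
  qed
  have Gm [measurable]: "(\<lambda>p. G (e n) (snd p) (fst p)) \<in> borel_measurable (borel \<Otimes>\<^sub>M borel)" for n
    by (rule meas[OF e0(1)])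
  \<comment> \<open>The mediating quantity: by exchanging integrals it is the smoothed indicator of
    U integrated against the measures at \<mu> (\<open>S_rho\<close>), while its integral over \<mu>
    is the integral over U of a function between c and C (\<open>S_int\<close>).\<close>
  define S where "S = (\<lambda>n U \<mu>. (\<integral>\<^sup>+x. ennreal (G (e n) x \<mu>) * indicator U x \<partial>lborel) * indicator I \<mu>)"
  have Gm2: "(\<lambda>(\<mu>, x). ennreal (G (e n) x \<mu>) * indicator U x) \<in> borel_measurable (lborel \<Otimes>\<^sub>M lborel)"
    if [measurable]: "U \<in> sets borel" for n U
  proof -
    have "(\<lambda>p. ennreal (G (e n) (snd p) (fst p)) * indicator U (snd p)) \<in> borel_measurable (borel \<Otimes>\<^sub>M borel)"
      by measurable
    then show ?thesis by (simp add: case_prod_beta' cong: measurable_cong_sets sets_pair_measure_cong)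
  qed
  have Sm: "S n U \<in> borel_measurable borel" if U: "U \<in> sets borel" for n U
  proof -
    have "(\<lambda>\<mu>. \<integral>\<^sup>+x. ennreal (G (e n) x \<mu>) * indicator U x \<partial>lborel) \<in> borel_measurable lborel"
      using Gm2[OF U, of n] by (intro lborel.borel_measurable_nn_integral) auto
    then show ?thesis unfolding S_def by measurable
  qed
  have S_rho: "S n U \<mu> = (\<Sum>i<L. \<integral>\<^sup>+t. psmooth (e n) U t \<partial>\<rho> \<mu> i)"
    if [measurable]: "U \<in> sets borel" and \<mu>: "\<mu> \<in> I" for n U \<mu>
  proof -
    have "S n U \<mu> = (\<integral>\<^sup>+x. (\<Sum>i<L. (\<integral>\<^sup>+t. ennreal (poisson (e n) (t - x)) \<partial>\<rho> \<mu> i) * indicator U x) \<partial>lborel)"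
      unfolding S_def sum_distrib_right[symmetric] using poisson[OF _ e0(1)] \<mu> by (simp add: I_def)
    also have "\<dots> = (\<Sum>i<L. \<integral>\<^sup>+x. (\<integral>\<^sup>+t. ennreal (poisson (e n) (t - x)) \<partial>\<rho> \<mu> i) * indicator U x \<partial>lborel)"
    proof (rule nn_integral_sum)
      fix i assume "i \<in> {..<L}"
      then have i: "i < L" by simp
      interpret finite_measure "\<rho> \<mu> i" using fin[of \<mu> i] \<mu> i by (simp add: I_def)
      have [measurable_cong]: "sets (\<rho> \<mu> i) = sets borel" using sets[of \<mu> i] \<mu> i by (simp add: I_def)
      show "(\<lambda>x. (\<integral>\<^sup>+t. ennreal (poisson (e n) (t - x)) \<partial>\<rho> \<mu> i) * indicator U x) \<in> borel_measurable lborel"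
        by measurable
    qed
    also have "\<dots> = (\<Sum>i<L. \<integral>\<^sup>+t. psmooth (e n) U t \<partial>\<rho> \<mu> i)"
    proof (rule sum.cong[OF refl])
      fix i assume "i \<in> {..<L}"
      then have i: "i < L" by simp
      interpret finite_measure "\<rho> \<mu> i" using fin[of \<mu> i] \<mu> i by (simp add: I_def)
      have sb [measurable_cong]: "sets (\<rho> \<mu> i) = sets borel" using sets[of \<mu> i] \<mu> i by (simp add: I_def)
      interpret P: pair_sigma_finite "\<rho> \<mu> i" lborel ..
      have "(\<integral>\<^sup>+x. (\<integral>\<^sup>+t. ennreal (poisson (e n) (t - x)) \<partial>\<rho> \<mu> i) * indicator U x \<partial>lborel)
         = (\<integral>\<^sup>+x. (\<integral>\<^sup>+t. ennreal (poisson (e n) (t - x)) * indicator U x \<partial>\<rho> \<mu> i) \<partial>lborel)"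
        by (intro nn_integral_cong nn_integral_multc[symmetric]) measurable
      also have "\<dots> = (\<integral>\<^sup>+t. (\<integral>\<^sup>+x. ennreal (poisson (e n) (t - x)) * indicator U x \<partial>lborel) \<partial>\<rho> \<mu> i)"
        by (rule P.Fubini') measurable
      finally show "(\<integral>\<^sup>+x. (\<integral>\<^sup>+t. ennreal (poisson (e n) (t - x)) \<partial>\<rho> \<mu> i) * indicator U x \<partial>lborel) = (\<integral>\<^sup>+t. psmooth (e n) U t \<partial>\<rho> \<mu> i)"
        by (simp add: psmooth_def)
    qed
    finally show ?thesis .
  qed
  have S_int: "(\<integral>\<^sup>+\<mu>. S n U \<mu> \<partial>lborel) = (\<integral>\<^sup>+x. (\<integral>\<^sup>+\<mu>. ennreal (G (e n) x \<mu>) * indicator I \<mu> \<partial>lborel) * indicator U x \<partial>lborel)"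
    if U [measurable]: "U \<in> sets borel" for n U
  proof -
    have m: "(\<lambda>(\<mu>, x). ennreal (G (e n) x \<mu>) * indicator U x * indicator I \<mu>) \<in> borel_measurable (lborel \<Otimes>\<^sub>M lborel)"
    proof -
      have "(\<lambda>p. ennreal (G (e n) (snd p) (fst p)) * indicator U (snd p) * indicator I (fst p)) \<in> borel_measurable (borel \<Otimes>\<^sub>M borel)"
        by measurable
      then show ?thesis by (simp add: case_prod_beta' cong: measurable_cong_sets sets_pair_measure_cong)
    qed
    have mx [measurable]: "(\<lambda>x. G (e n) x \<mu>) \<in> borel_measurable borel" for \<mu>
      using measurable_compose[OF measurable_Pair[OF measurable_const[of \<mu>] measurable_ident] Gm[of n]] by simp
    have m\<mu> [measurable]: "(\<lambda>\<mu>. G (e n) x \<mu>) \<in> borel_measurable borel" for x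
      using measurable_compose[OF measurable_Pair[OF measurable_ident measurable_const[of x]] Gm[of n]] by simp
    have "(\<integral>\<^sup>+\<mu>. S n U \<mu> \<partial>lborel) = (\<integral>\<^sup>+\<mu>. (\<integral>\<^sup>+x. ennreal (G (e n) x \<mu>) * indicator U x * indicator I \<mu> \<partial>lborel) \<partial>lborel)"
      unfolding S_def by (intro nn_integral_cong nn_integral_multc[symmetric]) measurable
    also have "\<dots> = (\<integral>\<^sup>+x. (\<integral>\<^sup>+\<mu>. ennreal (G (e n) x \<mu>) * indicator U x * indicator I \<mu> \<partial>lborel) \<partial>lborel)"
      by (rule lborel_pair.Fubini'[OF m, symmetric])
    also have "\<dots> = (\<integral>\<^sup>+x. (\<integral>\<^sup>+\<mu>. ennreal (G (e n) x \<mu>) * indicator I \<mu> * indicator U x \<partial>lborel) \<partial>lborel)"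
      by (intro nn_integral_cong) (simp add: mult_ac)
    also have "\<dots> = (\<integral>\<^sup>+x. (\<integral>\<^sup>+\<mu>. ennreal (G (e n) x \<mu>) * indicator I \<mu> \<partial>lborel) * indicator U x \<partial>lborel)"
      by (intro nn_integral_cong nn_integral_multc) measurable
    finally show ?thesis .
  qed
  have S_upper: "(\<integral>\<^sup>+\<mu>. S n U \<mu> \<partial>lborel) \<le> ennreal C * emeasure lborel U"
    and S_lower: "ennreal c * emeasure lborel U \<le> (\<integral>\<^sup>+\<mu>. S n U \<mu> \<partial>lborel)"
    if U: "U \<in> sets borel" "U \<subseteq> {E-\<delta><..<E+\<delta>}" for n U
  proof -
    have "(\<integral>\<^sup>+\<mu>. S n U \<mu> \<partial>lborel) \<le> (\<integral>\<^sup>+x. ennreal C * indicator U x \<partial>lborel)"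
      unfolding S_int[OF U(1)] using bounds[OF e0] U(2) by (intro nn_integral_mono) (auto simp: indicator_def I_def)
    then show "(\<integral>\<^sup>+\<mu>. S n U \<mu> \<partial>lborel) \<le> ennreal C * emeasure lborel U"
      using U(1) by (simp add: nn_integral_cmult_indicator)
    have "(\<integral>\<^sup>+x. ennreal c * indicator U x \<partial>lborel) \<le> (\<integral>\<^sup>+\<mu>. S n U \<mu> \<partial>lborel)"
      unfolding S_int[OF U(1)] using bounds[OF e0] U(2) by (intro nn_integral_mono) (auto simp: indicator_def I_def)
    then show "ennreal c * emeasure lborel U \<le> (\<integral>\<^sup>+\<mu>. S n U \<mu> \<partial>lborel)"
      using U(1) by (simp add: nn_integral_cmult_indicator)
  qed
  \<comment> \<open>On an open set the smoothed indicators are eventually at least 1. Fatou is used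
    twice, for each measure and then for \<mu>; the factor L arises because every diagonal entry is
    bounded by the whole S.\<close>
  have upper: "(\<integral>\<^sup>+\<mu>. (\<Sum>i<L. emeasure (\<rho> \<mu> i) \<Delta>) * indicator I \<mu> \<partial>lborel) \<le> of_nat L * (ennreal C * emeasure lborel U)"
    if U: "open U" "\<Delta> \<subseteq> U" "U \<subseteq> {E-\<delta><..<E+\<delta>}" for U
  proof -
    have Ub [measurable]: "U \<in> sets borel" using U(1) by simp
    have "emeasure (\<rho> \<mu> i) \<Delta> \<le> liminf (\<lambda>n. S n U \<mu>)" if \<mu>: "\<mu> \<in> I" and i: "i < L" for \<mu> i
    proof -
      have sb [measurable_cong]: "sets (\<rho> \<mu> i) = sets borel" using sets[of \<mu> i] \<mu> i by (simp add: I_def)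
      have "1 \<le> liminf (\<lambda>n. psmooth (e n) U t)" if t: "t \<in> U" for t
      proof -
        obtain r where r: "0 < r" "cball t r \<subseteq> U" using U(1) t unfolding open_contains_cball by blast
        have "\<forall>\<^sub>F n in sequentially. e n < r" using order_tendstoD(2)[OF elim r(1)] .
        then have "\<forall>\<^sub>F n in sequentially. 1 \<le> psmooth (e n) U t"
        proof eventually_elim
          case (elim n)
          have "{t - e n..t + e n} \<subseteq> cball t r" using elim by (auto simp: dist_real_def)
          then show ?case using r(2) by (intro psmooth_ge_1 e0) auto
        qed
        then show ?thesis by (rule Liminf_bounded)
      qed
      then have ind: "indicator U t \<le> liminf (\<lambda>n. psmooth (e n) U t)" for t by (auto simp: indicator_def)
      have "emeasure (\<rho> \<mu> i) \<Delta> \<le> emeasure (\<rho> \<mu> i) U" using U(2) sb by (intro emeasure_mono) auto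
      also have "\<dots> = (\<integral>\<^sup>+t. indicator U t \<partial>\<rho> \<mu> i)" using sb by simp
      also have "\<dots> \<le> (\<integral>\<^sup>+t. liminf (\<lambda>n. psmooth (e n) U t) \<partial>\<rho> \<mu> i)" by (intro nn_integral_mono ind)
      also have "\<dots> \<le> liminf (\<lambda>n. \<integral>\<^sup>+t. psmooth (e n) U t \<partial>\<rho> \<mu> i)" by (intro nn_integral_liminf) measurable
      also have "\<dots> \<le> liminf (\<lambda>n. S n U \<mu>)"
      proof (intro Liminf_mono always_eventually allI)
        fix n
        show "(\<integral>\<^sup>+t. psmooth (e n) U t \<partial>\<rho> \<mu> i) \<le> S n U \<mu>"
          unfolding S_rho[OF Ub \<mu>] using i by (intro member_le_sum) auto
      qed
      finally show ?thesis .
    qed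
    then have "(\<Sum>i<L. emeasure (\<rho> \<mu> i) \<Delta>) \<le> (\<Sum>i<L. liminf (\<lambda>n. S n U \<mu>))" if "\<mu> \<in> I" for \<mu>
      using that by (intro sum_mono) auto
    then have "(\<integral>\<^sup>+\<mu>. (\<Sum>i<L. emeasure (\<rho> \<mu> i) \<Delta>) * indicator I \<mu> \<partial>lborel) \<le> (\<integral>\<^sup>+\<mu>. of_nat L * liminf (\<lambda>n. S n U \<mu>) \<partial>lborel)"
      by (intro nn_integral_mono) (auto simp: indicator_def)
    also have "\<dots> = of_nat L * (\<integral>\<^sup>+\<mu>. liminf (\<lambda>n. S n U \<mu>) \<partial>lborel)"
      using Sm[OF Ub] by (intro nn_integral_cmult) measurable
    also have "\<dots> \<le> of_nat L * liminf (\<lambda>n. \<integral>\<^sup>+\<mu>. S n U \<mu> \<partial>lborel)"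
      using Sm[OF Ub] by (intro mult_left_mono nn_integral_liminf) auto
    also have "\<dots> \<le> of_nat L * (ennreal C * emeasure lborel U)"
    proof (intro mult_left_mono)
      have "liminf (\<lambda>n. \<integral>\<^sup>+\<mu>. S n U \<mu> \<partial>lborel) \<le> liminf (\<lambda>n. ennreal C * emeasure lborel U)"
        using S_upper[OF Ub U(3)] by (intro Liminf_mono always_eventually) auto
      then show "liminf (\<lambda>n. \<integral>\<^sup>+\<mu>. S n U \<mu> \<partial>lborel) \<le> ennreal C * emeasure lborel U"
        by (simp add: Liminf_const)
    qed simp
    finally show ?thesis .
  qed
  have lower: "ennreal c * emeasure lborel K \<le> ennreal pi * (\<integral>\<^sup>+\<mu>. (\<Sum>i<L. emeasure (\<rho> \<mu> i) \<Delta>) * indicator I \<mu> \<partial>lborel)"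
    if K: "compact K" "K \<subseteq> \<Delta>" for K
  proof -
    have Kb [measurable]: "K \<in> sets borel" using K(1) by (rule borel_compact)
    have KJ: "K \<subseteq> {E-\<delta>..E+\<delta>}" using K(2) \<Delta>(2) by auto
    note ple = psmooth_le_pi[OF e0(1) KJ]
    have ple: "psmooth (e n) K t \<le> ennreal pi" for n t using ple pos by simp
    have Sb: "S n K \<mu> \<le> ennreal pi * of_nat L * indicator I \<mu>" for n \<mu>
    proof (cases "\<mu> \<in> I")
      case True
      have "S n K \<mu> \<le> (\<Sum>i<L. ennreal pi)"
        unfolding S_rho[OF Kb True]
      proof (rule sum_mono)
        fix i assume i: "i \<in> {..<L}"
        have "(\<integral>\<^sup>+t. psmooth (e n) K t \<partial>\<rho> \<mu> i) \<le> (\<integral>\<^sup>+t. ennreal pi \<partial>\<rho> \<mu> i)" by (intro nn_integral_mono ple)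
        also have "\<dots> = ennreal pi * emeasure (\<rho> \<mu> i) UNIV"
          using sets_eq_imp_space_eq[OF sets[of \<mu> i]] i True by (simp add: I_def)
        also have "\<dots> \<le> ennreal pi * 1" using mass[of \<mu> i] i True by (intro mult_left_mono) (auto simp: I_def)
        finally show "(\<integral>\<^sup>+t. psmooth (e n) K t \<partial>\<rho> \<mu> i) \<le> ennreal pi" by simp
      qed
      then show ?thesis using True by (simp add: mult.commute)
    qed (simp add: S_def)
    have "limsup (\<lambda>n. S n K \<mu>) \<le> ennreal pi * (\<Sum>i<L. emeasure (\<rho> \<mu> i) K)" if \<mu>: "\<mu> \<in> I" for \<mu>
    proof -
      \<comment> \<open>The part of the smoothed mass off K. It tends to 0 by dominated convergence,
        while on K the kernel mass pi is an upper bound.\<close>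
      define r where "r = (\<lambda>n. \<Sum>i<L. \<integral>\<^sup>+t. psmooth (e n) K t * indicator (- K) t \<partial>\<rho> \<mu> i)"
      have r0: "r \<longlonglongrightarrow> (\<Sum>i<L. 0)"
        unfolding r_def
      proof (intro tendsto_sum)
        fix i assume "i \<in> {..<L}"
        then have i: "i < L" by simp
        interpret finite_measure "\<rho> \<mu> i" using fin[of \<mu> i] \<mu> i by (simp add: I_def)
        have sb [measurable_cong]: "sets (\<rho> \<mu> i) = sets borel" using sets[of \<mu> i] \<mu> i by (simp add: I_def)
        have "(\<lambda>n. \<integral>\<^sup>+t. psmooth (e n) K t * indicator (- K) t \<partial>\<rho> \<mu> i) \<longlonglongrightarrow> (\<integral>\<^sup>+t. 0 \<partial>\<rho> \<mu> i)"
        proof (rule nn_integral_dominated_convergence[where w = "\<lambda>_. ennreal pi"])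
          show "AE t in \<rho> \<mu> i. psmooth (e n) K t * indicator (- K) t \<le> ennreal pi" for n
            using ple by (intro always_eventually) (auto simp: indicator_def)
          show "(\<integral>\<^sup>+t. ennreal pi \<partial>\<rho> \<mu> i) < \<infinity>"
            using emeasure_finite[of "space (\<rho> \<mu> i)"]
              by (simp add: ennreal_mult_eq_top_iff less_top[symmetric])
          show "AE t in \<rho> \<mu> i. (\<lambda>n. psmooth (e n) K t * indicator (- K) t) \<longlonglongrightarrow> 0"
          proof (intro always_eventually allI)
            fix t
            show "(\<lambda>n. psmooth (e n) K t * indicator (- K) t) \<longlonglongrightarrow> 0"
              using psmooth_tendsto_0[OF K(1) _ e0(1) elim, of t] by (cases "t \<in> K") auto
          qed
        qed measurable
        then show "(\<lambda>n. \<integral>\<^sup>+t. psmooth (e n) K t * indicator (- K) t \<partial>\<rho> \<mu> i) \<longlonglongrightarrow> 0" by simp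
      qed
      have "S n K \<mu> \<le> ennreal pi * (\<Sum>i<L. emeasure (\<rho> \<mu> i) K) + r n" for n
        unfolding S_rho[OF Kb \<mu>] r_def sum_distrib_left sum.distrib[symmetric]
      proof (rule sum_mono)
        fix i assume "i \<in> {..<L}"
        then have i: "i < L" by simp
        have sb [measurable_cong]: "sets (\<rho> \<mu> i) = sets borel" using sets[of \<mu> i] \<mu> i by (simp add: I_def)
        have "(\<integral>\<^sup>+t. psmooth (e n) K t \<partial>\<rho> \<mu> i) \<le> (\<integral>\<^sup>+t. ennreal pi * indicator K t + psmooth (e n) K t * indicator (- K) t \<partial>\<rho> \<mu> i)"
          using ple by (intro nn_integral_mono) (auto simp: indicator_def)
        also have "\<dots> = (\<integral>\<^sup>+t. ennreal pi * indicator K t \<partial>\<rho> \<mu> i) + (\<integral>\<^sup>+t. psmooth (e n) K t * indicator (- K) t \<partial>\<rho> \<mu> i)"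
          by (intro nn_integral_add) measurable
        also have "(\<integral>\<^sup>+t. ennreal pi * indicator K t \<partial>\<rho> \<mu> i) = ennreal pi * emeasure (\<rho> \<mu> i) K"
          using sb by (intro nn_integral_cmult_indicator) simp
        finally show "(\<integral>\<^sup>+t. psmooth (e n) K t \<partial>\<rho> \<mu> i) \<le> ennreal pi * emeasure (\<rho> \<mu> i) K + (\<integral>\<^sup>+t. psmooth (e n) K t * indicator (- K) t \<partial>\<rho> \<mu> i)" .
      qed
      then have "limsup (\<lambda>n. S n K \<mu>) \<le> limsup (\<lambda>n. ennreal pi * (\<Sum>i<L. emeasure (\<rho> \<mu> i) K) + r n)"
        by (intro Limsup_mono always_eventually) auto
      also have "\<dots> = ennreal pi * (\<Sum>i<L. emeasure (\<rho> \<mu> i) K) + (\<Sum>i<L. 0)"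
        by (intro lim_imp_Limsup tendsto_add tendsto_const r0) simp
      finally show ?thesis by simp
    qed
    then have ptw: "ennreal (1 / pi) * limsup (\<lambda>n. S n K \<mu>) \<le> (\<Sum>i<L. emeasure (\<rho> \<mu> i) \<Delta>) * indicator I \<mu>" for \<mu>
    proof (cases "\<mu> \<in> I")
      case True
      have "ennreal (1 / pi) * limsup (\<lambda>n. S n K \<mu>) \<le> ennreal (1 / pi) * (ennreal pi * (\<Sum>i<L. emeasure (\<rho> \<mu> i) K))"
        using \<open>\<And>\<mu>. \<mu> \<in> I \<Longrightarrow> limsup (\<lambda>n. S n K \<mu>) \<le> ennreal pi * (\<Sum>i<L. emeasure (\<rho> \<mu> i) K)\<close>[OF True]
        by (intro mult_left_mono) auto
      also have "\<dots> = (\<Sum>i<L. emeasure (\<rho> \<mu> i) K)"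
        by (simp add: mult.assoc[symmetric] ennreal_mult[symmetric])
      also have "\<dots> \<le> (\<Sum>i<L. emeasure (\<rho> \<mu> i) \<Delta>)"
        using K(2) \<Delta>(1) sets[of \<mu>] True by (intro sum_mono emeasure_mono) (auto simp: I_def)
      finally show ?thesis using True by simp
    next
      case False
      then have "(\<lambda>n. S n K \<mu>) = (\<lambda>n. 0)" by (auto simp: S_def)
      then show ?thesis by (simp add: Limsup_const)
    qed
    have "ennreal c * emeasure lborel K = limsup (\<lambda>n::nat. ennreal c * emeasure lborel K)" by (simp add: Limsup_const)
    also have "\<dots> \<le> limsup (\<lambda>n. \<integral>\<^sup>+\<mu>. S n K \<mu> \<partial>lborel)"
      using S_lower[OF Kb] K(2) \<Delta>(2) by (intro Limsup_mono always_eventually) auto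
    also have "\<dots> \<le> (\<integral>\<^sup>+\<mu>. limsup (\<lambda>n. S n K \<mu>) \<partial>lborel)"
    proof (rule nn_integral_limsup[where w = "\<lambda>\<mu>. ennreal pi * of_nat L * indicator I \<mu>"])
      show "(\<integral>\<^sup>+\<mu>. ennreal pi * of_nat L * indicator I \<mu> \<partial>lborel) < \<infinity>"
      proof -
        have "emeasure lborel I < \<infinity>" unfolding I_def by (rule emeasure_compact_finite) simp
        then show ?thesis by (simp add: nn_integral_cmult_indicator ennreal_mult_less_top less_top ennreal_of_nat_eq_real_of_nat flip: ennreal_mult)
      qed
    qed (use Sm[OF Kb] Sb in auto)
    \<comment> \<open>The constant is pulled out of the integral of the measurable limsup, so that
      the averaged integrand is afterwards reached by monotonicity alone.\<close>
    also have "\<dots> = ennreal pi * (ennreal (1 / pi) * (\<integral>\<^sup>+\<mu>. limsup (\<lambda>n. S n K \<mu>) \<partial>lborel))"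
      by (simp add: mult.assoc[symmetric] ennreal_mult[symmetric])
    also have "\<dots> = ennreal pi * (\<integral>\<^sup>+\<mu>. ennreal (1 / pi) * limsup (\<lambda>n. S n K \<mu>) \<partial>lborel)"
      using Sm[OF Kb] by (subst nn_integral_cmult) auto
    also have "\<dots> \<le> ennreal pi * (\<integral>\<^sup>+\<mu>. (\<Sum>i<L. emeasure (\<rho> \<mu> i) \<Delta>) * indicator I \<mu> \<partial>lborel)"
      by (intro mult_left_mono nn_integral_mono ptw) auto
    finally show ?thesis .
  qed
  have "(\<integral>\<^sup>+\<mu>. (\<Sum>i<L. emeasure (\<rho> \<mu> i) \<Delta>) * indicator I \<mu> \<partial>lborel) = 0" if null: "emeasure lborel \<Delta> = 0"
  proof -
    have "(\<integral>\<^sup>+\<mu>. (\<Sum>i<L. emeasure (\<rho> \<mu> i) \<Delta>) * indicator I \<mu> \<partial>lborel) \<le> 0 + ennreal a" if a: "0 < a" for a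
    proof -
      \<comment> \<open>Chosen so that \<open>L * C * \<eta>\<close> stays below a; the absolute
        value and the added 1 keep the denominator positive.\<close>
      define \<eta> where "\<eta> = a / (real L * \<bar>C\<bar> + 1)"
      have den: "0 < real L * \<bar>C\<bar> + 1" by (simp add: add_nonneg_pos)
      have \<eta>: "0 < \<eta>" unfolding \<eta>_def using a den by simp
      obtain U0 where U0: "open U0" "\<Delta> \<subseteq> U0" "emeasure lborel (U0 - \<Delta>) < \<eta>"
        using outer_regular_lborel[OF \<Delta>(1) \<eta>] by blast
      define U where "U = U0 \<inter> {E-\<delta><..<E+\<delta>}"
      have U: "open U" "\<Delta> \<subseteq> U" "U \<subseteq> {E-\<delta><..<E+\<delta>}" using U0 \<Delta>(2) by (auto simp: U_def)
      have "emeasure lborel U \<le> emeasure lborel ((U0 - \<Delta>) \<union> \<Delta>)"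
        using U0(1) \<Delta>(1) by (intro emeasure_mono) (auto simp: U_def)
      also have "\<dots> \<le> emeasure lborel (U0 - \<Delta>) + emeasure lborel \<Delta>"
        using U0(1) \<Delta>(1) by (intro emeasure_subadditive) auto
      also have "\<dots> \<le> ennreal \<eta>" using U0(3) null by simp
      finally have "(\<integral>\<^sup>+\<mu>. (\<Sum>i<L. emeasure (\<rho> \<mu> i) \<Delta>) * indicator I \<mu> \<partial>lborel) \<le> of_nat L * (ennreal C * ennreal \<eta>)"
        by (intro order_trans[OF upper[OF U]] mult_left_mono) auto
      also have "\<dots> \<le> ennreal (real L) * (ennreal \<bar>C\<bar> * ennreal \<eta>)"
        unfolding ennreal_of_nat_eq_real_of_nat by (intro mult_left_mono mult_right_mono ennreal_leI) auto
      also have "\<dots> = ennreal (real L * (\<bar>C\<bar> * \<eta>))" using \<eta> by (simp add: ennreal_mult)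
      also have "\<dots> \<le> ennreal a"
      proof (rule ennreal_leI)
        have "real L * (\<bar>C\<bar> * \<eta>) \<le> (real L * \<bar>C\<bar> + 1) * \<eta>" using \<eta> by (simp add: distrib_right mult.assoc)
        also have "\<dots> = a" using den by (simp add: \<eta>_def)
        finally show "real L * (\<bar>C\<bar> * \<eta>) \<le> a" .
      qed
      finally show ?thesis by simp
    qed
    then have "(\<integral>\<^sup>+\<mu>. (\<Sum>i<L. emeasure (\<rho> \<mu> i) \<Delta>) * indicator I \<mu> \<partial>lborel) \<le> 0"
      by (rule ennreal_le_epsilon)
    then show ?thesis by simp
  qed
  moreover have "emeasure lborel \<Delta> = 0" if zero: "(\<integral>\<^sup>+\<mu>. (\<Sum>i<L. emeasure (\<rho> \<mu> i) \<Delta>) * indicator I \<mu> \<partial>lborel) = 0"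
  proof -
    have K0: "emeasure lborel K = 0" if "compact K" "K \<subseteq> \<Delta>" for K
      using lower[OF that] pos(3) unfolding zero by (simp add: ennreal_eq_0_iff)
    have "emeasure lborel \<Delta> \<le> 0 + ennreal a" if a: "0 < a" for a
    proof -
      \<comment> \<open>Inner regularity by complements: removing an open superset of B from the
        closed interval leaves a compact subset of \<Delta>, and little of \<Delta> is lost.\<close>
      define B where "B = {E-\<delta>..E+\<delta>} - \<Delta>"
      have B: "B \<in> sets borel" using \<Delta>(1) by (simp add: B_def)
      obtain U where U: "open U" "B \<subseteq> U" "emeasure lborel (U - B) < a"
        using outer_regular_lborel[OF B a] by blast
      define K where "K = {E-\<delta>..E+\<delta>} - U"
      have K: "compact K" "K \<subseteq> \<Delta>" using U(1,2) by (auto simp: K_def B_def intro: compact_diff)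
      have Kb: "K \<in> sets borel" using K(1) by (rule borel_compact)
      have "emeasure lborel \<Delta> \<le> emeasure lborel (K \<union> (U - B))"
        using U(1) B Kb \<Delta>(2) by (intro emeasure_mono) (auto simp: K_def B_def)
      also have "\<dots> \<le> emeasure lborel K + emeasure lborel (U - B)"
        using U(1) B Kb by (intro emeasure_subadditive) auto
      finally show ?thesis using U(3) K0[OF K] by simp
    qed
    then have "emeasure lborel \<Delta> \<le> 0" by (rule ennreal_le_epsilon)
    then show ?thesis by simp
  qed
  ultimately show ?thesis unfolding I_def by blast
qed

section \<open>Stieltjes transforms, total mass, and the conclusion\<close>

lemma norm_inverse_resolvent_le:
  assumes "0 < \<epsilon>"
  shows "norm (inverse (complex_of_real t - Complex x \<epsilon>)) \<le> 1 / \<epsilon>"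
proof -
  have "\<epsilon> \<le> cmod (complex_of_real t - Complex x \<epsilon>)"
    using abs_Im_le_cmod[of "complex_of_real t - Complex x \<epsilon>"] assms by simp
  then show ?thesis using assms by (simp add: norm_inverse divide_inverse le_imp_inverse_le)
qed

lemma Im_inverse_resolvent: "Im (inverse (complex_of_real t - Complex x \<epsilon>)) = poisson \<epsilon> (t - x)"
  by (simp add: poisson_def)

lemma Im_stieltjes:
  assumes fin: "finite_measure M" and sb [measurable_cong]: "sets M = sets borel" and e: "0 < \<epsilon>"
  shows "integrable M (\<lambda>t. poisson \<epsilon> (t - x))"
    and "Im (\<integral>t. inverse (complex_of_real t - Complex x \<epsilon>) \<partial>M) = (\<integral>t. poisson \<epsilon> (t - x) \<partial>M)"
    and "(\<integral>\<^sup>+t. ennreal (poisson \<epsilon> (t - x)) \<partial>M) = ennreal (Im (\<integral>t. inverse (complex_of_real t - Complex x \<epsilon>) \<partial>M))"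
proof -
  interpret finite_measure M by (rule fin)
  have m: "(\<lambda>t. inverse (complex_of_real t - Complex x \<epsilon>)) \<in> borel_measurable M" by measurable
  have i: "integrable M (\<lambda>t. inverse (complex_of_real t - Complex x \<epsilon>))"
    using norm_inverse_resolvent_le[OF e] by (intro integrable_const_bound[where B = "1 / \<epsilon>"] m) auto
  from integrable_bounded_linear[OF bounded_linear_Im i]
  show p: "integrable M (\<lambda>t. poisson \<epsilon> (t - x))" by (simp only: Im_inverse_resolvent)
  show q: "Im (\<integral>t. inverse (complex_of_real t - Complex x \<epsilon>) \<partial>M) = (\<integral>t. poisson \<epsilon> (t - x) \<partial>M)"
    using integral_bounded_linear[OF bounded_linear_Im i] by (simp only: Im_inverse_resolvent)
  show "(\<integral>\<^sup>+t. ennreal (poisson \<epsilon> (t - x)) \<partial>M) = ennreal (Im (\<integral>t. inverse (complex_of_real t - Complex x \<epsilon>) \<partial>M))"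
    unfolding q using e by (intro nn_integral_eq_integral p) auto
qed

context block_jacobi
begin

lemma site1_green_tendsto_stieltjes:
  assumes lp: "ess_self_adjoint L (min_graph L T V)"
    and rho: "site1_spectral_diag L (graph_closure L (min_graph L T (Vmu N V W \<mu>))) \<rho>"
    and e: "0 < \<epsilon>"
  shows "(\<lambda>K. site1_green (Suc K) \<epsilon> x \<mu>) \<longlonglongrightarrow> (\<Sum>i<L. Im (\<integral>t. inverse (complex_of_real t - Complex x \<epsilon>) \<partial>\<rho> i))"
proof -
  have "(\<lambda>K. resolvent_col (Suc K * L) (Hmat \<mu>) (Complex x \<epsilon>) i i) \<longlonglongrightarrow> (\<integral>t. inverse (complex_of_real t - Complex x \<epsilon>) \<partial>\<rho> i)" if "i < L" for i
    using stieltjes_eq_limit[OF lp rho _ that, of "Complex x \<epsilon>"] e by (intro LIMSEQ_Suc) auto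
  then show ?thesis
    unfolding site1_green_eq_resolvent_col[OF zero_less_Suc] by (intro tendsto_sum tendsto_Im) auto
qed

text \<open>The hypotheses give finite measures only; a bound uniform in \<mu> is needed for
  domination. At z = i y the truncated resolvents give y times the Poisson integral at most 1, the
  integrand tends to 1 as y grows, and Fatou concludes.\<close>

lemma spectral_diag_mass:
  assumes lp: "ess_self_adjoint L (min_graph L T V)"
    and rho: "site1_spectral_diag L (graph_closure L (min_graph L T (Vmu N V W \<mu>))) \<rho>"
    and i: "i < L"
  shows "emeasure (\<rho> i) UNIV \<le> 1"
proof -
  have fin: "finite_measure (\<rho> i)" and sb [measurable_cong]: "sets (\<rho> i) = sets borel"
    using rho i by (auto simp: site1_spectral_diag_def)
  have sp: "space (\<rho> i) = UNIV" using sets_eq_imp_space_eq[OF sb] by simp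
  define y where "y = (\<lambda>n::nat. real (Suc n))"
  have y0: "0 < y n" for n by (simp add: y_def)
  have le: "(\<integral>\<^sup>+t. ennreal (y n * poisson (y n) t) \<partial>\<rho> i) \<le> 1" for n
  proof -
    define z where "z = Complex 0 (y n)"
    have z: "Im z \<noteq> 0" using y0[of n] by (simp add: z_def)
    have lim: "(\<lambda>K. Im (resolvent_col (Suc K * L) (Hmat \<mu>) z i i)) \<longlonglongrightarrow> Im (\<integral>t. inverse (complex_of_real t - z) \<partial>\<rho> i)"
      using stieltjes_eq_limit[OF lp rho z i] by (intro tendsto_Im LIMSEQ_Suc)
    have "Im (resolvent_col (Suc K * L) (Hmat \<mu>) z i i) \<le> 1 / y n" for K
    proof -
      have i': "i < Suc K * L" using i by (simp add: trans_less_add1)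
      have "(cmod (resolvent_col (Suc K * L) (Hmat \<mu>) z i i))\<^sup>2 \<le> (1 / y n)\<^sup>2"
        using cmod_sq_le_sqn[OF i', of "resolvent_col (Suc K * L) (Hmat \<mu>) z i"] resolvent_col_norm[OF herm_Hmat z i', of \<mu>]
        by (simp add: z_def power_divide)
      then have "cmod (resolvent_col (Suc K * L) (Hmat \<mu>) z i i) \<le> 1 / y n"
        by (rule power2_le_imp_le) (use y0[of n] in simp)
      then show ?thesis using abs_Im_le_cmod[of "resolvent_col (Suc K * L) (Hmat \<mu>) z i i"] by linarith
    qed
    then have "Im (\<integral>t. inverse (complex_of_real t - z) \<partial>\<rho> i) \<le> 1 / y n"
      by (intro LIMSEQ_le_const2[OF lim]) auto
    then have im: "y n * Im (\<integral>t. inverse (complex_of_real t - z) \<partial>\<rho> i) \<le> 1"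
      using y0[of n] by (simp add: pos_le_divide_eq mult.commute)
    have "(\<integral>\<^sup>+t. ennreal (y n * poisson (y n) t) \<partial>\<rho> i) = ennreal (y n) * (\<integral>\<^sup>+t. ennreal (poisson (y n) (t - 0)) \<partial>\<rho> i)"
      using y0[of n] by (subst nn_integral_cmult[symmetric]) (auto simp: ennreal_mult)
    also have "\<dots> = ennreal (y n) * ennreal (Im (\<integral>t. inverse (complex_of_real t - z) \<partial>\<rho> i))"
      unfolding Im_stieltjes(3)[OF fin sb y0] z_def ..
    also have "\<dots> = ennreal (y n * Im (\<integral>t. inverse (complex_of_real t - z) \<partial>\<rho> i))"
      using y0[of n] by (intro ennreal_mult'[symmetric]) simp
    also have "\<dots> \<le> 1" using im by (metis ennreal_1 ennreal_leI)
    finally show ?thesis .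
  qed
  have lim1: "(\<lambda>n. ennreal (y n * poisson (y n) t)) \<longlonglongrightarrow> 1" for t
  proof -
    have "(\<lambda>n. y n * poisson (y n) t) \<longlonglongrightarrow> 1"
    proof -
      have "(\<lambda>n. 1 / (t\<^sup>2 * (inverse (y n))\<^sup>2 + 1)) \<longlonglongrightarrow> 1 / (t\<^sup>2 * 0\<^sup>2 + 1)"
        unfolding y_def by (intro tendsto_intros LIMSEQ_inverse_real_of_nat) simp
      moreover have "1 / (t\<^sup>2 * (inverse (y n))\<^sup>2 + 1) = y n * poisson (y n) t" for n
        using y0[of n] by (simp add: poisson_def power2_eq_square field_simps)
      ultimately show ?thesis by simp
    qed
    then show ?thesis by (metis ennreal_1 tendsto_ennrealI)
  qed
  have "emeasure (\<rho> i) UNIV = (\<integral>\<^sup>+t. 1 \<partial>\<rho> i)" using sp by simp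
  also have "\<dots> = (\<integral>\<^sup>+t. liminf (\<lambda>n. ennreal (y n * poisson (y n) t)) \<partial>\<rho> i)"
    using lim_imp_Liminf[OF _ lim1] by (intro nn_integral_cong) simp
  also have "\<dots> \<le> liminf (\<lambda>n. \<integral>\<^sup>+t. ennreal (y n * poisson (y n) t) \<partial>\<rho> i)"
    by (intro nn_integral_liminf) measurable
  also have "\<dots> \<le> liminf (\<lambda>n::nat. 1 :: ennreal)"
    using le by (intro Liminf_mono always_eventually) auto
  finally show ?thesis by (simp add: Liminf_const)
qed

lemma site1_green_nn_integral:
  assumes "0 < \<epsilon>" "\<mu>0 \<le> \<mu>1"
  shows "\<exists>G. (site1_green (Suc K) \<epsilon> x has_integral G) {\<mu>0..\<mu>1} \<and>
    (\<integral>\<^sup>+\<mu>. ennreal (site1_green (Suc K) \<epsilon> x \<mu>) * indicator {\<mu>0..\<mu>1} \<mu> \<partial>lborel) = ennreal G"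
proof -
  have "continuous_on UNIV (\<lambda>\<mu>. (\<mu>, x))" by (intro continuous_intros)
  then have "continuous_on UNIV (site1_green (Suc K) \<epsilon> x)"
    using continuous_on_compose2[OF site1_green_continuous[OF assms(1) zero_less_Suc], of UNIV "\<lambda>\<mu>. (\<mu>, x)" K] by simp
  then have c: "continuous_on {\<mu>0..\<mu>1} (site1_green (Suc K) \<epsilon> x)" by (rule continuous_on_subset) auto
  define f where "f = (\<lambda>\<mu>. indicator {\<mu>0..\<mu>1} \<mu> * site1_green (Suc K) \<epsilon> x \<mu>)"
  have i: "integrable lborel f"
    using borel_integrable_compact[OF _ c] by (simp add: f_def)
  have "(f has_integral (integral\<^sup>L lborel f)) UNIV" by (rule has_integral_integral_lborel[OF i])
  moreover have "f = (\<lambda>\<mu>. if \<mu> \<in> {\<mu>0..\<mu>1} then site1_green (Suc K) \<epsilon> x \<mu> else 0)"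
    by (auto simp: f_def indicator_def)
  ultimately have "(site1_green (Suc K) \<epsilon> x has_integral (integral\<^sup>L lborel f)) {\<mu>0..\<mu>1}"
    by (simp only: has_integral_restrict_UNIV)
  moreover have "(\<integral>\<^sup>+\<mu>. ennreal (site1_green (Suc K) \<epsilon> x \<mu>) * indicator {\<mu>0..\<mu>1} \<mu> \<partial>lborel) = (\<integral>\<^sup>+\<mu>. ennreal (f \<mu>) \<partial>lborel)"
    by (intro nn_integral_cong) (auto simp: f_def indicator_def)
  moreover have "\<dots> = ennreal (integral\<^sup>L lborel f)"
    using site1_green_bounds(1)[OF assms(1) zero_less_Suc] by (intro nn_integral_eq_integral[OF i]) (auto simp: f_def)
  ultimately show ?thesis by auto
qed

end

theorem theorem5:
  fixes L N :: nat
    and T V W :: "nat \<Rightarrow> complex mat"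
    and n0 :: nat and E \<mu>0 \<mu>1 :: real
    and \<rho> :: "real \<Rightarrow> nat \<Rightarrow> real measure"
  assumes L_pos: "1 \<le> L"
    and T: "\<And>n. 2 \<le> n \<Longrightarrow> T n \<in> carrier_mat L L \<and> invertible_mat (T n)"
    and V: "\<And>n. 1 \<le> n \<Longrightarrow> hermitian_mat L (V n)"
    and limit_point: "ess_self_adjoint L (min_graph L T V)"
    and W: "\<And>n. 1 \<le> n \<Longrightarrow> n \<le> N \<Longrightarrow> real_psd L (W n)"
    and n0: "1 \<le> n0" "n0 < N"
    and Wpos: "pos_def L (W n0)" "pos_def L (W (n0 + 1))"
    and I: "\<mu>0 \<le> \<mu>1"
    and pass: "2 * L \<le> card {k \<in> {1..N * L}.
                 kth_eig (HN L N T V W \<mu>0) k < E \<and> E < kth_eig (HN L N T V W \<mu>1) k}"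
    and rho: "\<And>\<mu>. \<mu> \<in> {\<mu>0..\<mu>1} \<Longrightarrow>
        site1_spectral_diag L (graph_closure L (min_graph L T (Vmu N V W \<mu>))) (\<rho> \<mu>)"
  shows "\<exists>\<epsilon>>0. \<forall>\<Delta>\<in>sets borel. \<Delta> \<subseteq> {E - \<epsilon> <..< E + \<epsilon>} \<longrightarrow>
           ((\<integral>\<^sup>+ \<mu>\<in>{\<mu>0..\<mu>1}. (\<Sum>i<L. emeasure (\<rho> \<mu> i) \<Delta>) \<partial>lborel) = 0
             \<longleftrightarrow> emeasure lborel \<Delta> = 0)"
proof -
  interpret block_jacobi L N T V W n0
    by unfold_locales (rule L_pos T V W n0 Wpos; assumption)+
  from site1_green_integral_bounds[OF I pass] obtain \<delta> \<epsilon>0 c C where pos: "0 < \<delta>" "0 < \<epsilon>0" "0 < c"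
    and b': "\<forall>K>N. \<forall>\<epsilon>. 0 < \<epsilon> \<longrightarrow> \<epsilon> < \<epsilon>0 \<longrightarrow> (\<forall>x\<in>{E-\<delta><..<E+\<delta>}. \<forall>G.
      (site1_green K \<epsilon> x has_integral G) {\<mu>0..\<mu>1} \<longrightarrow> c \<le> G \<and> G \<le> C)"
    by (elim exE conjE) (rule that)
  note b = b'[rule_format]
  \<comment> \<open>As a limit of jointly continuous functions, G is jointly measurable for all
    \<mu>, including those outside the interval, where nothing is assumed about \<rho>.\<close>
  define G where "G = (\<lambda>\<epsilon> x \<mu>. lim (\<lambda>K. site1_green (Suc K) \<epsilon> x \<mu>))"
  have Gs: "G \<epsilon> x \<mu> = (\<Sum>i<L. Im (\<integral>t. inverse (complex_of_real t - Complex x \<epsilon>) \<partial>\<rho> \<mu> i))"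
    if "\<mu> \<in> {\<mu>0..\<mu>1}" "0 < \<epsilon>" for \<epsilon> x \<mu>
    unfolding G_def by (rule limI[OF site1_green_tendsto_stieltjes[OF limit_point rho[OF that(1)] that(2)]])
  have Gl: "(\<lambda>K. site1_green (Suc K) \<epsilon> x \<mu>) \<longlonglongrightarrow> G \<epsilon> x \<mu>"
    if "\<mu> \<in> {\<mu>0..\<mu>1}" "0 < \<epsilon>" for \<epsilon> x \<mu>
    unfolding Gs[OF that] by (rule site1_green_tendsto_stieltjes[OF limit_point rho[OF that(1)] that(2)])
  have fin: "finite_measure (\<rho> \<mu> i)" and sb: "sets (\<rho> \<mu> i) = sets borel" if "\<mu> \<in> {\<mu>0..\<mu>1}" "i < L" for \<mu> i
    using rho[OF that(1)] that(2) by (auto simp: site1_spectral_diag_def)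
  have poisson: "(\<Sum>i<L. \<integral>\<^sup>+t. ennreal (poisson \<epsilon> (t - x)) \<partial>\<rho> \<mu> i) = ennreal (G \<epsilon> x \<mu>)"
    if \<mu>: "\<mu> \<in> {\<mu>0..\<mu>1}" and e: "0 < \<epsilon>" for \<mu> \<epsilon> x
  proof -
    have "0 \<le> Im (\<integral>t. inverse (complex_of_real t - Complex x \<epsilon>) \<partial>\<rho> \<mu> i)" if "i < L" for i
      unfolding Im_stieltjes(2)[OF fin[OF \<mu> that] sb[OF \<mu> that] e] using e by (intro integral_nonneg_AE) auto
    then have "ennreal (G \<epsilon> x \<mu>) = (\<Sum>i<L. ennreal (Im (\<integral>t. inverse (complex_of_real t - Complex x \<epsilon>) \<partial>\<rho> \<mu> i)))"
      unfolding Gs[OF \<mu> e] by (intro sum_ennreal[symmetric]) auto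
    also have "\<dots> = (\<Sum>i<L. \<integral>\<^sup>+t. ennreal (poisson \<epsilon> (t - x)) \<partial>\<rho> \<mu> i)"
      using Im_stieltjes(3)[OF fin[OF \<mu>] sb[OF \<mu>] e] by (intro sum.cong) auto
    finally show ?thesis ..
  qed
  have gm: "(\<lambda>p. site1_green (Suc K) \<epsilon> (snd p) (fst p)) \<in> borel_measurable (borel \<Otimes>\<^sub>M borel)" if "0 < \<epsilon>" for K \<epsilon>
    using borel_measurable_continuous_onI[OF site1_green_continuous[OF that zero_less_Suc]] by (simp add: borel_prod)
  then have Gm: "(\<lambda>p. G \<epsilon> (snd p) (fst p)) \<in> borel_measurable (borel \<Otimes>\<^sub>M borel)" if "0 < \<epsilon>" for \<epsilon>
    unfolding G_def using that by (intro borel_measurable_lim_metric) auto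
  have bounds: "ennreal c \<le> (\<integral>\<^sup>+\<mu>. ennreal (G \<epsilon> x \<mu>) * indicator {\<mu>0..\<mu>1} \<mu> \<partial>lborel) \<and>
      (\<integral>\<^sup>+\<mu>. ennreal (G \<epsilon> x \<mu>) * indicator {\<mu>0..\<mu>1} \<mu> \<partial>lborel) \<le> ennreal C"
    if e: "0 < \<epsilon>" "\<epsilon> < \<epsilon>0" and x: "x \<in> {E-\<delta><..<E+\<delta>}" for \<epsilon> x
  proof -
    let ?f = "\<lambda>K \<mu>. ennreal (site1_green (Suc K) \<epsilon> x \<mu>) * indicator {\<mu>0..\<mu>1} \<mu>"
    have mx: "(\<lambda>\<mu>. site1_green (Suc K) \<epsilon> x \<mu>) \<in> borel_measurable borel" for K
      using measurable_compose[OF measurable_Pair[OF measurable_ident measurable_const[of x]] gm[OF e(1), of K]] by simp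
    have mG: "(\<lambda>\<mu>. G \<epsilon> x \<mu>) \<in> borel_measurable borel"
      using measurable_compose[OF measurable_Pair[OF measurable_ident measurable_const[of x]] Gm[OF e(1)]] by simp
    \<comment> \<open>For fixed \<epsilon> the truncated Green functions are dominated by
      L/\<epsilon>, so the bounds c and C, which are uniform in K, survive the limit.\<close>
    have lim: "(\<lambda>K. \<integral>\<^sup>+\<mu>. ?f K \<mu> \<partial>lborel) \<longlonglongrightarrow> (\<integral>\<^sup>+\<mu>. ennreal (G \<epsilon> x \<mu>) * indicator {\<mu>0..\<mu>1} \<mu> \<partial>lborel)"
    proof (rule nn_integral_dominated_convergence[where w = "\<lambda>\<mu>. ennreal (real L / \<epsilon>) * indicator {\<mu>0..\<mu>1} \<mu>"])
      show "AE \<mu> in lborel. ?f K \<mu> \<le> ennreal (real L / \<epsilon>) * indicator {\<mu>0..\<mu>1} \<mu>" for K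
        using site1_green_bounds(2)[OF e(1) zero_less_Suc]
        by (intro always_eventually allI mult_right_mono ennreal_leI) auto
      show "(\<integral>\<^sup>+\<mu>. ennreal (real L / \<epsilon>) * indicator {\<mu>0..\<mu>1} \<mu> \<partial>lborel) < \<infinity>"
        using I by (simp add: nn_integral_cmult_indicator ennreal_mult_less_top)
      show "AE \<mu> in lborel. (\<lambda>K. ?f K \<mu>) \<longlonglongrightarrow> ennreal (G \<epsilon> x \<mu>) * indicator {\<mu>0..\<mu>1} \<mu>"
      proof (intro always_eventually allI)
        fix \<mu>
        show "(\<lambda>K. ?f K \<mu>) \<longlonglongrightarrow> ennreal (G \<epsilon> x \<mu>) * indicator {\<mu>0..\<mu>1} \<mu>"
        proof (cases "\<mu> \<in> {\<mu>0..\<mu>1}")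
          case True
          then show ?thesis using tendsto_ennrealI[OF Gl[OF True e(1), of x]] by simp
        qed simp
      qed
    qed (use mx mG in auto)
    have "ennreal c \<le> (\<integral>\<^sup>+\<mu>. ?f K \<mu> \<partial>lborel) \<and> (\<integral>\<^sup>+\<mu>. ?f K \<mu> \<partial>lborel) \<le> ennreal C" if "N \<le> K" for K
    proof -
      obtain F where F: "(site1_green (Suc K) \<epsilon> x has_integral F) {\<mu>0..\<mu>1}" "(\<integral>\<^sup>+\<mu>. ?f K \<mu> \<partial>lborel) = ennreal F"
        using site1_green_nn_integral[OF e(1) I] by blast
      have "c \<le> F \<and> F \<le> C" using that by (intro b[OF _ e x F(1)]) simp
      then show ?thesis unfolding F(2) by (auto intro: ennreal_leI)
    qed
    then show ?thesis
      by (intro conjI LIMSEQ_le_const[OF lim] LIMSEQ_le_const2[OF lim]) auto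
  qed
  show ?thesis
  proof (intro exI[of _ \<delta>] conjI ballI impI)
    fix \<Delta> :: "real set" assume \<Delta>: "\<Delta> \<in> sets borel" "\<Delta> \<subseteq> {E - \<delta><..<E + \<delta>}"
    show "(\<integral>\<^sup>+ \<mu>\<in>{\<mu>0..\<mu>1}. (\<Sum>i<L. emeasure (\<rho> \<mu> i) \<Delta>) \<partial>lborel) = 0 \<longleftrightarrow> emeasure lborel \<Delta> = 0"
      by (rule averaged_null_sets_iff[OF sb fin spectral_diag_mass[OF limit_point rho] poisson Gm pos bounds \<Delta>])
  qed (rule pos)
qed

end
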